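(* Let $K_0=\frac{(a,b;q)_\infty}{(q;q)_\infty}$, take $c=\max(|a|,|b|)$, and let $M_q(a,b)$ be a positive constant such that $$|u(t)|\le M_q(a,b)\,(-cq|t|;q)_\infty\qquad\text{for all }t\text{ in the half-plane }\Re t\ge0.$$ Take $N$ a positive integer with $N>1-\frac{\ln c}{\ln q}$ and, for $e\in\{E,\theta,\lambda\}$, define the remainder $R_{N,e}$ via $$\mathrm{U}_{q,e}(a,b;z)=\sum_{n=0}^{N-1}\frac{(a,b;q)_n}{(q;q)_n}\,q^{-\binom n2}(-z)^n+R_{N,e}(a,b;z).$$ (i) In the half-plane $\Re z\ge0$, $$|R_{N,e}(a,b;z)|\le|z^N|\,|K_0|\,\frac{M_q(a,b)\,q^{-\binom N2}}{(cq^N;q)_\infty}$$ for all three cases $e=E,\theta,\lambda$. In the case $e=\lambda$, this bound holds for $\lambda>0$, and the condition $N>1-\frac{\ln c}{\ln q}$ is not required. (ii) In the sectors $|\arg z|\in(\frac\pi2,\pi)$, $$|R_{N,E}(a,b;z)|\le|z^N|\,|K_0|\,\frac{M_q(a,b)\exp\left(\frac{-\zeta^2}{2\ln q}\right)q^{-\binom N2}}{(cq^N;q)_\infty},$$ $$|R_{N,\theta}(a,b;z)|\le|z^N|\,|K_0|\,\frac{M_q(a,b)\exp\left(\frac{-\zeta^2}{2\ln q}\right)q^{-\binom N2}}{(cq^N;q)_\infty\,(\hat q^2;\hat q^2)_\infty^3}\left(\frac{1+\sqrt{\hat q}}{1-\sqrt{\hat q}}\right),$$ with $\zeta=|\arg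 z|-\frac\pi2$, and (with $\lambda>0$) $$|R_{N,\lambda}(a,b;z)|\le|z^N|\,|K_0|\,\frac{M_q(a,b)\,q^{-\binom N2}}{(cq^N;q)_\infty\,|\sin\xi|},$$ where $\xi=\arg z$.
   Context: Throughout $0<q<1$, $\hat q=e^{2\pi^2/\ln q}$, and $a,b$ are complex parameters; $(a;p)_\infty=\prod_{n\ge0}(1-ap^n)$, $(a;q)_n=(a;q)_\infty/(aq^n;q)_\infty$, $(a_1,\dots,a_k;q)_n=\prod_j(a_j;q)_n$ (also for $n=\infty$), $C_q=1/\sqrt{-2\pi\ln q}$, $$E_q(\tau)=\exp\left(\frac{\ln^2(\tau/\sqrt q)}{2\ln q}\right),\qquad\theta_q(\tau)=(q,-\tau,-q/\tau;q)_\infty=\sum_{n=-\infty}^\infty q^{\binom n2}\tau^n.$$ Let ${}_2\phi_1\!\left({a,b\atop0};q;x\right)=\sum_{n\ge0}\frac{(a,b;q)_n}{(q;q)_n}x^n$ for $|x|<1$, extended by analytic continuation in $x$, and ${}_1\phi_1\!\left({a\atop b};q;x\right)=\sum_{n\ge0}\frac{(a;q)_n}{(b,q;q)_n}(-1)^nq^{\binom n2}x^n$. The functions are defined by $$\mathrm{U}_{q,E}(a,b;z)=C_q\int_0^\infty{}_2\phi_1\!\left({a,b\atop0};q;-t\right)E_q\!\left(\tfrac tz\right)\frac{dt}t,\qquad\mathrm{U}_{q,\theta}(a,b;z)=\frac{-1}{\ln q}\int_0^\infty\frac{{}_2\phi_1\!\left({a,b\atop0};q;-t\right)}{\theta_q(t/z)}\frac{dt}t,$$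 $$\mathrm{U}_{q,\lambda}(a,b;z)=\sum_{n=-\infty}^\infty\frac{{}_2\phi_1\!\left({a,b\atop0};q;-q^n\lambda\right)}{\theta_q(q^n\lambda/z)},$$ where $\lambda$ is a free parameter; in $E_q(t/z)$ the logarithm is $\ln t-\ln|z|-i\arg z-\frac12\ln q$. The function $u$ is $$u(t)=(-abt;q)_\infty\;{}_2\phi_1\!\left({\frac qa,\frac qb\atop0};q;-abt\right)=(-aqt;q)_\infty\;{}_1\phi_1\!\left({\frac qb\atop-aqt};q;-bqt\right).$$
   Formalization: In (i) for e=λ the condition on N is not dropped altogether but weakened to N > -ln c/ln q (i.e. cq^N<1); with no condition the bound fails, e.g. b=q, q^{-N}<a<q^{-N-1}, where (cq^N;q)_∞<0. Also a, b and z are taken nonzero. *)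

theory Defs
  imports "HOL-Complex_Analysis.Complex_Analysis"
begin

definition qpoch_inf :: "'a::real_normed_field \<Rightarrow> 'a \<Rightarrow> 'a" where
  "qpoch_inf a p = (\<Prod>n. 1 - a * p ^ n)"

text \<open>The finite symbol is the quotient \<open>(a; q)\<^sub>\<infinity> / (a q\<^sup>n; q)\<^sub>\<infinity>\<close> in reduced form, which
  also makes sense when the quotient reads \<open>0 / 0\<close> (for \<open>a = q\<^sup>-\<^sup>m\<close>, \<open>m \<ge> n\<close>); see
  the lemma \<open>qpoch_eq_quotient\<close> below.\<close>

definition qpoch :: "'a::real_normed_field \<Rightarrow> 'a \<Rightarrow> nat \<Rightarrow> 'a" where
  "qpoch a q n = (\<Prod>k<n. 1 - a * q ^ k)"

lemma qpoch_eq_quotient: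
  fixes a q :: "'a::{real_normed_field,banach}"
  assumes "norm q < 1" and "qpoch_inf (a * q ^ n) q \<noteq> 0"
  shows "qpoch a q n = qpoch_inf a q / qpoch_inf (a * q ^ n) q"
proof -
  have "summable (\<lambda>k. norm (- (a * q ^ k)))"
    using assms(1) by (simp add: norm_mult norm_power summable_mult summable_geometric)
  then have "abs_convergent_prod (\<lambda>k. 1 + - (a * q ^ k))"
    by (simp add: summable_imp_abs_convergent_prod)
  then have conv: "convergent_prod (\<lambda>k. 1 - a * q ^ k)"
    using abs_convergent_prod_imp_convergent_prod by fastforce
  have "convergent_prod (\<lambda>k. 1 - a * q ^ (k + n))"
    using conv convergent_prod_iff_shift[of "\<lambda>k. 1 - a * q ^ k" n] by blast
  then have "(\<lambda>k. 1 - a * q ^ (k + n)) has_prod qpoch_inf (a * q ^ n) q"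
    by (simp add: qpoch_inf_def power_add mult_ac convergent_prod_has_prod)
  then have "(\<lambda>k. \<Prod>i\<le>k. 1 - a * q ^ (i + n)) \<longlonglongrightarrow> qpoch_inf (a * q ^ n) q"
    using convergent_prod_LIMSEQ[OF \<open>convergent_prod (\<lambda>k. 1 - a * q ^ (k + n))\<close>]
    by (simp add: has_prod_iff)
  then have "(\<lambda>k. (\<Prod>i<n. 1 - a * q ^ i) * (\<Prod>i\<le>k. 1 - a * q ^ (i + n)))
      \<longlonglongrightarrow> (\<Prod>i<n. 1 - a * q ^ i) * qpoch_inf (a * q ^ n) q"
    by (intro tendsto_intros)
  moreover have "(\<Prod>i<n. 1 - a * q ^ i) * (\<Prod>i\<le>k. 1 - a * q ^ (i + n))
      = (\<Prod>i\<le>k + n. 1 - a * q ^ i)" for k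
  proof -
    have "(\<Prod>i\<le>k + n. 1 - a * q ^ i) = (\<Prod>i\<in>{..<n} \<union> {n..k + n}. 1 - a * q ^ i)"
      by (intro prod.cong) auto
    also have "\<dots> = (\<Prod>i<n. 1 - a * q ^ i) * (\<Prod>i\<in>{n..k + n}. 1 - a * q ^ i)"
      by (intro prod.union_disjoint) auto
    also have "(\<Prod>i\<in>{n..k + n}. 1 - a * q ^ i) = (\<Prod>i\<le>k. 1 - a * q ^ (i + n))"
      using prod.shift_bounds_cl_nat_ivl[of "\<lambda>i. 1 - a * q ^ i" 0 n k]
      by (simp add: atMost_atLeast0)
    finally show ?thesis by simp
  qed
  moreover have "(\<lambda>k. \<Prod>i\<le>k + n. 1 - a * q ^ i) \<longlonglongrightarrow> qpoch_inf a q"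
    using LIMSEQ_ignore_initial_segment[OF convergent_prod_LIMSEQ[OF conv]]
    by (simp add: qpoch_inf_def)
  ultimately have "qpoch_inf a q = qpoch a q n * qpoch_inf (a * q ^ n) q"
    unfolding qpoch_def using LIMSEQ_unique by fastforce
  then show ?thesis using assms(2) by simp
qed

text \<open>In what follows the base \<open>q\<close> is real with \<open>0 < q < 1\<close>, and the numerator parameters and
  arguments are complex.\<close>

definition qhat :: "real \<Rightarrow> real" where
  "qhat q = exp (2 * pi ^ 2 / ln q)"

definition C_q :: "real \<Rightarrow> real" where
  "C_q q = 1 / sqrt (- 2 * pi * ln q)"

text \<open>With the principal logarithm, \<open>Ln (t / z / \<surd>q) = ln t - ln \<bar>z\<bar> - \<i> arg z - \<onehalf> ln q\<close> for
  all \<open>t > 0\<close> and \<open>\<bar>arg z\<bar> < \<pi>\<close>; only such arguments are used.\<close>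

definition E_q :: "real \<Rightarrow> complex \<Rightarrow> complex" where
  "E_q q \<tau> = exp ((Ln (\<tau> / of_real (sqrt q)))\<^sup>2 / of_real (2 * ln q))"

definition theta_q :: "real \<Rightarrow> complex \<Rightarrow> complex" where
  "theta_q q \<tau> = qpoch_inf (of_real q) (of_real q) * qpoch_inf (- \<tau>) (of_real q)
     * qpoch_inf (- of_real q / \<tau>) (of_real q)"

definition phi21_series :: "real \<Rightarrow> complex \<Rightarrow> complex \<Rightarrow> complex \<Rightarrow> complex" where
  "phi21_series q a b x = (\<Sum>n. qpoch a (of_real q) n * qpoch b (of_real q) n
     / qpoch (of_real q) (of_real q) n * x ^ n)"

text \<open>The continuation of \<open>\<^sub>2\<phi>\<^sub>1(a, b; 0; q; x)\<close> in \<open>x\<close> is single-valued on the plane punctured at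
  \<open>q\<^sup>-\<^sup>n\<close>, \<open>n \<ge> 0\<close>, where it has at most poles. This domain is open and connected, so the
  continuation is unique there. At the points \<open>q\<^sup>-\<^sup>n\<close> themselves the value of \<open>phi21\<close> is
  unspecified.\<close>

definition phi21 :: "real \<Rightarrow> complex \<Rightarrow> complex \<Rightarrow> complex \<Rightarrow> complex" where
  "phi21 q a b = (SOME F. F holomorphic_on - range (\<lambda>n::nat. 1 / of_real q ^ n)
     \<and> (\<forall>x. norm x < 1 \<longrightarrow> F x = phi21_series q a b x))"

definition U_E :: "real \<Rightarrow> complex \<Rightarrow> complex \<Rightarrow> complex \<Rightarrow> complex" where
  "U_E q a b z = of_real (C_q q) *
     (LBINT t:{0<..}. phi21 q a b (- of_real t) * E_q q (of_real t / z) / of_real t)"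

definition U_theta :: "real \<Rightarrow> complex \<Rightarrow> complex \<Rightarrow> complex \<Rightarrow> complex" where
  "U_theta q a b z = of_real (- 1 / ln q) *
     (LBINT t:{0<..}. phi21 q a b (- of_real t) / theta_q q (of_real t / z) / of_real t)"

definition U_lambda :: "real \<Rightarrow> complex \<Rightarrow> complex \<Rightarrow> complex \<Rightarrow> complex \<Rightarrow> complex" where
  "U_lambda q lam a b z = (\<Sum>\<^sub>\<infinity>n\<in>(UNIV :: int set).
     phi21 q a b (- (of_real q powi n) * lam) / theta_q q (of_real q powi n * lam / z))"

text \<open>The function \<open>u\<close> is entire: the zeros of \<open>(-abt; q)\<^sub>\<infinity>\<close> cancel the poles of
  \<open>\<^sub>2\<phi>\<^sub>1(q/a, q/b; 0; q; -abt)\<close>. At those isolated points the value is the limit, which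
  is what \<open>remove_sings\<close> supplies.\<close>

definition u_fun :: "real \<Rightarrow> complex \<Rightarrow> complex \<Rightarrow> complex \<Rightarrow> complex" where
  "u_fun q a b = remove_sings (\<lambda>t. qpoch_inf (- a * b * t) (of_real q)
     * phi21 q (of_real q / a) (of_real q / b) (- a * b * t))"

definition K0 :: "real \<Rightarrow> complex \<Rightarrow> complex \<Rightarrow> complex" where
  "K0 q a b = qpoch_inf a (of_real q) * qpoch_inf b (of_real q)
     / qpoch_inf (of_real q) (of_real q)"

definition U_partial :: "real \<Rightarrow> complex \<Rightarrow> complex \<Rightarrow> nat \<Rightarrow> complex \<Rightarrow> complex" where
  "U_partial q a b N z = (\<Sum>n<N. qpoch a (of_real q) n * qpoch b (of_real q) n
     / qpoch (of_real q) (of_real q) n * of_real (q powi (- int (n choose 2))) * (- z) ^ n)"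

definition R_E :: "real \<Rightarrow> complex \<Rightarrow> complex \<Rightarrow> nat \<Rightarrow> complex \<Rightarrow> complex" where
  "R_E q a b N z = U_E q a b z - U_partial q a b N z"

definition R_theta :: "real \<Rightarrow> complex \<Rightarrow> complex \<Rightarrow> nat \<Rightarrow> complex \<Rightarrow> complex" where
  "R_theta q a b N z = U_theta q a b z - U_partial q a b N z"

definition R_lambda :: "real \<Rightarrow> complex \<Rightarrow> complex \<Rightarrow> complex \<Rightarrow> nat \<Rightarrow> complex \<Rightarrow> complex" where
  "R_lambda q lam a b N z = U_lambda q lam a b z - U_partial q a b N z"

end

theory Submission
  imports Defs "HOL-Probability.Probability" "HOL-Real_Asymp.Real_Asymp"
begin

text \<open>
  Write \<open>\<phi>(x)\<close> for the continued series \<open>\<^sub>2\<phi>\<^sub>1(a, b; 0; q; x)\<close>. Its coefficients are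
  \<open>K\<^sub>0 (q\<^bsup>n+1\<^esup>; q)\<^sub>\<infinity> / (a q\<^sup>n, b q\<^sup>n; q)\<^sub>\<infinity>\<close>. With
  \<open>(q s; q)\<^sub>\<infinity> / (a s, b s; q)\<^sub>\<infinity> = \<Sum> c\<^sub>m s\<^sup>m\<close> this is \<open>K\<^sub>0 \<Sum> c\<^sub>m q\<^bsup>nm\<^esup>\<close> as soon as
  \<open>max(|a|, |b|) q\<^sup>n < 1\<close>, and summing the geometric series in \<open>n \<ge> N\<close> gives
  \<open>phi21_expansion\<close>: the first \<open>N\<close> terms of the series, plus
  \<open>K\<^sub>0 x\<^sup>N \<Sum> c\<^sub>m q\<^bsup>Nm\<^esup> / (1 - x q\<^sup>m)\<close>. The same numbers \<open>c\<^sub>m\<close> describe \<open>u\<close>: it is the entire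
  function \<open>\<Sum> c\<^sub>m q\<^bsup>m(m+1)/2\<^esup> t\<^sup>m\<close> (\<open>u_fun_eq_series\<close>), because both sides solve the same
  second order \<open>q\<close>-difference equation and agree at the origin.

  All three transforms integrate \<open>\<phi>(-t)\<close> against a kernel \<open>k(t)\<close>, on a measure invariant under
  \<open>t \<mapsto> t / q\<close>, of total mass \<open>1\<close> and with \<open>k(t / q) = k(t) q z / t\<close>. These properties give the
  moments \<open>\<integral> t\<^sup>j k = z\<^sup>j q\<^bsup>-j(j-1)/2\<^esup>\<close>, hence the partial sum, and for the remainder the series
  \<open>K\<^sub>0 (-1)\<^sup>N \<Sum> c\<^sub>m q\<^bsup>m(m+1)/2\<^esup> z\<^sup>m I\<^bsub>N-m\<^esub>\<close> with \<open>I\<^sub>j = \<integral> t\<^sup>j / (1 + t) k\<close>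
  (\<open>remainder_series\<close>). Resummed, the series is \<open>\<integral> t\<^sup>N / (1 + t) u(z / t) k\<close>, but the bound on
  \<open>u\<close> is available only if \<open>Re (z / t) \<ge> 0\<close>. Now \<open>I\<^sub>j + I\<^bsub>j+1\<^esub>\<close> is a moment, so all \<open>I\<^sub>j\<close> are
  determined by \<open>I\<^sub>0\<close>, and another kernel on another ray with the same \<open>I\<^sub>0\<close> produces the same
  remainder. On a ray where \<open>Re (z / t) \<ge> 0\<close> the factor \<open>u(z / t)\<close> is at most
  \<open>M (-c q |z / t|; q)\<^sub>\<infinity> = M \<Sum> c\<^sup>m q\<^bsup>m(m+1)/2\<^esup> |z / t|\<^sup>m / (q; q)\<^sub>m\<close>, and the moments of a positive
  kernel turn \<open>|t|\<^sup>N\<close> times this sum into \<open>M\<close> times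
  \<open>|z|\<^sup>N q\<^bsup>-N(N-1)/2\<^esup> / (c q\<^sup>N; q)\<^sub>\<infinity>\<close> (\<open>remainder_bound\<close>). What
  remains are the bounds for \<open>1 / |1 + t|\<close> on the ray and for the kernel against the positive one.

  \<^item> For \<open>E\<close> and \<open>\<theta>\<close> the ray is turned by Cauchy's theorem (\<open>strip_stieltjes_eq\<close>) and stays in
    the right half-plane, so \<open>1 / |1 + t| \<le> 1\<close>. If \<open>Re z \<ge> 0\<close>, the ray through \<open>z\<close> is admissible and
    the kernel is positive there. Otherwise the nearest admissible ray is a half of the imaginary
    axis; it makes the angle \<open>\<zeta>\<close> with \<open>z\<close>, which costs the factor
    \<open>exp(-\<zeta>\<^sup>2 / (2 ln q))\<close> for the Gaussian \<open>E\<close>.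
  \<^item> By Jacobi's imaginary transformation (\<open>theta_modular\<close>) the theta kernel is the Gaussian one
    divided by a dual theta function with nome \<open>qhat\<close>. A lower bound for the latter on the strip of
    half-width \<open>\<pi>/2\<close> (\<open>theta_hat_lower_bound_half\<close>) produces the constant in \<open>qhat\<close>.
  \<^item> For \<open>\<lambda>\<close> the nodes \<open>\<lambda> q\<^sup>n\<close> are replaced by \<open>z q\<^sup>n / \<lambda>\<close>, where the kernel is positive. That
    \<open>I\<^sub>0\<close> does not change is a symmetry of Appell-Lerch sums (\<open>appell_lerch_symmetry\<close>). The
    new ray is the one through \<open>z\<close>, so \<open>1 / |1 + t|\<close> is at most \<open>1\<close> or \<open>1 / |sin (arg z)|\<close>.
\<close>

section \<open>Infinite products and the identities of Euler\<close>

lemma qpoch_inf_LIMSEQ: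
  fixes a p :: "'a::{real_normed_field,banach}"
  assumes "norm p < 1"
  shows "(\<lambda>n. \<Prod>i<n. 1 - a * p ^ i) \<longlonglongrightarrow> qpoch_inf a p"
    and "convergent_prod (\<lambda>i. 1 - a * p ^ i)"
proof -
  have "summable (\<lambda>k. norm (- (a * p ^ k)))"
    using assms(1) by (simp add: norm_mult norm_power summable_mult summable_geometric)
  then have "abs_convergent_prod (\<lambda>k. 1 + - (a * p ^ k))"
    by (simp add: summable_imp_abs_convergent_prod)
  then show conv: "convergent_prod (\<lambda>k. 1 - a * p ^ k)"
    using abs_convergent_prod_imp_convergent_prod by fastforce
  have "(\<lambda>n. \<Prod>i\<le>n. 1 - a * p ^ i) \<longlonglongrightarrow> qpoch_inf a p"
    unfolding qpoch_inf_def by (rule convergent_prod_LIMSEQ[OF conv])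
  then have "(\<lambda>n. \<Prod>i<Suc n. 1 - a * p ^ i) \<longlonglongrightarrow> qpoch_inf a p"
    by (simp add: lessThan_Suc_atMost)
  then show "(\<lambda>n. \<Prod>i<n. 1 - a * p ^ i) \<longlonglongrightarrow> qpoch_inf a p"
    by (rule LIMSEQ_imp_Suc)
qed

lemma qpoch_inf_split:
  fixes a p :: "'a::{real_normed_field,banach}"
  assumes "norm p < 1"
  shows "qpoch_inf a p = qpoch a p n * qpoch_inf (a * p ^ n) p"
proof -
  have "(\<lambda>k. qpoch a p n * (\<Prod>i<k. 1 - a * p ^ n * p ^ i)) \<longlonglongrightarrow> qpoch a p n * qpoch_inf (a * p ^ n) p"
    by (intro tendsto_intros qpoch_inf_LIMSEQ assms)
  moreover have "qpoch a p n * (\<Prod>i<k. 1 - a * p ^ n * p ^ i) = (\<Prod>i<k+n. 1 - a * p ^ i)" for k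
  proof (induction k)
    case 0 then show ?case by (simp add: qpoch_def)
  next
    case (Suc k)
    have "qpoch a p n * (\<Prod>i<Suc k. 1 - a * p ^ n * p ^ i)
        = (qpoch a p n * (\<Prod>i<k. 1 - a * p ^ n * p ^ i)) * (1 - a * p ^ n * p ^ k)" by simp
    also have "\<dots> = (\<Prod>i<Suc k + n. 1 - a * p ^ i)"
      unfolding Suc by (simp add: power_add mult_ac)
    finally show ?case .
  qed
  ultimately have "(\<lambda>k. \<Prod>i<k+n. 1 - a * p ^ i) \<longlonglongrightarrow> qpoch a p n * qpoch_inf (a * p ^ n) p"
    by simp
  moreover have "(\<lambda>k. \<Prod>i<k+n. 1 - a * p ^ i) \<longlonglongrightarrow> qpoch_inf a p"
    by (rule LIMSEQ_ignore_initial_segment[OF qpoch_inf_LIMSEQ(1)[OF assms]])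
  ultimately show ?thesis using LIMSEQ_unique by blast
qed

lemma qpoch_inf_step:
  fixes a p :: "'a::{real_normed_field,banach}"
  assumes "norm p < 1"
  shows "qpoch_inf a p = (1 - a) * qpoch_inf (a * p) p"
  using qpoch_inf_split[OF assms, of a 1] by (simp add: qpoch_def)

lemma qpoch_inf_zero [simp]: "qpoch_inf 0 p = 1"
  by (simp add: qpoch_inf_def)

lemma qpoch_inf_eq_zero_iff:
  fixes a p :: "'a::{real_normed_field,banach}"
  assumes "norm p < 1"
  shows "qpoch_inf a p = 0 \<longleftrightarrow> (\<exists>n. a * p ^ n = 1)"
proof
  assume "qpoch_inf a p = 0"
  then show "\<exists>n. a * p ^ n = 1"
    using prodinf_nonzero[OF qpoch_inf_LIMSEQ(2)[OF assms, of a]]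
    by (auto simp: qpoch_inf_def)
next
  assume "\<exists>n. a * p ^ n = 1"
  then obtain n where "a * p ^ n = 1" by blast
  then have "qpoch a p (Suc n) = 0" by (simp add: qpoch_def)
  then show "qpoch_inf a p = 0" using qpoch_inf_split[OF assms, of a "Suc n"] by simp
qed

lemma qpoch_inf_nonzero:
  fixes a p :: "'a::{real_normed_field,banach}"
  assumes "norm p < 1" "norm a < 1"
  shows "qpoch_inf a p \<noteq> 0"
proof -
  have "norm (a * p ^ n) < 1" for n
  proof -
    have "norm (a * p ^ n) \<le> norm a * 1"
      unfolding norm_mult norm_power using assms by (intro mult_left_mono power_le_one) auto
    then show ?thesis using assms by simp
  qed
  then have "a * p ^ n \<noteq> 1" for n by (metis norm_one less_irrefl)
  then show ?thesis using qpoch_inf_eq_zero_iff[OF assms(1)] by blast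
qed

lemma qpoch_inf_of_real:
  fixes a p :: real
  assumes "\<bar>p\<bar> < 1"
  shows "qpoch_inf (of_real a :: 'a::{real_normed_field,banach}) (of_real p) = of_real (qpoch_inf a p)"
proof -
  have "(\<lambda>n. of_real (\<Prod>i<n. 1 - a * p ^ i) :: 'a) \<longlonglongrightarrow> of_real (qpoch_inf a p)"
    using assms by (intro tendsto_of_real qpoch_inf_LIMSEQ) auto
  moreover have "(\<lambda>n. \<Prod>i<n. 1 - (of_real a :: 'a) * of_real p ^ i) \<longlonglongrightarrow> qpoch_inf (of_real a) (of_real p)"
    using assms by (intro qpoch_inf_LIMSEQ) auto
  ultimately show ?thesis using LIMSEQ_unique by fastforce
qed

lemma qpoch_inf_pos:
  fixes a p :: real
  assumes "0 \<le> p" "p < 1" "a < 1"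
  shows "0 < qpoch_inf a p"
proof (cases "a \<ge> 0")
  case True
  have f: "0 < 1 - a * p ^ i" for i
  proof -
    have "a * p ^ i \<le> a * 1" using assms True by (intro mult_left_mono power_le_one) auto
    then show ?thesis using assms by simp
  qed
  have "0 \<le> qpoch_inf a p"
    by (rule LIMSEQ_le_const[OF qpoch_inf_LIMSEQ(1)]) (use assms f in \<open>auto intro!: prod_nonneg exI[of _ 0] simp: less_imp_le\<close>)
  moreover have "qpoch_inf a p \<noteq> 0"
    by (rule qpoch_inf_nonzero) (use assms True in auto)
  ultimately show ?thesis by simp
next
  case False
  have "1 \<le> qpoch_inf a p"
    by (rule LIMSEQ_le_const[OF qpoch_inf_LIMSEQ(1)])
       (use assms False in \<open>auto intro!: prod_ge_1 exI[of _ 0] mult_nonpos_nonneg\<close>)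
  then show ?thesis by simp
qed

text \<open>Denominators \<open>(p; p)\<^sub>n\<close> stay away from zero uniformly in \<open>n\<close>, so they do not affect the
  convergence of power series.\<close>

lemma qpoch_norm_ge:
  fixes p :: "'a::{real_normed_field,banach}"
  assumes "norm p < 1"
  shows "norm (qpoch p p n) \<ge> qpoch_inf (norm p) (norm p)"
proof -
  have f: "norm p * norm p ^ i < 1" for i
    using assms by (metis norm_ge_zero power_Suc power_less_one_iff zero_less_Suc)
  have "qpoch_inf (norm p) (norm p) = qpoch (norm p) (norm p) n * qpoch_inf (norm p * norm p ^ n) (norm p)"
    using qpoch_inf_split[of "norm p"] assms by simp
  also have "\<dots> \<le> qpoch (norm p) (norm p) n * 1"
  proof (intro mult_left_mono)
    show "qpoch_inf (norm p * norm p ^ n) (norm p) \<le> 1"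
      by (rule LIMSEQ_le_const2[OF qpoch_inf_LIMSEQ(1)])
         (use assms f in \<open>auto intro!: prod_le_1 exI[of _ 0] simp: mult.assoc power_add[symmetric] less_imp_le[OF f]\<close>)
    show "0 \<le> qpoch (norm p) (norm p) n"
      using f by (auto simp: qpoch_def intro!: prod_nonneg less_imp_le[OF f])
  qed
  also have "\<dots> \<le> norm (qpoch p p n)"
    unfolding qpoch_def prod_norm[symmetric] mult_1_right
  proof (intro prod_mono conjI)
    fix i
    show "0 \<le> 1 - norm p * norm p ^ i" using f[of i] by simp
    show "1 - norm p * norm p ^ i \<le> norm (1 - p * p ^ i)"
      using norm_triangle_ineq2[of 1 "p * p ^ i"] by (simp add: norm_mult norm_power)
  qed
  finally show ?thesis .
qed

lemma qpoch_self_nonzero: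
  fixes p :: "'a::{real_normed_field,banach}"
  assumes "norm p < 1"
  shows "qpoch p p n \<noteq> 0"
proof -
  have "0 < qpoch_inf (norm p) (norm p)" using assms by (intro qpoch_inf_pos) auto
  then show ?thesis using qpoch_norm_ge[OF assms, of n] by auto
qed

lemma choose_two_Suc: "Suc m choose 2 = (m choose 2) + m"
  by (simp add: numeral_2_eq_2)

lemma summable_gauss_power:
  fixes r y :: real
  assumes "0 \<le> r" "r < 1" "0 \<le> y"
  shows "summable (\<lambda>m. r ^ (m choose 2) * y ^ m)"
proof -
  have "(\<lambda>m. r ^ m * y) \<longlonglongrightarrow> 0 * y" using assms by (intro tendsto_intros LIMSEQ_power_zero) auto
  then have "eventually (\<lambda>m. r ^ m * y < 1/2) sequentially"
    by (intro order_tendstoD(2)[of _ 0]) auto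
  then obtain n0 where n0: "\<And>m. m \<ge> n0 \<Longrightarrow> r ^ m * y < 1/2"
    by (auto simp: eventually_sequentially)
  show ?thesis
  proof (rule summable_ratio_test[of "1/2" n0])
    fix m assume "m \<ge> n0"
    have "r ^ (Suc m choose 2) * y ^ Suc m = (r ^ m * y) * (r ^ (m choose 2) * y ^ m)"
      by (simp add: choose_two_Suc power_add)
    also have "\<dots> \<le> 1/2 * (r ^ (m choose 2) * y ^ m)"
      using n0[OF \<open>m \<ge> n0\<close>] assms by (intro mult_right_mono) auto
    finally show "norm (r ^ (Suc m choose 2) * y ^ Suc m) \<le> 1/2 * norm (r ^ (m choose 2) * y ^ m)"
      using assms by simp
  qed auto
qed

text \<open>Iterating \<open>f(y) = (1 - y) f(y p)\<close> splits off one factor of the product at a time while the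
  argument tends to \<open>0\<close>; continuity there identifies the remaining factor.\<close>

lemma iterate_functional_eq:
  fixes f :: "'a::{real_normed_field,banach} \<Rightarrow> 'a"
  assumes p: "norm p < 1" and x: "norm x < R"
    and eq: "\<And>y. norm y < R \<Longrightarrow> f y = (1 - y) * f (y * p)"
    and cont: "isCont f 0"
  shows "f x = qpoch_inf x p * f 0"
proof -
  have nx: "norm (x * p ^ n) < R" for n
  proof -
    have "norm (x * p ^ n) \<le> norm x * 1"
      unfolding norm_mult norm_power using p by (intro mult_left_mono power_le_one) auto
    then show ?thesis using x by simp
  qed
  have "f x = (\<Prod>i<n. 1 - x * p ^ i) * f (x * p ^ n)" for n
  proof (induction n)
    case (Suc n)
    then show ?case using eq[OF nx[of n]] by (simp add: mult_ac)
  qed simp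
  moreover have "(\<lambda>n. (\<Prod>i<n. 1 - x * p ^ i) * f (x * p ^ n)) \<longlonglongrightarrow> qpoch_inf x p * f (x * 0)"
    using p cont by (intro tendsto_mult qpoch_inf_LIMSEQ isCont_tendsto_compose[where g=f] LIMSEQ_power_zero tendsto_const) auto
  ultimately show ?thesis by (simp add: LIMSEQ_const_iff)
qed

definition euler_coeff :: "'a::{real_normed_field,banach} \<Rightarrow> nat \<Rightarrow> 'a" where
  "euler_coeff p m = (- 1) ^ m * p ^ (m choose 2) / qpoch p p m"

lemma euler_coeff_0 [simp]: "euler_coeff p 0 = 1"
  by (simp add: euler_coeff_def qpoch_def numeral_2_eq_2)

lemma euler_coeff_Suc:
  assumes "norm p < 1"
  shows "(1 - p ^ Suc m) * euler_coeff p (Suc m) = - (p ^ m) * euler_coeff p m"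
proof -
  have "1 - p ^ Suc m \<noteq> 0" using qpoch_self_nonzero[OF assms, of "Suc m"] by (auto simp: qpoch_def)
  then show ?thesis using qpoch_self_nonzero[OF assms, of m]
    by (simp add: euler_coeff_def qpoch_def choose_two_Suc power_add field_simps)
qed

lemma summable_euler:
  fixes p x :: "'a::{real_normed_field,banach}"
  assumes "norm p < 1"
  shows "summable (\<lambda>m. norm (euler_coeff p m * x ^ m))"
proof (rule summable_comparison_test')
  show "summable (\<lambda>m. inverse (qpoch_inf (norm p) (norm p)) * (norm p ^ (m choose 2) * norm x ^ m))"
    using assms by (intro summable_mult summable_gauss_power) auto
  fix m :: nat
  have pos: "0 < qpoch_inf (norm p) (norm p)" using assms by (intro qpoch_inf_pos) auto
  have "norm (euler_coeff p m * x ^ m) = inverse (norm (qpoch p p m)) * (norm p ^ (m choose 2) * norm x ^ m)"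
    by (simp add: euler_coeff_def norm_mult norm_power norm_divide norm_inverse divide_inverse mult_ac)
  also have "\<dots> \<le> inverse (qpoch_inf (norm p) (norm p)) * (norm p ^ (m choose 2) * norm x ^ m)"
    using pos qpoch_norm_ge[OF assms, of m] by (intro mult_right_mono le_imp_inverse_le) auto
  finally show "norm (norm (euler_coeff p m * x ^ m)) \<le> inverse (qpoch_inf (norm p) (norm p)) * (norm p ^ (m choose 2) * norm x ^ m)"
    by simp
qed

lemma isCont_powser_ball:
  fixes c :: "nat \<Rightarrow> 'a::{real_normed_field,banach}"
  assumes "\<And>y. norm y < R \<Longrightarrow> summable (\<lambda>n. c n * y ^ n)" "norm x < R"
  shows "isCont (\<lambda>x. \<Sum>n. c n * x ^ n) x"
proof -
  obtain r where r: "norm x < r" "r < R" using assms(2) dense by blast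
  have "r > 0" using r norm_ge_zero[of x] by linarith
  show ?thesis
    by (rule isCont_powser[of c "of_real r"]) (use assms(1)[of "of_real r"] r \<open>r > 0\<close> in auto)
qed

text \<open>Euler: the recurrence of the coefficients says that the power series satisfies
  \<open>f(y) = (1 - y) f(y p)\<close>.\<close>

lemma euler_product:
  fixes p x :: "'a::{real_normed_field,banach}"
  assumes p: "norm p < 1"
  shows "(\<lambda>m. euler_coeff p m * x ^ m) sums qpoch_inf x p"
proof -
  define f where "f = (\<lambda>x. \<Sum>m. euler_coeff p m * x ^ m)"
  have s: "(\<lambda>m. euler_coeff p m * y ^ m) sums f y" for y
    unfolding f_def using summable_norm_cancel[OF summable_euler[OF p]] by (rule summable_sums)
  have eq: "f y = (1 - y) * f (y * p)" for y
  proof -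
    have 1: "(\<lambda>m. euler_coeff p (Suc m) * y ^ Suc m) sums (f y - 1)"
      using s[of y] sums_Suc_iff[of "\<lambda>m. euler_coeff p m * y ^ m"] by simp
    have 2: "(\<lambda>m. euler_coeff p (Suc m) * (y * p) ^ Suc m) sums (f (y * p) - 1)"
      using s[of "y * p"] sums_Suc_iff[of "\<lambda>m. euler_coeff p m * (y * p) ^ m"] by simp
    have "(\<lambda>m. euler_coeff p (Suc m) * y ^ Suc m) sums (f (y * p) - 1 - y * f (y * p))"
    proof -
      have "(\<lambda>m. euler_coeff p (Suc m) * (y * p) ^ Suc m - y * (euler_coeff p m * (y * p) ^ m)) sums (f (y * p) - 1 - y * f (y * p))"
        by (intro sums_diff 2 sums_mult s)
      moreover have "euler_coeff p (Suc m) * (y * p) ^ Suc m - y * (euler_coeff p m * (y * p) ^ m) = euler_coeff p (Suc m) * y ^ Suc m" for m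
      proof -
        have "euler_coeff p (Suc m) = p ^ Suc m * euler_coeff p (Suc m) - p ^ m * euler_coeff p m"
          using euler_coeff_Suc[OF p, of m] by (simp add: algebra_simps)
        then have "euler_coeff p (Suc m) * y ^ Suc m = (p ^ Suc m * euler_coeff p (Suc m) - p ^ m * euler_coeff p m) * y ^ Suc m"
          by simp
        then show ?thesis by (simp add: power_mult_distrib algebra_simps)
      qed
      ultimately show ?thesis by simp
    qed
    from sums_unique2[OF 1 this] show ?thesis by (simp add: algebra_simps)
  qed
  have "isCont f 0"
    unfolding f_def by (rule isCont_powser_ball[where R=1]) (auto intro: summable_norm_cancel[OF summable_euler[OF p]])
  from iterate_functional_eq[OF p _ eq this, of x "norm x + 1"]
  have "f x = qpoch_inf x p * f 0" by simp
  moreover have "f 0 = 1" unfolding f_def by (subst powser_zero) simp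
  ultimately show ?thesis using s[of x] by simp
qed

lemma summable_euler_inverse:
  fixes p x :: "'a::{real_normed_field,banach}"
  assumes p: "norm p < 1" and x: "norm x < 1"
  shows "summable (\<lambda>m. norm (x ^ m / qpoch p p m))"
proof (rule summable_comparison_test')
  show "summable (\<lambda>m. inverse (qpoch_inf (norm p) (norm p)) * norm x ^ m)"
    using assms by (intro summable_mult summable_geometric) auto
  fix m :: nat
  have pos: "0 < qpoch_inf (norm p) (norm p)" using assms by (intro qpoch_inf_pos) auto
  have "norm (x ^ m / qpoch p p m) = inverse (norm (qpoch p p m)) * norm x ^ m"
    by (simp add: norm_power norm_mult norm_inverse divide_inverse mult.commute)
  also have "\<dots> \<le> inverse (qpoch_inf (norm p) (norm p)) * norm x ^ m"
    using pos qpoch_norm_ge[OF p, of m] by (intro mult_right_mono le_imp_inverse_le) auto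
  finally show "norm (norm (x ^ m / qpoch p p m)) \<le> inverse (qpoch_inf (norm p) (norm p)) * norm x ^ m"
    by simp
qed

text \<open>Here the recurrence is \<open>f(y p) = (1 - y) f(y)\<close>, the equation of the reciprocal product.\<close>

lemma euler_inverse_product:
  fixes p x :: "'a::{real_normed_field,banach}"
  assumes p: "norm p < 1" and x: "norm x < 1"
  shows "(\<lambda>m. x ^ m / qpoch p p m) sums (1 / qpoch_inf x p)"
proof -
  define f where "f = (\<lambda>x. \<Sum>m. (1 / qpoch p p m) * x ^ m)"
  have s: "(\<lambda>m. x ^ m / qpoch p p m) sums f x" if "norm x < 1" for x
    unfolding f_def using summable_sums[OF summable_norm_cancel[OF summable_euler_inverse[OF p that]]] by simp
  have f0: "f 0 = 1" unfolding f_def by (subst powser_zero) (simp add: qpoch_def)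
  have px: "norm (y * p) < 1" if "norm y < 1" for y
  proof -
    have "norm (y * p) \<le> norm y * 1"
      unfolding norm_mult using p by (intro mult_left_mono) auto
    then show ?thesis using that by simp
  qed
  have eq: "f (y * p) = (1 - y) * f y" if y: "norm y < 1" for y
  proof -
    have 1: "(\<lambda>m. y ^ Suc m / qpoch p p (Suc m)) sums (f y - 1)"
      using s[OF y] sums_Suc_iff[of "\<lambda>m. y ^ m / qpoch p p m"] by (simp add: qpoch_def)
    have 2: "(\<lambda>m. (y * p) ^ Suc m / qpoch p p (Suc m)) sums (f (y * p) - 1)"
      using s[OF px[OF y]] sums_Suc_iff[of "\<lambda>m. (y * p) ^ m / qpoch p p m"] by (simp add: qpoch_def)
    have "(\<lambda>m. y ^ Suc m / qpoch p p (Suc m) - y * (y ^ m / qpoch p p m)) sums (f y - 1 - y * f y)"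
      by (intro sums_diff 1 sums_mult s y)
    moreover have "y ^ Suc m / qpoch p p (Suc m) - y * (y ^ m / qpoch p p m) = (y * p) ^ Suc m / qpoch p p (Suc m)" for m
    proof -
      have "1 - p * p ^ m \<noteq> 0" "qpoch p p m \<noteq> 0"
        using qpoch_self_nonzero[OF p, of "Suc m"] by (auto simp: qpoch_def)
      then show ?thesis by (simp add: qpoch_def field_simps power_mult_distrib)
    qed
    ultimately have "(\<lambda>m. (y * p) ^ Suc m / qpoch p p (Suc m)) sums (f y - 1 - y * f y)" by simp
    from sums_unique2[OF 2 this] show ?thesis by (simp add: algebra_simps)
  qed
  have cont: "isCont f 0"
    unfolding f_def by (rule isCont_powser_ball[where R=1])
      (use summable_norm_cancel[OF summable_euler_inverse[OF p]] in auto)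
  have qn: "f x * (\<Prod>i<n. 1 - x * p ^ i) = f (x * p ^ n)" for n
  proof (induction n)
    case (Suc n)
    have "norm (x * p ^ n) < 1"
    proof -
      have "norm (x * p ^ n) \<le> norm x * 1"
        unfolding norm_mult norm_power using p by (intro mult_left_mono power_le_one) auto
      then show ?thesis using x by simp
    qed
    from eq[OF this] Suc show ?case by (simp add: mult_ac)
  qed simp
  have "(\<lambda>n. f x * (\<Prod>i<n. 1 - x * p ^ i)) \<longlonglongrightarrow> f (x * 0)"
    unfolding qn using p cont by (intro isCont_tendsto_compose[where g=f] tendsto_mult LIMSEQ_power_zero tendsto_const) auto
  moreover have "(\<lambda>n. f x * (\<Prod>i<n. 1 - x * p ^ i)) \<longlonglongrightarrow> f x * qpoch_inf x p"
    by (intro tendsto_intros qpoch_inf_LIMSEQ p)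
  ultimately have "f x * qpoch_inf x p = 1" using LIMSEQ_unique f0 by fastforce
  then have "f x = 1 / qpoch_inf x p" using qpoch_inf_nonzero[OF p x] by (simp add: eq_divide_eq)
  then show ?thesis using s[OF x] by simp
qed

section \<open>The theta function and the triple product\<close>

no_notation Infinite_Set_Sum.abs_summable_on (infix \<open>abs'_summable'_on\<close> 50)
notation Infinite_Sum.abs_summable_on (infixr \<open>abs'_summable'_on\<close> 46)

definition tri :: "real \<Rightarrow> int \<Rightarrow> real" where
  "tri q n = q powi (n * (n - 1) div 2)"

lemma double_triangular: "2 * (n * (n - 1) div 2) = n * (n - (1::int))"
proof -
  have "even (n * (n - 1))" by auto
  then show ?thesis by simp
qed

lemma triangular_add:
  "(n + m) * (n + m - 1) div 2 = n * (n - 1) div 2 + m * (m - 1) div 2 + n * (m::int)"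
proof -
  have "2 * ((n + m) * (n + m - 1) div 2) = 2 * (n * (n - 1) div 2 + m * (m - 1) div 2 + n * m)"
    unfolding distrib_left double_triangular by (simp add: algebra_simps)
  then show ?thesis by (simp only: mult_cancel_left) simp
qed

lemma tri_add:
  assumes "q \<noteq> 0"
  shows "tri q (n + m) = tri q n * tri q m * q powi (n * m)"
  using assms unfolding tri_def triangular_add by (simp add: power_int_add)

lemma tri_0 [simp]: "tri q 0 = 1" and tri_1 [simp]: "tri q 1 = 1"
  by (simp_all add: tri_def)

lemma tri_Suc:
  assumes "q \<noteq> 0"
  shows "tri q (n + 1) = tri q n * q powi n"
  using tri_add[OF assms, of n 1] by simp

lemma tri_reflect: "tri q (1 - n) = tri q n"
  by (simp add: tri_def algebra_simps)

lemma tri_pos [simp]: "0 < q \<Longrightarrow> 0 < tri q n"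
  by (simp add: tri_def)

lemma tri_of_nat: "tri q (int m) = q ^ (m choose 2)"
proof -
  have "int m * (int m - 1) div 2 = int (m choose 2)"
  proof (cases m)
    case (Suc k)
    then have "int m * (int m - 1) div 2 = int (m * (m - 1) div 2)"
      by (simp add: zdiv_int algebra_simps)
    then show ?thesis by (simp add: choose_two)
  qed simp
  then show ?thesis by (simp add: tri_def)
qed

lemma tri_neg_of_nat: "tri q (- int m) = q ^ (Suc m choose 2)"
  using tri_reflect[of q "int (Suc m)"] tri_of_nat[of q "Suc m"] by simp

lemma abs_summable_int_split:
  fixes f :: "int \<Rightarrow> 'a::banach"
  assumes "summable (\<lambda>n. norm (f (int n)))" "summable (\<lambda>n. norm (f (- int n)))"
  shows "f abs_summable_on UNIV"
proof -
  have 1: "(\<lambda>n. norm (f n)) summable_on range int"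
    using norm_summable_imp_summable_on[of "\<lambda>n. norm (f (int n))"] assms(1)
    by (subst summable_on_reindex) (auto simp: o_def)
  have s: "summable (\<lambda>n. norm (f (- int (Suc n))))"
    using assms(2) summable_Suc_iff[of "\<lambda>n. norm (f (- int n))"] by simp
  have 2: "(\<lambda>n. norm (f n)) summable_on range (\<lambda>n. - int (Suc n))"
    using norm_summable_imp_summable_on[of "\<lambda>n. norm (f (- int (Suc n)))"] s
    by (subst summable_on_reindex) (auto simp: o_def inj_on_def)
  have "(\<lambda>n. norm (f n)) summable_on (range int \<union> range (\<lambda>n. - int (Suc n)))"
    by (rule summable_on_Un_disjoint[OF 1 2]) auto
  moreover have "range int \<union> range (\<lambda>n. - int (Suc n)) = UNIV"
  proof (intro equalityI subsetI UNIV_I)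
    fix k :: int
    show "k \<in> range int \<union> range (\<lambda>n. - int (Suc n))" by (cases k rule: int_cases) blast+
  qed
  ultimately show ?thesis by simp
qed

lemma summable_tri:
  fixes x :: complex
  assumes q: "0 < q" "q < 1"
  shows "(\<lambda>n. of_real (tri q n) * x powi n) abs_summable_on UNIV"
proof (rule abs_summable_int_split)
  show "summable (\<lambda>n. norm (complex_of_real (tri q (int n)) * x powi int n))"
    using summable_gauss_power[of q "norm x"] q
    by (simp add: tri_of_nat norm_mult norm_power)
  have "summable (\<lambda>n. q ^ (n choose 2) * (q * norm (inverse x)) ^ n)"
    using q by (intro summable_gauss_power) auto
  then show "summable (\<lambda>n. norm (complex_of_real (tri q (- int n)) * x powi (- int n)))"
    using q by (simp add: tri_neg_of_nat norm_mult norm_power norm_inverse choose_two_Suc power_add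
       power_mult_distrib power_int_minus power_inverse mult_ac)
qed

lemma abs_summable_times:
  fixes f :: "'a \<Rightarrow> complex" and g :: "'b \<Rightarrow> complex"
  assumes f: "f abs_summable_on A" and g: "g abs_summable_on B"
  shows "(\<lambda>(x, y). f x * g y) abs_summable_on A \<times> B"
  unfolding Infinite_Sum.abs_summable_on_Sigma_iff
proof (intro conjI ballI)
  fix x
  show "(\<lambda>y. (case (x, y) of (x, y) \<Rightarrow> f x * g y)) abs_summable_on B"
    using summable_on_cmult_right[OF g, of "norm (f x)"] by (simp add: norm_mult)
next
  have "(\<lambda>x. norm (f x) * (\<Sum>\<^sub>\<infinity>y\<in>B. norm (g y))) summable_on A"
    by (rule summable_on_cmult_left[OF f])
  moreover have "(\<Sum>\<^sub>\<infinity>y\<in>B. norm (f x * g y)) = norm (f x) * (\<Sum>\<^sub>\<infinity>y\<in>B. norm (g y))" for x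
    unfolding norm_mult by (rule infsum_cmult_right) (use g in auto)
  moreover have "0 \<le> (\<Sum>\<^sub>\<infinity>y\<in>B. norm (g y))" by (intro infsum_nonneg) auto
  ultimately show "(\<lambda>x. \<Sum>\<^sub>\<infinity>y\<in>B. norm (case (x, y) of (x, y) \<Rightarrow> f x * g y)) abs_summable_on A"
    by (simp add: norm_mult abs_mult)
qed

lemma infsum_times:
  fixes f :: "'a \<Rightarrow> complex" and g :: "'b \<Rightarrow> complex"
  assumes f: "f abs_summable_on A" and g: "g abs_summable_on B"
  shows "infsum (\<lambda>(x, y). f x * g y) (A \<times> B) = infsum f A * infsum g B"
proof -
  have "infsum (\<lambda>x. infsum (\<lambda>y. f x * g y) B) A = infsum (\<lambda>(x, y). f x * g y) (A \<times> B)"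
    by (rule infsum_Sigma'_banach) (use abs_summable_summable[OF abs_summable_times[OF f g]] in auto)
  moreover have "infsum (\<lambda>y. f x * g y) B = f x * infsum g B" for x
    by (rule infsum_cmult_right) (use abs_summable_summable[OF g] in auto)
  moreover have "infsum (\<lambda>x. f x * infsum g B) A = infsum f A * infsum g B"
    by (rule infsum_cmult_left) (use abs_summable_summable[OF f] in auto)
  ultimately show ?thesis by simp
qed

definition theta_series :: "real \<Rightarrow> complex \<Rightarrow> complex" where
  "theta_series q x = (\<Sum>\<^sub>\<infinity>n. of_real (tri q n) * x powi n)"

lemma theta_series_shift:
  assumes q: "0 < q" "q < 1" and x: "x \<noteq> 0"
  shows "theta_series q (of_real (q powi m) * x) * (of_real (tri q m) * x powi m) = theta_series q x"
proof -
  have "theta_series q (of_real (q powi m) * x) * (of_real (tri q m) * x powi m)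
     = (\<Sum>\<^sub>\<infinity>n. of_real (tri q n) * (of_real (q powi m) * x) powi n * (of_real (tri q m) * x powi m))"
    unfolding theta_series_def
    by (rule infsum_cmult_left[symmetric]) (use abs_summable_summable[OF summable_tri[OF q]] in blast)
  also have "\<dots> = (\<Sum>\<^sub>\<infinity>n. of_real (tri q (n + m)) * x powi (n + m))"
  proof (rule infsum_cong)
    fix n :: int
    have "complex_of_real (q powi m) powi n = of_real (q powi (n * m))"
      by (simp add: of_real_power_int[symmetric] power_int_mult[symmetric] mult.commute del: of_real_power_int)
    then show "of_real (tri q n) * (of_real (q powi m) * x) powi n * (of_real (tri q m) * x powi m)
      = of_real (tri q (n + m)) * x powi (n + m)"
      using q x by (simp add: tri_add power_int_add power_int_mult_distrib mult_ac)
  qed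
  also have "\<dots> = theta_series q x"
    unfolding theta_series_def
    by (rule infsum_reindex_bij_betw[where g = "\<lambda>n. n + m" and f="\<lambda>n. of_real (tri q n) * x powi n"])
       (auto intro!: bij_betwI[of _ _ _ "\<lambda>n. n - m"])
  finally show ?thesis .
qed

lemma has_sum_nat_sums:
  fixes f :: "nat \<Rightarrow> complex"
  assumes "f sums s" "summable (\<lambda>n. norm (f n))"
  shows "infsum f UNIV = s"
  using norm_summable_imp_has_sum[OF assms(2,1)] by (rule infsumI)

lemma infsum_int_nat:
  fixes f :: "int \<Rightarrow> complex"
  assumes "\<And>n. n < 0 \<Longrightarrow> f n = 0"
  shows "infsum f UNIV = (\<Sum>\<^sub>\<infinity>n. f (int n))"
proof -
  have "infsum f UNIV = infsum f (range int)"
    by (rule infsum_cong_neutral) (use assms in \<open>auto, metis int_cases2 linorder_not_less nat_0_le not_less_iff_gr_or_eq of_nat_0_le_iff rangeI\<close>)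
  also have "\<dots> = (\<Sum>\<^sub>\<infinity>n. f (int n))"
    by (subst infsum_reindex) (auto simp: o_def)
  finally show ?thesis .
qed

text \<open>For \<open>|x| > q\<close> Euler's second identity expands \<open>1 / (-q/x; q)\<^sub>\<infinity>\<close>. The product of this series
  with the theta series, summed along \<open>k - m = n\<close>, contains the factor \<open>(q\<^bsup>n+1\<^esup>; q)\<^sub>\<infinity>\<close>, which
  vanishes for \<open>n < 0\<close>; what is left is Euler's first series for \<open>(-x; q)\<^sub>\<infinity>\<close>.\<close>

lemma jacobi_triple_product_large:
  assumes q: "0 < q" "q < 1" and x: "norm x > q"
  shows "theta_q q x = theta_series q x"
proof -
  let ?p = "complex_of_real q"
  define y where "y = - ?p / x"
  have x0: "x \<noteq> 0" using x q by auto
  have p: "norm ?p < 1" using q by simp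
  have y: "norm y < 1" using x q x0 by (simp add: y_def norm_divide)
  have yn: "qpoch_inf y ?p \<noteq> 0" by (rule qpoch_inf_nonzero[OF p y])
  define F where "F = (\<lambda>(k::int, m::nat). (of_real (tri q k) * x powi k) * (y ^ m / qpoch ?p ?p m))"
  have ey: "(\<lambda>m. y ^ m / qpoch ?p ?p m) abs_summable_on UNIV"
    using norm_summable_imp_summable_on[of "\<lambda>m. norm (y ^ m / qpoch ?p ?p m)"]
      summable_euler_inverse[OF p y] by simp
  have Fs: "F abs_summable_on UNIV \<times> UNIV"
    unfolding F_def by (rule abs_summable_times[OF summable_tri[OF q] ey])
  have F: "infsum F (UNIV \<times> UNIV) = theta_series q x * (1 / qpoch_inf y ?p)"
    unfolding F_def infsum_times[OF summable_tri[OF q] ey] theta_series_def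
    using has_sum_nat_sums[OF euler_inverse_product[OF p y] summable_euler_inverse[OF p y]] by simp
  define h where "h = (\<lambda>(n::int, m::nat). (n + int m, m))"
  have h: "bij_betw h (UNIV \<times> UNIV) (UNIV \<times> UNIV)"
    by (rule bij_betwI[of _ _ _ "\<lambda>(n, m). (n - int m, m)"]) (auto simp: h_def)
  \<comment> \<open>The reindexing \<open>k = n + m\<close> is the one that completes the square in the exponent.\<close>
  have Fh: "F (h (n, m)) = of_real (tri q n) * x powi n * (euler_coeff ?p m * (of_real (q powi (n + 1))) ^ m)" for n m
  proof -
    have "F (h (n, m)) = of_real (tri q n * tri q (int m) * q powi (n * int m)) * (x powi n * x ^ m) * ((- ?p / x) ^ m / qpoch ?p ?p m)"
      using q x0 by (simp add: F_def h_def y_def tri_add power_int_add)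
    also have "x ^ m * (- ?p / x) ^ m = (- ?p) ^ m"
      unfolding power_mult_distrib[symmetric] using x0 by simp
    then have "x powi n * x ^ m * (- ?p / x) ^ m = x powi n * (- ?p) ^ m"
      by (simp add: mult.assoc)
    then have "of_real (tri q n * tri q (int m) * q powi (n * int m)) * (x powi n * x ^ m) * ((- ?p / x) ^ m / qpoch ?p ?p m)
      = of_real (tri q n * tri q (int m) * q powi (n * int m)) * (x powi n * (- ?p) ^ m) / qpoch ?p ?p m"
      by (simp add: mult.assoc)
    also have "(- ?p) ^ m = (-1) ^ m * ?p ^ m" by (rule power_minus)
    also have "complex_of_real (tri q n * tri q (int m) * q powi (n * int m)) * (x powi n * ((-1) ^ m * ?p ^ m)) / qpoch ?p ?p m
      = of_real (tri q n) * x powi n * (euler_coeff ?p m * (of_real (q powi (n + 1))) ^ m)"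
      using q by (simp add: euler_coeff_def tri_of_nat power_int_add power_mult_distrib power_int_mult mult_ac)
    finally show ?thesis .
  qed
  have "infsum (\<lambda>u. F (h u)) (UNIV \<times> UNIV) = infsum F (UNIV \<times> UNIV)"
    by (rule infsum_reindex_bij_betw[OF h])
  moreover have Fhs: "(\<lambda>u. F (h u)) summable_on (UNIV \<times> UNIV)"
    using abs_summable_summable[OF Fs] by (subst summable_on_reindex_bij_betw[OF h])
  have "infsum (\<lambda>u. F (h u)) (UNIV \<times> UNIV) = (\<Sum>\<^sub>\<infinity>n. \<Sum>\<^sub>\<infinity>m. F (h (n, m)))"
    using Fhs by (subst infsum_Sigma'_banach) (auto simp: case_prod_unfold)
  moreover have "(\<Sum>\<^sub>\<infinity>m. F (h (n, m))) = of_real (tri q n) * x powi n * qpoch_inf (of_real (q powi (n + 1))) ?p" for n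
    unfolding Fh
    by (subst infsum_cmult_right) (use norm_summable_imp_summable_on[OF summable_euler[OF p]]
       has_sum_nat_sums[OF euler_product[OF p] summable_euler[OF p]] in auto)
  ultimately have "theta_series q x * (1 / qpoch_inf y ?p) = (\<Sum>\<^sub>\<infinity>n. of_real (tri q n) * x powi n * qpoch_inf (of_real (q powi (n + 1))) ?p)"
    using F by simp
  also have "\<dots> = (\<Sum>\<^sub>\<infinity>n. of_real (tri q (int n)) * x powi (int n) * qpoch_inf (of_real (q powi (int n + 1))) ?p)"
  proof (rule infsum_int_nat)
    fix n :: int assume n: "n < 0"
    have "of_real (q powi (n + 1)) * ?p ^ nat (- n - 1) = of_real (q powi (n + 1) * q ^ nat (- n - 1))"
      by simp
    also have "q ^ nat (- n - 1) = q powi (- n - 1)"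
      using power_int_nonneg_exp[of "- n - 1" q] n by simp
    also have "q powi (n + 1) * q powi (- n - 1) = 1"
      using q by (subst power_int_add[symmetric]) auto
    also have "complex_of_real 1 = 1" by simp
    finally have "qpoch_inf (of_real (q powi (n + 1))) ?p = 0"
      using qpoch_inf_eq_zero_iff[OF p] by blast
    then show "of_real (tri q n) * x powi n * qpoch_inf (of_real (q powi (n + 1))) ?p = 0" by simp
  qed
  also have "\<dots> = (\<Sum>\<^sub>\<infinity>n. qpoch_inf ?p ?p * (euler_coeff ?p n * (- x) ^ n))"
  proof (rule infsum_cong)
    fix n :: nat
    have e: "complex_of_real (q powi (int n + 1)) = ?p * ?p ^ n" using q by (simp add: power_int_add)
    have "qpoch_inf ?p ?p = qpoch ?p ?p n * qpoch_inf (of_real (q powi (int n + 1))) ?p"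
      unfolding e by (rule qpoch_inf_split[OF p])
    moreover have "(- x) ^ n = (-1) ^ n * x ^ n" by (rule power_minus)
    moreover have "(-1) ^ n * (-1) ^ n = (1::complex)" by (simp flip: power_mult_distrib)
    ultimately show "of_real (tri q (int n)) * x powi (int n) * qpoch_inf (of_real (q powi (int n + 1))) ?p
      = qpoch_inf ?p ?p * (euler_coeff ?p n * (- x) ^ n)"
      using qpoch_self_nonzero[OF p, of n] by (simp add: euler_coeff_def tri_of_nat field_simps)
  qed
  also have "\<dots> = qpoch_inf ?p ?p * qpoch_inf (- x) ?p"
    by (subst infsum_cmult_right) (use norm_summable_imp_summable_on[OF summable_euler[OF p]]
       has_sum_nat_sums[OF euler_product[OF p] summable_euler[OF p]] in auto)
  finally show ?thesis using yn by (simp add: theta_q_def y_def field_simps)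
qed

lemma theta_q_step:
  assumes q: "0 < q" "q < 1" and x: "x \<noteq> 0"
  shows "x * theta_q q (of_real q * x) = theta_q q x"
proof -
  let ?p = "complex_of_real q"
  have p: "norm ?p < 1" using q by simp
  have 1: "qpoch_inf (- x) ?p = (1 + x) * qpoch_inf (- (?p * x)) ?p"
    using qpoch_inf_step[OF p, of "- x"] by (simp add: mult.commute)
  have 2: "qpoch_inf (- ?p / (?p * x)) ?p = (1 + 1 / x) * qpoch_inf (- ?p / x) ?p"
    using qpoch_inf_step[OF p, of "- 1 / x"] q by (simp add: field_simps)
  show ?thesis unfolding theta_q_def 1 2 using x by (simp add: field_simps)
qed

text \<open>Both sides have the same quasi-period \<open>q\<close>, so Jacobi's identity propagates from \<open>|x| > q\<close> to all
  of the punctured plane.\<close>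

theorem theta_q_eq_series:
  assumes q: "0 < q" "q < 1" and x: "x \<noteq> 0"
  shows "theta_q q x = theta_series q x"
proof -
  have "norm x > q * q ^ n \<Longrightarrow> x \<noteq> 0 \<Longrightarrow> theta_q q x = theta_series q x" for n
  proof (induction n arbitrary: x)
    case 0
    then show ?case using jacobi_triple_product_large[OF q] by simp
  next
    case (Suc n)
    define y where "y = x / of_real q"
    have y: "y \<noteq> 0" "x = of_real q * y" using Suc.prems q by (auto simp: y_def)
    have "norm y > q * q ^ n" using Suc.prems q by (simp add: y_def norm_divide field_simps)
    then have "theta_q q y = theta_series q y" using Suc.IH y by blast
    moreover have "y * theta_q q x = theta_q q y" using theta_q_step[OF q y(1)] y by simp
    moreover have "theta_series q x * y = theta_series q y"
      using theta_series_shift[OF q y(1), of 1] y by simp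
    ultimately show ?case using y by (metis mult.commute mult_right_cancel)
  qed
  moreover obtain n where "q * q ^ n < norm x"
    using real_arch_pow_inv[of "norm x" q] x q
    by (metis mult.commute mult_le_one less_eq_real_def mult_left_le_one_le order_le_less_trans zero_le_power zero_less_norm_iff)
  ultimately show ?thesis using x by blast
qed

lemma theta_q_shift:
  assumes q: "0 < q" "q < 1" and x: "x \<noteq> 0"
  shows "theta_q q (of_real (q powi m) * x) * (of_real (tri q m) * x powi m) = theta_q q x"
  using theta_series_shift[OF assms, of m] theta_q_eq_series[OF q] q x by simp

lemma theta_q_eq_zero_iff:
  assumes q: "0 < q" "q < 1" and x: "x \<noteq> 0"
  shows "theta_q q x = 0 \<longleftrightarrow> (\<exists>k::int. x = - of_real (q powi k))"
proof -
  let ?p = "complex_of_real q"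
  have p: "norm ?p < 1" using q by simp
  have "theta_q q x = 0 \<longleftrightarrow> (\<exists>n::nat. - x * ?p ^ n = 1) \<or> (\<exists>n::nat. - ?p / x * ?p ^ n = 1)"
    using qpoch_inf_nonzero[OF p p] by (simp add: theta_q_def qpoch_inf_eq_zero_iff[OF p])
  moreover have "- x * ?p ^ n = 1 \<longleftrightarrow> x = - of_real (q powi (- int n))" for n
  proof -
    have "- x * ?p ^ n = 1 \<longleftrightarrow> x * ?p ^ n = - 1" by (metis minus_minus mult_minus_left)
    also have "\<dots> \<longleftrightarrow> x = - of_real (q powi (- int n))"
      using q by (simp add: power_int_minus field_simps)
    finally show ?thesis .
  qed
  moreover have "- ?p / x * ?p ^ n = 1 \<longleftrightarrow> x = - of_real (q powi (int n + 1))" for n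
    using q x by (auto simp: power_int_add field_simps)
  moreover have "(\<exists>n. k = - int n) \<or> (\<exists>n. k = int n + 1)" for k
    by presburger
  ultimately show ?thesis by metis
qed

section \<open>The symmetry of Appell-Lerch sums\<close>

definition partial_theta_tail :: "real \<Rightarrow> nat \<Rightarrow> real" where
  "partial_theta_tail q k = (\<Sum>j. (-1) ^ (k + j) * q ^ (k + j choose 2))"

lemma summable_partial_theta:
  fixes q :: real
  assumes q: "0 < q" "q < 1"
  shows "summable (\<lambda>j. norm ((-1) ^ (k + j) * q ^ (k + j choose 2)))"
proof -
  have "summable (\<lambda>j. q ^ (j choose 2))" using summable_gauss_power[of q 1] q by simp
  from summable_ignore_initial_segment[OF this, of k] show ?thesis
    using q by (simp add: abs_mult power_abs add.commute)
qed

lemma partial_theta_tail_step: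
  assumes q: "0 < q" "q < 1"
  shows "partial_theta_tail q k = (-1) ^ k * q ^ (k choose 2) + partial_theta_tail q (Suc k)"
  unfolding partial_theta_tail_def
  using suminf_split_head[OF summable_norm_cancel[OF summable_partial_theta[OF q]], of k] by simp

lemma partial_theta_tail_bound:
  assumes q: "0 < q" "q < 1"
  shows "\<bar>partial_theta_tail q k\<bar> \<le> (\<Sum>j. q ^ (j choose 2)) * q ^ (k choose 2)"
proof -
  have s: "summable (\<lambda>j. q ^ (j choose 2))"
    using summable_gauss_power[of q 1] q by simp
  have "\<bar>partial_theta_tail q k\<bar> \<le> (\<Sum>j. norm ((-1) ^ (k + j) * q ^ (k + j choose 2)))"
    unfolding partial_theta_tail_def using summable_norm[OF summable_partial_theta[OF q, of k]] by simp
  also have "\<dots> \<le> (\<Sum>j. q ^ (k choose 2) * q ^ (j choose 2))"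
  proof (rule suminf_le[OF _ summable_partial_theta[OF q] summable_mult[OF s]])
    fix j
    have "(k choose 2) + (j choose 2) \<le> (k + j choose 2)"
      by (induction j) (auto simp: choose_two_Suc)
    then have "q ^ (k + j choose 2) \<le> q ^ ((k choose 2) + (j choose 2))"
      using q by (intro power_decreasing) auto
    then show "norm ((-1) ^ (k + j) * q ^ (k + j choose 2)) \<le> q ^ (k choose 2) * q ^ (j choose 2)"
      using q by (simp add: power_add abs_mult power_abs)
  qed
  also have "\<dots> = (\<Sum>j. q ^ (j choose 2)) * q ^ (k choose 2)"
    by (subst suminf_mult[OF s]) simp
  finally show ?thesis .
qed

text \<open>The sum of \<open>(-1)\<^sup>k q\<^bsup>k(k-1)/2\<^esup>\<close> over all \<open>k \<ge> r\<close>. Since the sum over all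
  integers vanishes (the terms for \<open>k\<close> and \<open>1 - k\<close> cancel), the tail from \<open>r\<close> agrees with the
  tail from \<open>2 - r\<close>, and using the one with the positive index keeps it of the size of its first
  term.\<close>

definition partial_theta :: "real \<Rightarrow> int \<Rightarrow> real" where
  "partial_theta q r = partial_theta_tail q (nat (if r \<ge> 1 then r else 2 - r))"

lemma partial_theta_step:
  assumes q: "0 < q" "q < 1"
  shows "partial_theta q r - partial_theta q (r + 1) = (-1) powi r * tri q r"
proof -
  consider "r \<ge> 1" | "r = 0" | "r < 0" by linarith
  then show ?thesis
  proof cases
    case 1
    then obtain k where k: "r = int k" using nonneg_int_cases[of r] by auto
    then show ?thesis using 1 partial_theta_tail_step[OF q, of k]
      by (simp add: partial_theta_def tri_of_nat nat_add_distrib)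
  next
    case 2
    then show ?thesis using partial_theta_tail_step[OF q, of 1]
      by (simp add: partial_theta_def numeral_2_eq_2)
  next
    case 3
    define k where "k = nat (1 - r)"
    have k: "r = 1 - int k" "k \<ge> 2" using 3 by (auto simp: k_def)
    have "tri q r = q ^ (k choose 2)" unfolding k tri_reflect tri_of_nat ..
    moreover have "(-1::real) powi r = - ((-1) ^ k)"
      unfolding k by (cases "even k") (simp_all add: power_int_diff)
    moreover have "nat (2 - r) = Suc k" "nat (2 - (r + 1)) = k" using k by auto
    ultimately show ?thesis using 3 partial_theta_tail_step[OF q, of k]
      by (simp add: partial_theta_def)
  qed
qed

lemma partial_theta_bound:
  assumes q: "0 < q" "q < 1"
  shows "\<bar>partial_theta q r\<bar> \<le> (\<Sum>j. q ^ (j choose 2)) * tri q r"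
proof (cases "r \<ge> 1")
  case True
  then obtain k where k: "r = int k" using nonneg_int_cases[of r] by auto
  then show ?thesis using True partial_theta_tail_bound[OF q, of k]
    by (simp add: partial_theta_def tri_of_nat)
next
  case False
  define k where "k = nat (- r)"
  have k: "r = - int k" using False by (auto simp: k_def)
  have "0 \<le> (\<Sum>j. q ^ (j choose 2))"
    using q summable_gauss_power[of q 1] by (intro suminf_nonneg) auto
  moreover have "q ^ (Suc (Suc k) choose 2) \<le> q ^ (Suc k choose 2)"
    using q by (intro power_decreasing) (auto simp: choose_two_Suc)
  ultimately have "(\<Sum>j. q ^ (j choose 2)) * q ^ (Suc (Suc k) choose 2) \<le> (\<Sum>j. q ^ (j choose 2)) * q ^ (Suc k choose 2)"
    by (rule mult_left_mono[rotated])
  moreover have "nat (2 - r) = Suc (Suc k)" using k by auto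
  ultimately show ?thesis using False partial_theta_tail_bound[OF q, of "Suc (Suc k)"]
    unfolding k tri_neg_of_nat by (simp add: partial_theta_def)
qed

text \<open>The double Laurent coefficients of \<open>\<theta>(x) \<Sum> q\<^bsup>n(n-1)/2\<^esup> y\<^sup>n / (1 + q\<^sup>n / x)\<close>, holomorphic
  in \<open>x \<noteq> 0\<close>. Clearing the denominator gives a first order recurrence in \<open>p\<close>; up to the factor
  \<open>(-1)\<^bsup>p+n\<^esup> q\<^bsup>-pn\<^esup>\<close> it is solved by the tails \<open>partial_theta\<close>, which decay in both directions.\<close>

definition appell_coeff :: "real \<Rightarrow> int \<Rightarrow> int \<Rightarrow> real" where
  "appell_coeff q p n = (-1) powi (p + n) * q powi (- (p * n)) * partial_theta q (p + n)"

lemma appell_coeff_commute: "appell_coeff q p n = appell_coeff q n p"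
  by (simp add: appell_coeff_def add.commute mult.commute)

lemma appell_coeff_step:
  assumes q: "0 < q" "q < 1"
  shows "appell_coeff q p n + q powi n * appell_coeff q (p + 1) n = tri q n * tri q p"
proof -
  have "- ((p + 1) * n) = - (p * n) - n" "p + 1 + n = p + n + 1" by (simp_all add: algebra_simps)
  then have "q powi n * appell_coeff q (p + 1) n
      = - ((-1) powi (p + n)) * (q powi n * q powi (- (p * n) - n)) * partial_theta q (p + n + 1)"
    by (simp only: appell_coeff_def) (simp add: power_int_add mult_ac)
  also have "q powi n * q powi (- (p * n) - n) = q powi (- (p * n))"
    using q by (subst power_int_add[symmetric]) auto
  finally have "appell_coeff q p n + q powi n * appell_coeff q (p + 1) n
     = (-1) powi (p + n) * q powi (- (p * n)) * (partial_theta q (p + n) - partial_theta q (p + n + 1))"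
    by (simp add: appell_coeff_def algebra_simps)
  also have "\<dots> = ((-1) powi (p + n) * (-1) powi (p + n)) * (q powi (- (p * n)) * q powi (p * n)) * (tri q p * tri q n)"
    unfolding partial_theta_step[OF q] using q by (simp add: tri_add mult_ac)
  also have "(-1::real) powi (p + n) * (-1) powi (p + n) = 1"
    by (simp flip: power_int_mult_distrib)
  also have "q powi (- (p * n)) * q powi (p * n) = 1"
    using q by (simp flip: power_int_add)
  finally show ?thesis by simp
qed

text \<open>The bound of the partial theta function by its first term is what makes the double series converge:
  \<open>q\<^bsup>-pn\<^esup>\<close> alone grows, and only \<open>tri q (p + n)\<close> compensates it.\<close>

lemma appell_coeff_bound:
  assumes q: "0 < q" "q < 1"
  shows "\<bar>appell_coeff q p n\<bar> \<le> (\<Sum>j. q ^ (j choose 2)) * (tri q p * tri q n)"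
proof -
  have "\<bar>appell_coeff q p n\<bar> = q powi (- (p * n)) * \<bar>partial_theta q (p + n)\<bar>"
    using q by (simp add: appell_coeff_def abs_mult power_int_abs)
  also have "\<dots> \<le> q powi (- (p * n)) * ((\<Sum>j. q ^ (j choose 2)) * tri q (p + n))"
    using q by (intro mult_left_mono partial_theta_bound) auto
  also have "\<dots> = (\<Sum>j. q ^ (j choose 2)) * (tri q p * tri q n) * (q powi (- (p * n)) * q powi (p * n))"
    using q by (simp add: tri_add)
  also have "q powi (- (p * n)) * q powi (p * n) = 1"
    using q by (simp flip: power_int_add)
  finally show ?thesis by simp
qed

lemma appell_coeff_summable:
  fixes x y :: complex
  assumes q: "0 < q" "q < 1"
  shows "(\<lambda>(n, p). of_real (appell_coeff q p n) * x powi p * y powi n) abs_summable_on UNIV \<times> UNIV"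
proof (rule Infinite_Sum.abs_summable_on_comparison_test)
  define C where "C = (\<Sum>j. q ^ (j choose 2))"
  have "0 \<le> C" unfolding C_def
    using q summable_gauss_power[of q 1] by (intro suminf_nonneg) auto
  have "(\<lambda>(n, p). (of_real (tri q n) * y powi n) * (of_real (tri q p) * x powi p)) abs_summable_on UNIV \<times> UNIV"
    by (intro abs_summable_times summable_tri q)
  from summable_on_cmult_right[OF this, of "norm (complex_of_real C)"]
  show "(\<lambda>(n, p). of_real C * ((of_real (tri q n) * y powi n) * (of_real (tri q p) * x powi p))) abs_summable_on UNIV \<times> UNIV"
    by (simp add: case_prod_unfold norm_mult)
  fix u :: "int \<times> int"
  obtain n p where u: "u = (n, p)" by (cases u)
  have "norm (of_real (appell_coeff q p n) * x powi p * y powi n)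
      \<le> (C * (tri q p * tri q n)) * norm (x powi p) * norm (y powi n)"
    unfolding norm_mult using appell_coeff_bound[OF q, of p n]
    by (intro mult_right_mono) (auto simp: C_def)
  then show "norm (case u of (n, p) \<Rightarrow> of_real (appell_coeff q p n) * x powi p * y powi n)
     \<le> norm (case u of (n, p) \<Rightarrow> of_real C * ((of_real (tri q n) * y powi n) * (of_real (tri q p) * x powi p)))"
    using q \<open>0 \<le> C\<close> by (simp add: u norm_mult abs_mult abs_of_pos mult_ac)
qed

lemma appell_row:
  fixes x :: complex
  assumes q: "0 < q" "q < 1" and x: "x \<noteq> 0"
  shows "(1 + of_real (q powi n) / x) * (\<Sum>\<^sub>\<infinity>p. of_real (appell_coeff q p n) * x powi p)
    = of_real (tri q n) * theta_q q x"
proof -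
  have s: "(\<lambda>p. of_real (appell_coeff q p n) * x powi p) summable_on UNIV"
  proof -
    have "(\<lambda>p. (case (n, p) of (n, p) \<Rightarrow> of_real (appell_coeff q p n) * x powi p * 1 powi n)) abs_summable_on UNIV"
      using appell_coeff_summable[OF q, of x 1] unfolding Infinite_Sum.abs_summable_on_Sigma_iff by blast
    then show ?thesis using abs_summable_summable by simp
  qed
  have "(\<Sum>\<^sub>\<infinity>p. of_real (appell_coeff q p n) * x powi p)
      = (\<Sum>\<^sub>\<infinity>p. of_real (appell_coeff q (p + 1) n) * x powi (p + 1))"
    by (rule infsum_reindex_bij_betw[symmetric, where g = "\<lambda>n. n + 1" and f="\<lambda>p. of_real (appell_coeff q p n) * x powi p"])
       (auto intro!: bij_betwI[of _ _ _ "\<lambda>n. n - 1"])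
  then have "of_real (q powi n) / x * (\<Sum>\<^sub>\<infinity>p. of_real (appell_coeff q p n) * x powi p)
      = (\<Sum>\<^sub>\<infinity>p. of_real (q powi n) / x * (of_real (appell_coeff q (p + 1) n) * x powi (p + 1)))"
    by (simp only: infsum_cmult_right')
  also have "\<dots> = (\<Sum>\<^sub>\<infinity>p. of_real (q powi n * appell_coeff q (p + 1) n) * x powi p)"
    using x by (intro infsum_cong) (simp add: power_int_add)
  finally have e: "of_real (q powi n) / x * (\<Sum>\<^sub>\<infinity>p. of_real (appell_coeff q p n) * x powi p) = \<dots>" .
  have s2: "(\<lambda>p. of_real (q powi n * appell_coeff q (p + 1) n) * x powi p) summable_on UNIV"
  proof -
    have "(\<lambda>p. of_real (tri q n) * (of_real (tri q p) * x powi p)) summable_on UNIV"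
      by (intro summable_on_cmult_right abs_summable_summable[OF summable_tri[OF q]])
    from summable_on_add[OF this summable_on_cmult_right[OF s, of "- 1"]] show ?thesis
      using appell_coeff_step[OF q, of _ n, symmetric]
      by (simp add: algebra_simps flip: of_real_mult)
  qed
  have "(1 + of_real (q powi n) / x) * (\<Sum>\<^sub>\<infinity>p. of_real (appell_coeff q p n) * x powi p)
    = (\<Sum>\<^sub>\<infinity>p. of_real (appell_coeff q p n) * x powi p) + (\<Sum>\<^sub>\<infinity>p. of_real (q powi n * appell_coeff q (p + 1) n) * x powi p)"
    unfolding distrib_right e by simp
  also have "\<dots> = (\<Sum>\<^sub>\<infinity>p. of_real (appell_coeff q p n) * x powi p + of_real (q powi n * appell_coeff q (p + 1) n) * x powi p)"
    by (rule infsum_add[symmetric, OF s s2])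
  also have "\<dots> = (\<Sum>\<^sub>\<infinity>p. of_real (tri q n) * (of_real (tri q p) * x powi p))"
  proof (rule infsum_cong)
    fix p
    have "complex_of_real (appell_coeff q p n) + of_real (q powi n * appell_coeff q (p + 1) n) = of_real (tri q n * tri q p)"
      by (simp only: of_real_add[symmetric] appell_coeff_step[OF q])
    then show "of_real (appell_coeff q p n) * x powi p + of_real (q powi n * appell_coeff q (p + 1) n) * x powi p
       = of_real (tri q n) * (of_real (tri q p) * x powi p)"
      by (metis distrib_right mult.assoc of_real_mult)
  qed
  also have "\<dots> = of_real (tri q n) * theta_q q x"
    unfolding theta_q_eq_series[OF q x] theta_series_def by (rule infsum_cmult_right')
  finally show ?thesis .
qed

lemma appell_lerch_expansion:
  fixes x y :: complex
  assumes q: "0 < q" "q < 1" and x: "x \<noteq> 0" "\<And>k::int. x \<noteq> - of_real (q powi k)"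
  shows "theta_q q x * (\<Sum>\<^sub>\<infinity>n. of_real (tri q n) * y powi n / (1 + of_real (q powi n) / x))
    = (\<Sum>\<^sub>\<infinity>n. \<Sum>\<^sub>\<infinity>p. of_real (appell_coeff q p n) * x powi p * y powi n)"
  unfolding infsum_cmult_right'[symmetric]
proof (rule infsum_cong)
  fix n :: int
  have "1 + of_real (q powi n) / x \<noteq> 0"
  proof
    assume "1 + of_real (q powi n) / x = 0"
    then have "x = - of_real (q powi n)" using x(1) by (simp add: field_simps add_eq_0_iff)
    then show False using x(2) by blast
  qed
  then have "theta_q q x * (of_real (tri q n) * y powi n / (1 + of_real (q powi n) / x))
      = (\<Sum>\<^sub>\<infinity>p. of_real (appell_coeff q p n) * x powi p) * y powi n"
    using appell_row[OF q x(1), of n] by (simp add: divide_eq_eq mult_ac)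
  then show "theta_q q x * (of_real (tri q n) * y powi n / (1 + of_real (q powi n) / x))
     = (\<Sum>\<^sub>\<infinity>p. of_real (appell_coeff q p n) * x powi p * y powi n)"
    by (simp only: infsum_cmult_left')
qed

text \<open>The Laurent coefficients on the left are symmetric in the two indices.\<close>

theorem appell_lerch_symmetry:
  fixes x y :: complex
  assumes q: "0 < q" "q < 1" and x: "x \<noteq> 0" "\<And>k::int. x \<noteq> - of_real (q powi k)"
    and y: "y \<noteq> 0" "\<And>k::int. y \<noteq> - of_real (q powi k)"
  shows "theta_q q x * (\<Sum>\<^sub>\<infinity>n. of_real (tri q n) * y powi n / (1 + of_real (q powi n) / x))
    = theta_q q y * (\<Sum>\<^sub>\<infinity>n. of_real (tri q n) * x powi n / (1 + of_real (q powi n) / y))"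
  unfolding appell_lerch_expansion[OF q x] appell_lerch_expansion[OF q y]
proof (subst infsum_swap_banach)
  show "(\<lambda>(n, p). of_real (appell_coeff q p n) * x powi p * y powi n) summable_on UNIV \<times> UNIV"
    by (rule abs_summable_summable[OF appell_coeff_summable[OF q]])
  show "(\<Sum>\<^sub>\<infinity>p. \<Sum>\<^sub>\<infinity>n. of_real (appell_coeff q p n) * x powi p * y powi n)
      = (\<Sum>\<^sub>\<infinity>n. \<Sum>\<^sub>\<infinity>p. of_real (appell_coeff q p n) * y powi p * x powi n)"
    by (intro infsum_cong) (subst appell_coeff_commute, simp add: mult_ac)
qed

section \<open>The Borel coefficients and the entire function u\<close>

lemma qpoch_inf_holomorphic:
  fixes p :: complex
  assumes "norm p < 1"
  shows "(\<lambda>x. qpoch_inf x p) holomorphic_on A"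
proof -
  have "(\<lambda>x. qpoch_inf x p) holomorphic_on ball 0 R" for R
    by (rule power_series_holomorphic[where a = "euler_coeff p"]) (use euler_product[OF assms] in simp)
  then have "(\<lambda>x. qpoch_inf x p) field_differentiable at x" for x
    using holomorphic_on_imp_differentiable_at[of _ "ball 0 (norm x + 1)" x] by auto
  then show ?thesis by (simp add: holomorphic_on_def field_differentiable_at_within)
qed

lemma qpoch_inf_continuous [continuous_intros]:
  fixes p :: complex
  assumes "norm p < 1" "continuous_on A f"
  shows "continuous_on A (\<lambda>x. qpoch_inf (f x) p)"
  using continuous_on_compose2[OF holomorphic_on_imp_continuous_on[OF qpoch_inf_holomorphic[OF assms(1), of UNIV]] assms(2)]
  by auto

text \<open>The Cauchy product of the Euler expansions of \<open>(q s; q)\<^sub>\<infinity>\<close>, \<open>1 / (a s; q)\<^sub>\<infinity>\<close> and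
  \<open>1 / (b s; q)\<^sub>\<infinity>\<close>.\<close>

definition borel_fps :: "real \<Rightarrow> complex \<Rightarrow> complex \<Rightarrow> complex fps" where
  "borel_fps q a b = Abs_fps (\<lambda>m. euler_coeff (of_real q) m * of_real q ^ m)
     * Abs_fps (\<lambda>m. a ^ m / qpoch (of_real q) (of_real q) m)
     * Abs_fps (\<lambda>m. b ^ m / qpoch (of_real q) (of_real q) m)"

definition borel_coeff :: "real \<Rightarrow> complex \<Rightarrow> complex \<Rightarrow> nat \<Rightarrow> complex" where
  "borel_coeff q a b m = fps_nth (borel_fps q a b) m"

lemma fps_nth_times_power:
  "fps_nth (F * G) m * x ^ m = (\<Sum>i\<le>m. (fps_nth F i * x ^ i) * (fps_nth G (m - i) * (x::complex) ^ (m - i)))"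
proof -
  have "fps_nth (F * G) m * x ^ m = (\<Sum>i\<le>m. fps_nth F i * fps_nth G (m - i) * (x ^ i * x ^ (m - i)))"
    by (simp add: fps_mult_nth sum_distrib_right atLeast0AtMost flip: power_add)
  then show ?thesis by (simp add: mult_ac)
qed

lemma summable_norm_powser_ball:
  fixes c :: "nat \<Rightarrow> complex"
  assumes "\<And>x. norm x < R \<Longrightarrow> summable (\<lambda>m. c m * x ^ m)" "norm x < R"
  shows "summable (\<lambda>m. norm (c m * x ^ m))"
proof -
  obtain r where r: "norm x < r" "r < R" using assms(2) dense by blast
  have "r > 0" using r norm_ge_zero[of x] by linarith
  show ?thesis
    by (rule powser_insidea[of c "of_real r"]) (use assms(1)[of "of_real r"] r \<open>r > 0\<close> in auto)
qed

lemma fps_product_sums: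
  assumes "\<And>x. norm x < R \<Longrightarrow> (\<lambda>m. fps_nth F m * (x::complex) ^ m) sums f x"
    and "\<And>x. norm x < R \<Longrightarrow> (\<lambda>m. fps_nth G m * x ^ m) sums g x" and "norm x < R"
  shows "(\<lambda>m. fps_nth (F * G) m * x ^ m) sums (f x * g x)"
proof -
  have "summable (\<lambda>m. norm (fps_nth F m * x ^ m))" "summable (\<lambda>m. norm (fps_nth G m * x ^ m))"
    by (rule summable_norm_powser_ball[of R]; use assms sums_summable in blast)+
  from Cauchy_product_sums[OF this] show ?thesis
    unfolding fps_nth_times_power using assms by (simp add: sums_iff)
qed

lemma less_radius:
  fixes c y :: real
  assumes "0 \<le> c" "c * y < 1"
  shows "y < (if c = 0 then y + 1 else 1 / c)"
proof (cases "c = 0")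
  case False
  then have "c > 0" using assms(1) by simp
  then show ?thesis using assms(2) by (simp add: pos_less_divide_eq mult.commute)
qed simp

lemma borel_coeff_sums:
  assumes q: "0 < q" "q < 1" and s: "max (norm a) (norm b) * norm s < 1"
  shows "(\<lambda>m. borel_coeff q a b m * s ^ m) sums
    (qpoch_inf (of_real q * s) (of_real q) / (qpoch_inf (a * s) (of_real q) * qpoch_inf (b * s) (of_real q)))"
proof -
  let ?p = "complex_of_real q"
  have p: "norm ?p < 1" using q by simp
  define R where "R = (if max (norm a) (norm b) = 0 then norm s + 1 else 1 / max (norm a) (norm b))"
  have sR: "norm s < R" unfolding R_def by (rule less_radius) (use s le_max_iff_disj[of 0 "norm a" "norm b"] in auto)
  have R: "norm (a * x) < 1" "norm (b * x) < 1" if "norm x < R" for x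
  proof -
    have "max (norm a) (norm b) * norm x < 1"
      using that by (auto simp: R_def field_simps max_def split: if_splits)
    moreover have "norm a * norm x \<le> max (norm a) (norm b) * norm x" "norm b * norm x \<le> max (norm a) (norm b) * norm x"
      by (intro mult_right_mono; simp)+
    ultimately show "norm (a * x) < 1" "norm (b * x) < 1" by (simp_all add: norm_mult)
  qed
  have 1: "(\<lambda>m. fps_nth (Abs_fps (\<lambda>m. euler_coeff ?p m * ?p ^ m)) m * x ^ m) sums qpoch_inf (?p * x) ?p" for x
    using euler_product[OF p, of "?p * x"] by (simp add: power_mult_distrib mult.assoc)
  have 2: "(\<lambda>m. fps_nth (Abs_fps (\<lambda>m. a ^ m / qpoch ?p ?p m)) m * x ^ m) sums (1 / qpoch_inf (a * x) ?p)" if "norm x < R" for x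
    using euler_inverse_product[OF p R(1)[OF that]] by (simp add: power_mult_distrib)
  have 3: "(\<lambda>m. fps_nth (Abs_fps (\<lambda>m. b ^ m / qpoch ?p ?p m)) m * x ^ m) sums (1 / qpoch_inf (b * x) ?p)" if "norm x < R" for x
    using euler_inverse_product[OF p R(2)[OF that]] by (simp add: power_mult_distrib)
  have "(\<lambda>m. borel_coeff q a b m * s ^ m) sums (qpoch_inf (?p * s) ?p * (1 / qpoch_inf (a * s) ?p) * (1 / qpoch_inf (b * s) ?p))"
    unfolding borel_coeff_def borel_fps_def
    by (intro fps_product_sums[where R=R and f = "\<lambda>x. qpoch_inf (?p * x) ?p * (1 / qpoch_inf (a * x) ?p)"]
         fps_product_sums[where R=R and f = "\<lambda>x. qpoch_inf (?p * x) ?p"] 1 2 3 sR)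
  then show ?thesis by simp
qed

lemma borel_coeff_summable:
  assumes q: "0 < q" "q < 1" and s: "max (norm a) (norm b) * norm s < 1"
  shows "summable (\<lambda>m. norm (borel_coeff q a b m * s ^ m))"
proof -
  define R where "R = (if max (norm a) (norm b) = 0 then norm s + 1 else 1 / max (norm a) (norm b))"
  show ?thesis
  proof (rule summable_norm_powser_ball[of R])
    show "norm s < R" unfolding R_def by (rule less_radius) (use s le_max_iff_disj[of 0 "norm a" "norm b"] in auto)
    fix x :: complex assume "norm x < R"
    then have "max (norm a) (norm b) * norm x < 1"
      by (auto simp: R_def field_simps max_def split: if_splits)
    from sums_summable[OF borel_coeff_sums[OF q this]]
    show "summable (\<lambda>m. borel_coeff q a b m * x ^ m)" .
  qed
qed

lemma borel_coeff_0: "borel_coeff q a b 0 = 1"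
  by (simp add: borel_coeff_def borel_fps_def qpoch_def)

lemma euler_inverse_fps_dilate:
  fixes p x :: complex
  assumes "norm p < 1"
  shows "Abs_fps (\<lambda>m. x ^ m / qpoch p p m) oo (fps_const p * fps_X)
     = (1 - fps_const x * fps_X) * Abs_fps (\<lambda>m. x ^ m / qpoch p p m)"
proof (rule fps_ext)
  fix n
  show "fps_nth (Abs_fps (\<lambda>m. x ^ m / qpoch p p m) oo (fps_const p * fps_X)) n
     = fps_nth ((1 - fps_const x * fps_X) * Abs_fps (\<lambda>m. x ^ m / qpoch p p m)) n"
  proof (cases n)
    case (Suc k)
    have "1 - p * p ^ k \<noteq> 0" "qpoch p p k \<noteq> 0"
      using qpoch_self_nonzero[OF assms, of "Suc k"] by (auto simp: qpoch_def)
    then show ?thesis unfolding Suc fps_compose_linear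
      by (simp add: left_diff_distrib mult.assoc qpoch_def field_simps)
  qed (simp add: fps_compose_linear qpoch_def)
qed

lemma euler_fps_dilate:
  fixes p :: complex
  assumes "norm p < 1"
  shows "(1 - fps_const p * fps_X) * (Abs_fps (\<lambda>m. euler_coeff p m * p ^ m) oo (fps_const p * fps_X))
     = Abs_fps (\<lambda>m. euler_coeff p m * p ^ m)"
proof (rule fps_ext)
  fix n
  show "fps_nth ((1 - fps_const p * fps_X) * (Abs_fps (\<lambda>m. euler_coeff p m * p ^ m) oo (fps_const p * fps_X))) n
     = fps_nth (Abs_fps (\<lambda>m. euler_coeff p m * p ^ m)) n"
  proof (cases n)
    case (Suc k)
    have "p ^ Suc k * euler_coeff p (Suc k) - p ^ k * euler_coeff p k = euler_coeff p (Suc k)"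
      using euler_coeff_Suc[OF assms, of k] by (simp add: algebra_simps)
    then have "p ^ Suc k * (p ^ Suc k * euler_coeff p (Suc k) - p ^ k * euler_coeff p k) = p ^ Suc k * euler_coeff p (Suc k)"
      by simp
    then show ?thesis unfolding Suc fps_compose_linear
      by (simp add: left_diff_distrib mult.assoc algebra_simps)
  qed (simp add: fps_compose_linear)
qed

text \<open>The generating function \<open>g\<close> satisfies \<open>(1 - q s) g(q s) = (1 - a s) (1 - b s) g(s)\<close>; compare
  coefficients.\<close>

lemma borel_coeff_recurrence:
  assumes q: "0 < q" "q < 1"
  shows "(1 - of_real q) * borel_coeff q a b 1 = a + b - of_real q"
    and "(1 - of_real q ^ (n + 2)) * borel_coeff q a b (n + 2)
      = (a + b - of_real q ^ (n + 2)) * borel_coeff q a b (n + 1) - a * b * borel_coeff q a b n"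
proof -
  let ?p = "complex_of_real q"
  let ?d = "fps_const ?p * fps_X"
  let ?G = "borel_fps q a b"
  have p: "norm ?p < 1" using q by simp
  define E A B where "E = Abs_fps (\<lambda>m. euler_coeff ?p m * ?p ^ m)"
    and "A = Abs_fps (\<lambda>m. a ^ m / qpoch ?p ?p m)" and "B = Abs_fps (\<lambda>m. b ^ m / qpoch ?p ?p m)"
  have G: "?G = E * A * B" by (simp add: borel_fps_def E_def A_def B_def)
  have "(1 - fps_const ?p * fps_X) * (?G oo ?d) = ((1 - fps_const ?p * fps_X) * (E oo ?d)) * (A oo ?d) * (B oo ?d)"
    unfolding G by (simp add: fps_compose_mult_distrib mult.assoc)
  also have "\<dots> = E * ((1 - fps_const a * fps_X) * A) * ((1 - fps_const b * fps_X) * B)"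
    unfolding E_def A_def B_def euler_fps_dilate[OF p] euler_inverse_fps_dilate[OF p] ..
  also have "\<dots> = (1 - fps_const a * fps_X) * ((1 - fps_const b * fps_X) * ?G)"
    unfolding G by (simp only: mult_ac)
  finally have eq: "fps_nth ((1 - fps_const ?p * fps_X) * (?G oo ?d)) m
     = fps_nth ((1 - fps_const a * fps_X) * ((1 - fps_const b * fps_X) * ?G)) m" for m by simp
  show "(1 - of_real q) * borel_coeff q a b 1 = a + b - of_real q"
    using eq[of 1] borel_coeff_0[of q a b] unfolding fps_compose_linear borel_coeff_def
    by (simp add: left_diff_distrib mult.assoc algebra_simps)
  show "(1 - of_real q ^ (n + 2)) * borel_coeff q a b (n + 2)
      = (a + b - of_real q ^ (n + 2)) * borel_coeff q a b (n + 1) - a * b * borel_coeff q a b n"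
    using eq[of "n + 2"] unfolding fps_compose_linear borel_coeff_def
    by (simp add: left_diff_distrib mult.assoc algebra_simps)
qed

definition u_series :: "real \<Rightarrow> complex \<Rightarrow> complex \<Rightarrow> complex \<Rightarrow> complex" where
  "u_series q a b t = (\<Sum>m. (borel_coeff q a b m * of_real q ^ (Suc m choose 2)) * t ^ m)"

lemma u_series_summable:
  assumes q: "0 < q" "q < 1"
  shows "summable (\<lambda>m. norm (borel_coeff q a b m * of_real q ^ (Suc m choose 2) * t ^ m))"
proof -
  \<comment> \<open>At \<open>s = 1 / c\<close> the generating function converges, so the coefficients grow at most geometrically and the Gaussian weight wins.\<close>
  define c where "c = max (norm a) (norm b) + 1"
  define r where "r = 1 / c"
  have c: "c \<ge> 1" "max (norm a) (norm b) < c" using le_max_iff_disj[of 0 "norm a" "norm b"] by (auto simp: c_def)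
  then have r: "r > 0" "max (norm a) (norm b) * norm (complex_of_real r) < 1" by (simp_all add: r_def norm_divide)
  have s: "summable (\<lambda>m. norm (borel_coeff q a b m * of_real r ^ m))"
    by (rule borel_coeff_summable[OF q r(2)])
  then have "(\<lambda>m. norm (borel_coeff q a b m * of_real r ^ m)) \<longlonglongrightarrow> 0" by (rule summable_LIMSEQ_zero)
  then have "Bseq (\<lambda>m. norm (borel_coeff q a b m * of_real r ^ m))"
    using convergentI convergent_imp_Bseq by blast
  then obtain K where K: "K > 0" "\<And>m. norm (borel_coeff q a b m * of_real r ^ m) \<le> K"
    by (auto simp: Bseq_def)
  have gs: "summable (\<lambda>m. K * (q ^ (m choose 2) * (q * norm t / r) ^ m))"
    using q r by (intro summable_mult summable_gauss_power) auto
  show ?thesis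
  proof (rule summable_comparison_test'[OF gs])
    fix m
    have "norm (borel_coeff q a b m * of_real q ^ (Suc m choose 2) * t ^ m)
       = norm (borel_coeff q a b m * of_real r ^ m) * (q ^ (m choose 2) * (q * norm t / r) ^ m)"
      using q r by (simp add: norm_mult norm_power choose_two_Suc power_add power_divide power_mult_distrib)
    also have "\<dots> \<le> K * (q ^ (m choose 2) * (q * norm t / r) ^ m)"
      using K q r by (intro mult_right_mono) auto
    finally show "norm (norm (borel_coeff q a b m * of_real q ^ (Suc m choose 2) * t ^ m)) \<le> K * (q ^ (m choose 2) * (q * norm t / r) ^ m)"
      by simp
  qed
qed

lemma u_series_sums:
  assumes q: "0 < q" "q < 1"
  shows "(\<lambda>m. borel_coeff q a b m * of_real q ^ (Suc m choose 2) * t ^ m) sums u_series q a b t"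
  unfolding u_series_def by (rule summable_sums[OF summable_norm_cancel[OF u_series_summable[OF q]]])

lemma u_series_holomorphic:
  assumes q: "0 < q" "q < 1"
  shows "u_series q a b holomorphic_on A"
proof -
  have "u_series q a b holomorphic_on ball 0 R" for R
    by (rule power_series_holomorphic[where a = "\<lambda>m. borel_coeff q a b m * of_real q ^ (Suc m choose 2)"])
       (use u_series_sums[OF q] in simp)
  then have "u_series q a b field_differentiable at x" for x
    using holomorphic_on_imp_differentiable_at[of _ "ball 0 (norm x + 1)" x] by auto
  then show ?thesis by (simp add: holomorphic_on_def field_differentiable_at_within)
qed

lemma u_series_0: "u_series q a b 0 = 1"
  unfolding u_series_def by (subst powser_zero) (simp add: borel_coeff_0 numeral_2_eq_2)

lemma sums_shift_one:
  assumes "(f::nat \<Rightarrow> complex) sums s"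
  shows "(\<lambda>m. if m = 0 then 0 else f (m - 1)) sums s"
  using sums_Suc_iff[of "\<lambda>m. if m = 0 then 0 else f (m - 1)" s] assms by simp

text \<open>The recurrence of the Borel coefficients, rewritten for the coefficients with the weight
  \<open>q\<^bsup>m(m+1)/2\<^esup>\<close>. It is the equation of \<open>(-a b t; q)\<^sub>\<infinity> \<^sub>2\<phi>\<^sub>1(q/a, q/b; 0; q; -a b t)\<close>.\<close>

lemma u_series_functional_eq:
  assumes q: "0 < q" "q < 1"
  shows "u_series q a b t = (1 + of_real q * (a + b) * t) * u_series q a b (of_real q * t)
    - of_real q ^ 2 * t * (1 + of_real q * a * b * t) * u_series q a b (of_real q ^ 2 * t)"
proof -
  let ?p = "complex_of_real q"
  let ?u = "u_series q a b"
  define U where "U m = borel_coeff q a b m * ?p ^ (Suc m choose 2)" for m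
  have s: "(\<lambda>m. U m * t ^ m) sums ?u t" for t unfolding U_def by (rule u_series_sums[OF q])
  have U0: "U 0 = 1" by (simp add: U_def borel_coeff_0 numeral_2_eq_2)
  have U1: "(1 - ?p) * U 1 = ?p * (a + b - ?p)"
    using borel_coeff_recurrence(1)[OF q, of a b] by (simp add: U_def numeral_2_eq_2 mult_ac)
  have U2: "U (n + 2) = ?p ^ (n + 2) * U (n + 2) + ?p * (a + b) * ?p ^ (n + 1) * U (n + 1)
       - ?p ^ 2 * (?p ^ 2) ^ (n + 1) * U (n + 1) - ?p ^ 3 * a * b * (?p ^ 2) ^ n * U n" for n
  proof -
    let ?e = "?p ^ (Suc n choose 2)"
    have e1: "U (n + 1) = borel_coeff q a b (n + 1) * (?e * ?p ^ (n + 1))"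
      by (simp add: U_def choose_two_Suc power_add)
    have e2: "U (n + 2) = borel_coeff q a b (n + 2) * (?e * ?p ^ (n + 1) * ?p ^ (n + 2))"
      by (simp add: U_def choose_two_Suc power_add)
    have e0: "U n = borel_coeff q a b n * ?e" by (simp add: U_def)
    have "(1 - ?p ^ (n + 2)) * U (n + 2) = ((1 - ?p ^ (n + 2)) * borel_coeff q a b (n + 2)) * (?e * ?p ^ (n + 1) * ?p ^ (n + 2))"
      unfolding e2 by (simp only: mult_ac)
    also have "\<dots> = ((a + b - ?p ^ (n + 2)) * borel_coeff q a b (n + 1) - a * b * borel_coeff q a b n) * (?e * ?p ^ (n + 1) * ?p ^ (n + 2))"
      unfolding borel_coeff_recurrence(2)[OF q] ..
    also have "\<dots> = ?p * (a + b) * ?p ^ (n + 1) * U (n + 1)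
       - ?p ^ 2 * (?p ^ 2) ^ (n + 1) * U (n + 1) - ?p ^ 3 * a * b * (?p ^ 2) ^ n * U n"
      unfolding e0 e1
      by (simp add: algebra_simps power_add power2_eq_square power3_eq_cube power_mult_distrib)
    finally show ?thesis by (simp add: algebra_simps)
  qed
  define S where "S f = (\<lambda>m::nat. if m = 0 then 0 else (f (m - 1) :: complex))" for f
  have S: "S f sums l" if "f sums l" for f l unfolding S_def by (rule sums_shift_one[OF that])
  have "(\<lambda>m. U m * (?p * t) ^ m + ?p * (a + b) * t * S (\<lambda>m. U m * (?p * t) ^ m) m
       - ?p ^ 2 * t * S (\<lambda>m. U m * (?p ^ 2 * t) ^ m) m
       - ?p ^ 3 * a * b * t ^ 2 * S (S (\<lambda>m. U m * (?p ^ 2 * t) ^ m)) m)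
    sums (?u (?p * t) + ?p * (a + b) * t * ?u (?p * t) - ?p ^ 2 * t * ?u (?p ^ 2 * t) - ?p ^ 3 * a * b * t ^ 2 * ?u (?p ^ 2 * t))"
    by (intro sums_diff sums_add sums_mult S s)
  moreover have "U m * (?p * t) ^ m + ?p * (a + b) * t * S (\<lambda>m. U m * (?p * t) ^ m) m
       - ?p ^ 2 * t * S (\<lambda>m. U m * (?p ^ 2 * t) ^ m) m
       - ?p ^ 3 * a * b * t ^ 2 * S (S (\<lambda>m. U m * (?p ^ 2 * t) ^ m)) m = U m * t ^ m" for m
  proof -
    consider "m = 0" | "m = 1" | n where "m = n + 2" by (metis One_nat_def add_2_eq_Suc' not0_implies_Suc)
    then show ?thesis
    proof cases
      case 1 then show ?thesis by (simp add: S_def)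
    next
      case 2
      have "U 1 = ?p * U 1 + ?p * (a + b) - ?p ^ 2"
        using U1 by (simp add: algebra_simps power2_eq_square)
      then have "U 1 * t = (?p * U 1 + ?p * (a + b) - ?p ^ 2) * t" by simp
      then show ?thesis unfolding 2 by (simp add: S_def U0 algebra_simps)
    next
      case 3
      have "U (n + 2) * t ^ (n + 2) = (?p ^ (n + 2) * U (n + 2) + ?p * (a + b) * ?p ^ (n + 1) * U (n + 1)
       - ?p ^ 2 * (?p ^ 2) ^ (n + 1) * U (n + 1) - ?p ^ 3 * a * b * (?p ^ 2) ^ n * U n) * t ^ (n + 2)"
        by (subst U2) (rule refl)
      also have "\<dots> = U (n + 2) * (?p * t) ^ (n + 2) + ?p * (a + b) * t * (U (n + 1) * (?p * t) ^ (n + 1))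
       - ?p ^ 2 * t * (U (n + 1) * (?p ^ 2 * t) ^ (n + 1))
       - ?p ^ 3 * a * b * t ^ 2 * (U n * (?p ^ 2 * t) ^ n)"
        unfolding power_mult_distrib power_add by (simp add: algebra_simps power2_eq_square)
      finally show ?thesis unfolding 3 by (simp add: S_def)
    qed
  qed
  ultimately have "?u (?p * t) + ?p * (a + b) * t * ?u (?p * t) - ?p ^ 2 * t * ?u (?p ^ 2 * t) - ?p ^ 3 * a * b * t ^ 2 * ?u (?p ^ 2 * t) = ?u t"
    using sums_unique2[OF _ s[of t]] by simp
  then show ?thesis by (simp add: algebra_simps power2_eq_square power3_eq_cube)
qed

text \<open>A continuous solution of a \<open>q\<close>-difference equation that vanishes at the origin vanishes
  on the whole disc: its values are controlled by those closer to the origin, at the cost of a factor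
  whose infinite product converges.\<close>

lemma q_difference_zero:
  fixes D :: "complex \<Rightarrow> complex"
  assumes q: "0 < q" "q < 1" and K: "K \<ge> 0" and cont: "isCont D 0" and D0: "D 0 = 0"
    and step: "\<And>t. norm t < R \<Longrightarrow> norm (D t) \<le> (1 + K * norm t) * max (norm (D (of_real q * t))) (norm (D (of_real q ^ 2 * t)))"
    and t: "norm t < R"
  shows "D t = 0"
proof -
  have "norm (D t) \<le> e * exp (K * norm t / (1 - q))" if e: "e > 0" for e
  proof -
    obtain d where d: "d > 0" "\<And>x. norm x < d \<Longrightarrow> norm (D x) < e"
      using cont e unfolding continuous_at_eps_delta D0 by auto
    have "norm t < R \<Longrightarrow> q ^ n * norm t < d \<Longrightarrow> norm (D t) \<le> e * exp (K * norm t / (1 - q))" for n t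
    proof (induction n arbitrary: t)
      case 0
      have "1 \<le> exp (K * norm t / (1 - q))" using K q by simp
      then have "e * 1 \<le> e * exp (K * norm t / (1 - q))" using e by (intro mult_left_mono) auto
      then show ?case using d(2)[of t] 0 by simp
    next
      case (Suc n)
      have q2: "q\<^sup>2 \<le> q" using q by (simp add: power2_eq_square)
      let ?B = "e * exp (K * (q * norm t) / (1 - q))"
      have n1: "norm (of_real q * t) = q * norm t" "norm (of_real q ^ 2 * t) = q\<^sup>2 * norm t"
        using q by (simp_all add: norm_mult norm_power)
      have n2: "q * norm t \<le> 1 * norm t" "q\<^sup>2 * norm t \<le> q * norm t"
        using q q2 by (intro mult_right_mono; simp)+
      have "norm (D (of_real q * t)) \<le> ?B"
        using Suc.IH[of "of_real q * t"] Suc.prems n1 n2 by (simp add: mult_ac)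
      moreover have "norm (D (of_real q ^ 2 * t)) \<le> ?B"
      proof -
        have "q ^ n * (q\<^sup>2 * norm t) \<le> q ^ n * (q * norm t)"
          using n2 q by (intro mult_left_mono) auto
        then have "norm (D (of_real q ^ 2 * t)) \<le> e * exp (K * (q\<^sup>2 * norm t) / (1 - q))"
          using Suc.IH[of "of_real q ^ 2 * t"] Suc.prems n1 n2 by (simp add: mult_ac)
        also have "\<dots> \<le> ?B"
          using e K q n2 by (intro mult_left_mono) (auto intro!: divide_right_mono mult_left_mono)
        finally show ?thesis .
      qed
      ultimately have "max (norm (D (of_real q * t))) (norm (D (of_real q ^ 2 * t))) \<le> ?B" by simp
      then have "norm (D t) \<le> (1 + K * norm t) * ?B"
        using step[OF Suc.prems(1)] K by (meson add_nonneg_nonneg mult_left_mono mult_nonneg_nonneg norm_ge_zero order_trans zero_le_one)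
      also have "\<dots> \<le> exp (K * norm t) * ?B"
        using e exp_ge_add_one_self[of "K * norm t"] by (intro mult_right_mono) auto
      also have "\<dots> = e * exp (K * norm t / (1 - q))"
      proof -
        have "K * norm t + K * (q * norm t) / (1 - q) = K * norm t / (1 - q)"
          using q by (simp add: field_simps)
        then show ?thesis by (metis exp_add mult.left_commute)
      qed
      finally show ?case .
    qed
    moreover obtain n where "q ^ n * norm t < d"
    proof -
      have "(\<lambda>n. q ^ n * norm t) \<longlonglongrightarrow> 0 * norm t" using q by (intro tendsto_intros LIMSEQ_power_zero) auto
      then have "eventually (\<lambda>n. q ^ n * norm t < d) sequentially" using d by (intro order_tendstoD(2)[of _ 0]) auto
      then show ?thesis using that by (auto simp: eventually_sequentially)
    qed
    ultimately show ?thesis using t by blast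
  qed
  then have "norm (D t) / exp (K * norm t / (1 - q)) \<le> 0 + e" if "e > 0" for e
    using that by (simp add: divide_le_eq)
  then have "norm (D t) / exp (K * norm t / (1 - q)) \<le> 0" by (rule field_le_epsilon)
  then show ?thesis by (simp add: divide_le_0_iff)
qed

section \<open>Analytic continuation of the basic hypergeometric series\<close>

definition phi21_coeff :: "real \<Rightarrow> complex \<Rightarrow> complex \<Rightarrow> nat \<Rightarrow> complex" where
  "phi21_coeff q a b n = qpoch a (of_real q) n * qpoch b (of_real q) n / qpoch (of_real q) (of_real q) n"

lemma phi21_series_eq: "phi21_series q a b x = (\<Sum>n. phi21_coeff q a b n * x ^ n)"
  by (simp add: phi21_series_def phi21_coeff_def)

lemma norm_power_less:
  fixes q :: real
  assumes "0 < q" "q < 1" "c * q ^ N < 1" "0 \<le> c" "N \<le> n"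
  shows "c * q ^ n < 1"
proof -
  have "c * q ^ n \<le> c * q ^ N" using assms by (intro mult_left_mono power_decreasing) auto
  then show ?thesis using assms by simp
qed

text \<open>\<open>(a; q)\<^sub>n = (a; q)\<^sub>\<infinity> / (a q\<^sup>n; q)\<^sub>\<infinity>\<close>, and similarly for \<open>b\<close> and \<open>q\<close>, turn the coefficient
  into \<open>K\<^sub>0\<close> times the generating function of the Borel coefficients at \<open>s = q\<^sup>n\<close>.\<close>

lemma phi21_coeff_eq_K0:
  assumes q: "0 < q" "q < 1" and n: "max (norm a) (norm b) * q ^ n < 1"
  shows "(\<lambda>m. K0 q a b * (borel_coeff q a b m * (of_real q ^ n) ^ m)) sums phi21_coeff q a b n"
proof -
  let ?p = "complex_of_real q"
  have p: "norm ?p < 1" using q by simp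
  have le: "norm a * q ^ n \<le> max (norm a) (norm b) * q ^ n" "norm b * q ^ n \<le> max (norm a) (norm b) * q ^ n"
    using q by (intro mult_right_mono; simp)+
  have nz: "qpoch_inf (a * ?p ^ n) ?p \<noteq> 0" "qpoch_inf (b * ?p ^ n) ?p \<noteq> 0"
    by (rule qpoch_inf_nonzero[OF p]; use order_le_less_trans[OF le(1) n] order_le_less_trans[OF le(2) n] q in \<open>simp add: norm_mult norm_power\<close>)+
  have "norm ?p * norm ?p ^ n < 1" using q by (simp add: power_less_one_iff flip: power_Suc)
  then have nz2: "qpoch_inf (?p * ?p ^ n) ?p \<noteq> 0"
    by (intro qpoch_inf_nonzero[OF p]) (simp add: norm_mult norm_power)
  have "(\<lambda>m. borel_coeff q a b m * (?p ^ n) ^ m) sums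
     (qpoch_inf (?p * ?p ^ n) ?p / (qpoch_inf (a * ?p ^ n) ?p * qpoch_inf (b * ?p ^ n) ?p))"
    by (rule borel_coeff_sums[OF q]) (use n q in \<open>simp add: norm_power\<close>)
  from sums_mult[OF this, of "K0 q a b"]
  have "(\<lambda>m. K0 q a b * (borel_coeff q a b m * (?p ^ n) ^ m)) sums
     (K0 q a b * (qpoch_inf (?p * ?p ^ n) ?p / (qpoch_inf (a * ?p ^ n) ?p * qpoch_inf (b * ?p ^ n) ?p)))" .
  also have "K0 q a b * (qpoch_inf (?p * ?p ^ n) ?p / (qpoch_inf (a * ?p ^ n) ?p * qpoch_inf (b * ?p ^ n) ?p))
     = phi21_coeff q a b n"
    unfolding K0_def qpoch_inf_split[OF p, of a n] qpoch_inf_split[OF p, of b n] qpoch_inf_split[OF p, of ?p n] phi21_coeff_def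
    using nz nz2 qpoch_self_nonzero[OF p, of n] by (simp add: field_simps)
  finally show ?thesis .
qed

lemma phi21_coeff_bounded:
  assumes q: "0 < q" "q < 1"
  obtains K where "K > 0" "\<And>n. norm (phi21_coeff q a b n) \<le> K"
proof -
  let ?p = "complex_of_real q"
  have p: "norm ?p < 1" using q by simp
  have "qpoch_inf ?p ?p \<noteq> 0" by (rule qpoch_inf_nonzero[OF p p])
  then have "(\<lambda>n. phi21_coeff q a b n) \<longlonglongrightarrow> qpoch_inf a ?p * qpoch_inf b ?p / qpoch_inf ?p ?p"
    unfolding phi21_coeff_def qpoch_def by (intro tendsto_intros qpoch_inf_LIMSEQ p)
  then have "Bseq (phi21_coeff q a b)" using convergentI convergent_imp_Bseq by blast
  then show ?thesis using that by (auto simp: Bseq_def)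
qed

lemma phi21_series_sums:
  assumes q: "0 < q" "q < 1" and x: "norm x < 1"
  shows "(\<lambda>n. phi21_coeff q a b n * x ^ n) sums phi21_series q a b x"
proof -
  obtain K where K: "K > 0" "\<And>n. norm (phi21_coeff q a b n) \<le> K"
    using phi21_coeff_bounded[OF q] by blast
  have "summable (\<lambda>n. phi21_coeff q a b n * x ^ n)"
  proof (rule summable_comparison_test')
    show "summable (\<lambda>n. K * norm x ^ n)" using x by (intro summable_mult summable_geometric) auto
    show "norm (phi21_coeff q a b n * x ^ n) \<le> K * norm x ^ n" for n
      using K(2)[of n] by (simp add: norm_mult norm_power mult_right_mono)
  qed
  then show ?thesis unfolding phi21_series_eq by (rule summable_sums)
qed

definition phi21_domain :: "real \<Rightarrow> complex set" where
  "phi21_domain q = - range (\<lambda>n::nat. 1 / of_real q ^ n)"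

lemma phi21_domain_iff:
  assumes q: "0 < q" "q < 1"
  shows "x \<in> phi21_domain q \<longleftrightarrow> qpoch_inf x (of_real q) \<noteq> 0"
  using q by (auto simp: phi21_domain_def qpoch_inf_eq_zero_iff field_simps)

lemma phi21_domain_nonzero:
  assumes q: "0 < q" "q < 1" and x: "x \<in> phi21_domain q"
  shows "1 - x * of_real q ^ m \<noteq> 0"
  using x q unfolding phi21_domain_iff[OF q] by (auto simp: qpoch_inf_eq_zero_iff)

lemma phi21_domain_open:
  assumes q: "0 < q" "q < 1"
  shows "open (phi21_domain q)"
proof -
  have "open ((\<lambda>x. qpoch_inf x (complex_of_real q)) -` (- {0}))"
    using q by (intro open_vimage qpoch_inf_continuous continuous_on_id) auto
  moreover have "phi21_domain q = (\<lambda>x. qpoch_inf x (complex_of_real q)) -` (- {0})"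
    using phi21_domain_iff[OF q] by auto
  ultimately show ?thesis by simp
qed

lemma phi21_domain_connected: "connected (phi21_domain q)"
  unfolding phi21_domain_def
  by (intro path_connected_imp_connected path_connected_complement_countable) auto

lemma ball_subset_phi21_domain:
  assumes q: "0 < q" "q < 1"
  shows "ball 0 1 \<subseteq> phi21_domain q"
  using q qpoch_inf_nonzero[of "complex_of_real q"] by (auto simp: phi21_domain_iff)

lemma neg_real_in_phi21_domain:
  assumes q: "0 < q" "q < 1" and t: "t > 0"
  shows "- of_real t \<in> phi21_domain q"
proof -
  have "- complex_of_real t * of_real q ^ n \<noteq> 1" for n
  proof
    assume "- complex_of_real t * of_real q ^ n = 1"
    then have "- (t * q ^ n) = 1" by (metis mult_minus_left of_real_eq_1_iff of_real_minus of_real_mult of_real_power)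
    then show False using t q by (smt (verit) mult_pos_pos zero_less_power)
  qed
  then show ?thesis using q by (simp add: phi21_domain_iff qpoch_inf_eq_zero_iff)
qed

lemma phi21_continuation_unique:
  assumes q: "0 < q" "q < 1"
    and "F holomorphic_on phi21_domain q" "G holomorphic_on phi21_domain q"
    and "\<And>x. norm x < 1 \<Longrightarrow> F x = G x" and "x \<in> phi21_domain q"
  shows "F x = G x"
  by (rule analytic_continuation_open[of "ball 0 1" "phi21_domain q"])
     (use assms phi21_domain_open phi21_domain_connected ball_subset_phi21_domain in auto)

text \<open>An explicit continuation: all terms of the series from the \<open>N\<close>-th on, expanded in powers of
  \<open>q\<^sup>n\<close>, become geometric series with poles at \<open>q\<^bsup>-m\<^esup>\<close>.\<close>

definition phi21_expansion :: "real \<Rightarrow> complex \<Rightarrow> complex \<Rightarrow> nat \<Rightarrow> complex \<Rightarrow> complex" where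
  "phi21_expansion q a b N x = (\<Sum>n<N. phi21_coeff q a b n * x ^ n)
     + K0 q a b * x ^ N * (\<Sum>m. borel_coeff q a b m * (of_real q ^ N) ^ m / (1 - x * of_real q ^ m))"

lemma borel_coeff_summable_power:
  assumes q: "0 < q" "q < 1" and N: "max (norm a) (norm b) * q ^ N < 1"
  shows "summable (\<lambda>m. norm (borel_coeff q a b m * (of_real q ^ N) ^ m))"
  by (rule borel_coeff_summable[OF q]) (use q N in \<open>simp add: norm_power\<close>)

lemma phi21_expansion_holomorphic:
  assumes q: "0 < q" "q < 1" and N: "max (norm a) (norm b) * q ^ N < 1"
  shows "phi21_expansion q a b N holomorphic_on phi21_domain q"
proof -
  let ?p = "complex_of_real q"
  define f where "f m x = borel_coeff q a b m * (?p ^ N) ^ m / (1 - x * ?p ^ m)" for m x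
  have "(\<lambda>x. \<Sum>m. f m x) holomorphic_on phi21_domain q"
  proof (rule holomorphic_uniform_sequence[OF phi21_domain_open[OF q]])
    show "(\<lambda>x. \<Sum>m<n. f m x) holomorphic_on phi21_domain q" for n
      unfolding f_def using phi21_domain_nonzero[OF q] by (intro holomorphic_intros) auto
    fix x assume x: "x \<in> phi21_domain q"
    obtain d where d: "d > 0" "cball x d \<subseteq> phi21_domain q"
      using phi21_domain_open[OF q] x open_contains_cball by blast
    have "(\<lambda>m. (norm x + d) * q ^ m) \<longlonglongrightarrow> (norm x + d) * 0" using q by (intro tendsto_intros LIMSEQ_power_zero) auto
    then have "eventually (\<lambda>m. (norm x + d) * q ^ m < 1/2) sequentially" by (intro order_tendstoD(2)[of _ 0]) auto
    then obtain m0 where m0: "\<And>m. m \<ge> m0 \<Longrightarrow> (norm x + d) * q ^ m < 1/2"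
      by (auto simp: eventually_sequentially)
    have "\<exists>C. \<forall>y\<in>cball x d. norm (1 / (1 - y * ?p ^ m)) \<le> C" for m
    proof -
      have "continuous_on (cball x d) (\<lambda>y. 1 / (1 - y * ?p ^ m))"
        using d phi21_domain_nonzero[OF q] by (intro continuous_intros) auto
      then have "compact ((\<lambda>y. 1 / (1 - y * ?p ^ m)) ` cball x d)"
        by (rule compact_continuous_image) simp
      then show ?thesis using compact_imp_bounded bounded_iff by (metis (no_types, lifting) imageI)
    qed
    then obtain C where C: "\<And>m y. y \<in> cball x d \<Longrightarrow> norm (1 / (1 - y * ?p ^ m)) \<le> C m" by metis
    define C' where "C' = Max (insert 2 (C ` {..<m0}))"
    have C': "norm (1 / (1 - y * ?p ^ m)) \<le> C'" if y: "y \<in> cball x d" for m y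
    proof (cases "m < m0")
      case True
      then have "C m \<le> C'" unfolding C'_def by (intro Max_ge) auto
      then show ?thesis using C[OF y, of m] by simp
    next
      case False
      have "norm y \<le> norm x + d" using y norm_triangle_ineq2[of y x] by (simp add: dist_norm norm_minus_commute)
      then have "norm (y * ?p ^ m) \<le> (norm x + d) * q ^ m"
        using q by (simp add: norm_mult norm_power mult_right_mono)
      then have "norm (y * ?p ^ m) \<le> 1/2" using m0[of m] False by simp
      moreover have "1 - norm (y * ?p ^ m) \<le> norm (1 - y * ?p ^ m)" using norm_triangle_ineq2[of 1 "y * ?p ^ m"] by simp
      ultimately have ge: "1/2 \<le> norm (1 - y * ?p ^ m)" by linarith
      have "norm (1 / (1 - y * ?p ^ m)) = 1 / norm (1 - y * ?p ^ m)" by (simp add: norm_divide)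
      also have "\<dots> \<le> 1 / (1/2)" using ge by (intro divide_left_mono) auto
      also have "\<dots> \<le> C'" unfolding C'_def by simp
      finally show ?thesis .
    qed
    have "uniform_limit (cball x d) (\<lambda>n x. \<Sum>m<n. f m x) (\<lambda>x. \<Sum>m. f m x) sequentially"
    proof (rule Weierstrass_m_test)
      show "summable (\<lambda>m. norm (borel_coeff q a b m * (?p ^ N) ^ m) * C')"
        by (intro summable_mult2 borel_coeff_summable_power q N)
      fix m y assume "y \<in> cball x d"
      have "norm (f m y) = norm (borel_coeff q a b m * (?p ^ N) ^ m) * norm (1 / (1 - y * ?p ^ m))"
        by (simp add: f_def norm_divide)
      also have "\<dots> \<le> norm (borel_coeff q a b m * (?p ^ N) ^ m) * C'"
        by (intro mult_left_mono C' \<open>y \<in> cball x d\<close>) auto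
      finally show "norm (f m y) \<le> norm (borel_coeff q a b m * (?p ^ N) ^ m) * C'" .
    qed
    then show "\<exists>d>0. cball x d \<subseteq> phi21_domain q \<and>
        uniform_limit (cball x d) (\<lambda>n x. \<Sum>m<n. f m x) (\<lambda>x. \<Sum>m. f m x) sequentially"
      using d by blast
  qed
  then have "(\<lambda>x. (\<Sum>n<N. phi21_coeff q a b n * x ^ n) + K0 q a b * x ^ N * (\<Sum>m. f m x)) holomorphic_on phi21_domain q"
    by (intro holomorphic_intros)
  then show ?thesis by (simp add: phi21_expansion_def[abs_def] f_def)
qed

lemma phi21_expansion_series:
  assumes q: "0 < q" "q < 1" and N: "max (norm a) (norm b) * q ^ N < 1" and x: "norm x < 1"
  shows "phi21_expansion q a b N x = phi21_series q a b x"
proof -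
  let ?p = "complex_of_real q"
  let ?c = "borel_coeff q a b"
  have cn: "max (norm a) (norm b) * q ^ (k + N) < 1" for k
    by (rule norm_power_less[OF q N]) (auto simp: le_max_iff_disj)
  define f where "f = (\<lambda>(m, k). ?c m * (?p ^ N) ^ m * (x * ?p ^ m) ^ k)"
  have fs: "f abs_summable_on UNIV \<times> UNIV"
  proof (rule Infinite_Sum.abs_summable_on_comparison_test)
    show "(\<lambda>(m, k). (?c m * (?p ^ N) ^ m) * x ^ k) abs_summable_on UNIV \<times> UNIV"
    proof (rule abs_summable_times)
      show "(\<lambda>m. ?c m * (?p ^ N) ^ m) abs_summable_on UNIV"
        using norm_summable_imp_summable_on[of "\<lambda>m. norm (?c m * (?p ^ N) ^ m)"]
          borel_coeff_summable_power[OF q N] by simp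
      have "summable (\<lambda>k. norm (x ^ k))" using x by (simp add: norm_power summable_geometric)
      then show "(\<lambda>k. x ^ k) abs_summable_on UNIV"
        using norm_summable_imp_summable_on[of "\<lambda>k. norm (x ^ k)"] by simp
    qed
    fix u :: "nat \<times> nat"
    obtain m k where u: "u = (m, k)" by (cases u)
    have "norm (x * ?p ^ m) ^ k \<le> norm x ^ k"
      using q by (intro power_mono) (auto simp: norm_mult norm_power intro!: mult_right_le_one_le power_le_one)
    then show "norm (f u) \<le> norm (case u of (m, k) \<Rightarrow> (?c m * (?p ^ N) ^ m) * x ^ k)"
      by (simp add: u f_def norm_mult norm_power mult_left_mono)
  qed
  have rows: "infsum (\<lambda>k. f (m, k)) UNIV = ?c m * (?p ^ N) ^ m / (1 - x * ?p ^ m)" for m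
  proof -
    have "norm (x * ?p ^ m) \<le> norm x"
      using q by (auto simp: norm_mult norm_power intro!: mult_right_le_one_le power_le_one)
    then have lt: "norm (x * ?p ^ m) < 1" using x by simp
    have "infsum (\<lambda>k. (x * ?p ^ m) ^ k) UNIV = 1 / (1 - x * ?p ^ m)"
      by (rule has_sum_nat_sums[OF geometric_sums[OF lt]]) (use lt in \<open>simp add: norm_power summable_geometric\<close>)
    then show ?thesis unfolding f_def by (simp add: infsum_cmult_right')
  qed
  have cols: "K0 q a b * infsum (\<lambda>m. f (m, k)) UNIV = phi21_coeff q a b (k + N) * x ^ k" for k
  proof -
    have S: "summable (\<lambda>m. norm (?c m * (?p ^ (k + N)) ^ m))"
      by (rule borel_coeff_summable_power[OF q cn])
    have "(\<Sum>\<^sub>\<infinity>m. ?c m * (?p ^ (k + N)) ^ m) = (\<Sum>m. ?c m * (?p ^ (k + N)) ^ m)"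
      by (rule has_sum_nat_sums[OF summable_sums[OF summable_norm_cancel[OF S]] S])
    moreover have "K0 q a b * (\<Sum>m. ?c m * (?p ^ (k + N)) ^ m) = phi21_coeff q a b (k + N)"
      using phi21_coeff_eq_K0[OF q cn, of k] summable_norm_cancel[OF S]
      by (simp add: sums_iff suminf_mult)
    moreover have "f (m, k) = ?c m * (?p ^ (k + N)) ^ m * x ^ k" for m
    proof -
      have "(?p ^ m) ^ k = (?p ^ k) ^ m" by (simp only: power_mult[symmetric] mult.commute)
      then have "(?p ^ N) ^ m * (x * ?p ^ m) ^ k = (?p ^ (k + N)) ^ m * x ^ k"
        unfolding power_add power_mult_distrib by (simp only: mult_ac)
      then show ?thesis by (simp only: f_def prod.case mult.assoc)
    qed
    ultimately show ?thesis by (simp add: infsum_cmult_left' mult.assoc[symmetric])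
  qed
  have "infsum (\<lambda>m. infsum (\<lambda>k. f (m, k)) UNIV) UNIV = infsum (\<lambda>k. infsum (\<lambda>m. f (m, k)) UNIV) UNIV"
    by (rule infsum_swap_banach) (use abs_summable_summable[OF fs] in \<open>simp add: case_prod_unfold\<close>)
  then have sw: "(\<Sum>\<^sub>\<infinity>m. ?c m * (?p ^ N) ^ m / (1 - x * ?p ^ m)) = infsum (\<lambda>k. infsum (\<lambda>m. f (m, k)) UNIV) UNIV"
    by (simp only: rows)
  have "K0 q a b * (\<Sum>\<^sub>\<infinity>m. ?c m * (?p ^ N) ^ m / (1 - x * ?p ^ m)) = (\<Sum>\<^sub>\<infinity>k. phi21_coeff q a b (k + N) * x ^ k)"
    unfolding sw cols[symmetric] by (rule infsum_cmult_right'[symmetric])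
  moreover have "(\<Sum>\<^sub>\<infinity>m. ?c m * (?p ^ N) ^ m / (1 - x * ?p ^ m)) = (\<Sum>m. ?c m * (?p ^ N) ^ m / (1 - x * ?p ^ m))"
  proof -
    have "(\<lambda>m. infsum (\<lambda>k. f (m, k)) UNIV) summable_on UNIV"
      by (rule summable_on_Sigma_banach) (use abs_summable_summable[OF fs] in \<open>simp add: case_prod_unfold\<close>)
    then have "((\<lambda>m. ?c m * (?p ^ N) ^ m / (1 - x * ?p ^ m)) has_sum (\<Sum>\<^sub>\<infinity>m. ?c m * (?p ^ N) ^ m / (1 - x * ?p ^ m))) UNIV"
      unfolding rows by (rule has_sum_infsum)
    then show ?thesis using has_sum_imp_sums sums_unique by blast
  qed
  moreover have "(\<lambda>k. phi21_coeff q a b (k + N) * x ^ k) sums (\<Sum>\<^sub>\<infinity>k. phi21_coeff q a b (k + N) * x ^ k)"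
  proof -
    have "(\<lambda>k. infsum (\<lambda>m. f (m, k)) UNIV) summable_on UNIV"
    proof (rule summable_on_Sigma_banach)
      have "(\<lambda>(k, m). f (m, k)) summable_on UNIV \<times> UNIV"
        using abs_summable_summable[OF fs] summable_on_swap[of f UNIV UNIV] by (simp add: case_prod_unfold)
      then show "(\<lambda>(k, m). f (m, k)) summable_on (SIGMA x:UNIV. UNIV)" by simp
    qed
    then have "(\<lambda>k. K0 q a b * infsum (\<lambda>m. f (m, k)) UNIV) summable_on UNIV"
      by (rule summable_on_cmult_right)
    then show ?thesis unfolding cols by (intro has_sum_imp_sums has_sum_infsum)
  qed
  ultimately have tail: "(\<lambda>k. phi21_coeff q a b (k + N) * x ^ k) sums
     (K0 q a b * (\<Sum>m. ?c m * (?p ^ N) ^ m / (1 - x * ?p ^ m)))" by simp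
  have "(\<lambda>k. phi21_coeff q a b (k + N) * x ^ (k + N)) sums
     (x ^ N * (K0 q a b * (\<Sum>m. ?c m * (?p ^ N) ^ m / (1 - x * ?p ^ m))))"
    using sums_mult[OF tail, of "x ^ N"] by (simp add: power_add mult_ac)
  moreover have "(\<lambda>k. phi21_coeff q a b (k + N) * x ^ (k + N)) sums (phi21_series q a b x - (\<Sum>n<N. phi21_coeff q a b n * x ^ n))"
    using phi21_series_sums[OF q x, of a b] by (subst sums_iff_shift) simp
  ultimately have "x ^ N * (K0 q a b * (\<Sum>m. ?c m * (?p ^ N) ^ m / (1 - x * ?p ^ m))) = phi21_series q a b x - (\<Sum>n<N. phi21_coeff q a b n * x ^ n)"
    by (rule sums_unique2)
  then show ?thesis unfolding phi21_expansion_def by (simp add: mult_ac)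
qed

lemma ex_mult_power_less_one:
  assumes q: "0 < q" "q < (1::real)"
  shows "\<exists>N. c * q ^ N < 1"
proof -
  have "(\<lambda>n. c * q ^ n) \<longlonglongrightarrow> c * 0" using q by (intro tendsto_intros LIMSEQ_power_zero) auto
  then have "eventually (\<lambda>n. c * q ^ n < 1) sequentially" by (intro order_tendstoD(2)[of _ 0]) auto
  then show ?thesis by (auto simp: eventually_sequentially)
qed

lemma phi21_spec:
  assumes q: "0 < q" "q < 1"
  shows "phi21 q a b holomorphic_on phi21_domain q"
    and "norm x < 1 \<Longrightarrow> phi21 q a b x = phi21_series q a b x"
proof -
  obtain N where N: "max (norm a) (norm b) * q ^ N < 1" using ex_mult_power_less_one[OF q] by blast
  have "\<exists>F. F holomorphic_on phi21_domain q \<and> (\<forall>x. norm x < 1 \<longrightarrow> F x = phi21_series q a b x)"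
    using phi21_expansion_holomorphic[OF q N] phi21_expansion_series[OF q N] by blast
  from someI_ex[OF this]
  have "phi21 q a b holomorphic_on phi21_domain q \<and> (\<forall>x. norm x < 1 \<longrightarrow> phi21 q a b x = phi21_series q a b x)"
    unfolding phi21_def phi21_domain_def .
  then show "phi21 q a b holomorphic_on phi21_domain q"
    and "norm x < 1 \<Longrightarrow> phi21 q a b x = phi21_series q a b x" by auto
qed

lemma phi21_eq_expansion:
  assumes q: "0 < q" "q < 1" and N: "max (norm a) (norm b) * q ^ N < 1" and x: "x \<in> phi21_domain q"
  shows "phi21 q a b x = phi21_expansion q a b N x"
  by (rule phi21_continuation_unique[OF q _ _ _ x])
     (use phi21_spec[OF q] phi21_expansion_holomorphic[OF q N] phi21_expansion_series[OF q N] in auto)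

text \<open>From \<open>(1 - q\<^bsup>n+1\<^esup>) f\<^bsub>n+1\<^esub> = (1 - a q\<^sup>n) (1 - b q\<^sup>n) f\<^sub>n\<close> for the coefficients.\<close>

lemma phi21_functional_eq:
  assumes q: "0 < q" "q < 1" and x: "norm x < 1"
  shows "(1 - x) * phi21_series q a b x = (1 - (a + b) * x) * phi21_series q a b (of_real q * x)
    + a * b * x * phi21_series q a b (of_real q ^ 2 * x)"
proof -
  let ?p = "complex_of_real q"
  let ?f = "phi21_coeff q a b" and ?F = "phi21_series q a b"
  have p: "norm ?p < 1" using q by simp
  have rec: "(1 - ?p ^ Suc n) * ?f (Suc n) = (1 - a * ?p ^ n) * (1 - b * ?p ^ n) * ?f n" for n
  proof -
    have "1 - ?p * ?p ^ n \<noteq> 0" "qpoch ?p ?p n \<noteq> 0"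
      using qpoch_self_nonzero[OF p, of "Suc n"] by (auto simp: qpoch_def)
    then show ?thesis by (simp add: phi21_coeff_def qpoch_def mult_ac)
  qed
  have "q\<^sup>2 \<le> 1" using q by (simp add: power_le_one)
  then have "q * norm x \<le> 1 * norm x" "q\<^sup>2 * norm x \<le> 1 * norm x"
    using q by (intro mult_right_mono norm_ge_zero; linarith)+
  then have "q * norm x < 1" "q\<^sup>2 * norm x < 1" using x by linarith+
  then have nx: "norm (?p * x) < 1" "norm (?p ^ 2 * x) < 1"
    using q by (auto simp: norm_mult norm_power)
  note s = phi21_series_sums[OF q, of _ a b]
  define S where "S f = (\<lambda>m::nat. if m = 0 then 0 else (f (m - 1) :: complex))" for f
  have S: "S f sums l" if "f sums l" for f l unfolding S_def by (rule sums_shift_one[OF that])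
  have "(\<lambda>n. ?f n * (?p * x) ^ n - (a + b) * x * S (\<lambda>n. ?f n * (?p * x) ^ n) n
      + a * b * x * S (\<lambda>n. ?f n * (?p ^ 2 * x) ^ n) n + x * S (\<lambda>n. ?f n * x ^ n) n)
    sums (?F (?p * x) - (a + b) * x * ?F (?p * x) + a * b * x * ?F (?p ^ 2 * x) + x * ?F x)"
    by (intro sums_add sums_diff sums_mult S s nx x)
  moreover have "?f n * (?p * x) ^ n - (a + b) * x * S (\<lambda>n. ?f n * (?p * x) ^ n) n
      + a * b * x * S (\<lambda>n. ?f n * (?p ^ 2 * x) ^ n) n + x * S (\<lambda>n. ?f n * x ^ n) n = ?f n * x ^ n" for n
  proof (cases n)
    case (Suc k)
    have "?f (Suc k) = ?p ^ Suc k * ?f (Suc k) + (1 - a * ?p ^ k) * (1 - b * ?p ^ k) * ?f k"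
      using rec[of k] by (simp add: algebra_simps)
    then have "?f (Suc k) * x ^ Suc k = (?p ^ Suc k * ?f (Suc k) + (1 - a * ?p ^ k) * (1 - b * ?p ^ k) * ?f k) * x ^ Suc k"
      by simp
    also have "\<dots> = ?f (Suc k) * (?p * x) ^ Suc k - (a + b) * x * (?f k * (?p * x) ^ k)
      + a * b * x * (?f k * (?p ^ 2 * x) ^ k) + x * (?f k * x ^ k)"
      unfolding power_mult_distrib by (simp add: algebra_simps power2_eq_square power_mult_distrib)
    finally show ?thesis unfolding Suc by (simp add: S_def)
  qed (simp add: S_def)
  ultimately have "(\<lambda>n. ?f n * x ^ n) sums (?F (?p * x) - (a + b) * x * ?F (?p * x) + a * b * x * ?F (?p ^ 2 * x) + x * ?F x)"
    by (simp only:)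
  from sums_unique2[OF this s[OF x]]
  have "?F x = ?F (?p * x) - (a + b) * x * ?F (?p * x) + a * b * x * ?F (?p ^ 2 * x) + x * ?F x" by (rule sym)
  then have "?F x - x * ?F x = ?F (?p * x) - (a + b) * x * ?F (?p * x) + a * b * x * ?F (?p ^ 2 * x)"
    by (metis add_diff_cancel_right')
  then show ?thesis by (simp only: left_diff_distrib mult_1_left)
qed

lemma phi21_series_0: "phi21_series q a b 0 = 1"
  unfolding phi21_series_eq by (subst powser_zero) (simp add: phi21_coeff_def qpoch_def)

text \<open>In this disc the series for \<open>\<^sub>2\<phi>\<^sub>1\<close> converges. The product satisfies the equation of
  \<open>u_series\<close>, and both have the value \<open>1\<close> at the origin, so the difference is zero.\<close>

lemma u_product_near_zero:
  assumes q: "0 < q" "q < 1" and ab: "a \<noteq> 0" "b \<noteq> 0" and t: "norm (a * b * t) < 1"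
  shows "qpoch_inf (- a * b * t) (of_real q) * phi21 q (of_real q / a) (of_real q / b) (- a * b * t)
    = u_series q a b t"
proof -
  let ?p = "complex_of_real q"
  have p: "norm ?p < 1" using q by simp
  define A B where "A = ?p / a" and "B = ?p / b"
  define W where "W t = qpoch_inf (- a * b * t) ?p * phi21 q A B (- a * b * t)" for t
  define D where "D t = W t - u_series q a b t" for t
  define R where "R = 1 / norm (a * b)"
  have R: "norm t < R \<longleftrightarrow> norm (a * b * t) < 1" for t
    using ab by (simp add: R_def norm_mult field_simps)
  have dom: "- a * b * t \<in> phi21_domain q" if "norm t < R" for t
    using that ball_subset_phi21_domain[OF q] unfolding R by (auto simp: norm_minus_commute)
  have scale: "norm (?p * t) < R" "norm (?p ^ 2 * t) < R" if "norm t < R" for t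
  proof -
    have "q\<^sup>2 \<le> 1" using q by (simp add: power_le_one)
    then have "q * norm t \<le> 1 * norm t" "q\<^sup>2 * norm t \<le> 1 * norm t"
      using q by (intro mult_right_mono norm_ge_zero; linarith)+
    then have "q * norm t < R" "q\<^sup>2 * norm t < R" using that by linarith+
    then show "norm (?p * t) < R" "norm (?p ^ 2 * t) < R" using q by (auto simp: norm_mult norm_power)
  qed
  have Weq: "W t = (1 + ?p * (a + b) * t) * W (?p * t) - ?p ^ 2 * t * (1 + ?p * a * b * t) * W (?p ^ 2 * t)"
    if t: "norm t < R" for t
  proof -
    define x where "x = - a * b * t"
    define F where "F = phi21_series q A B"
    have F: "phi21 q A B x = F x" "phi21 q A B (?p * x) = F (?p * x)" "phi21 q A B (?p ^ 2 * x) = F (?p ^ 2 * x)"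
      unfolding F_def using t scale[OF t] unfolding R x_def
      by (intro phi21_spec(2)[OF q]; simp add: norm_mult mult_ac)+
    have nx: "norm x < 1" using t unfolding R by (simp add: x_def)
    have W: "W t = qpoch_inf x ?p * F x" "W (?p * t) = qpoch_inf (?p * x) ?p * F (?p * x)"
      "W (?p ^ 2 * t) = qpoch_inf (?p ^ 2 * x) ?p * F (?p ^ 2 * x)"
      using F by (simp_all add: W_def x_def mult_ac)
    have s1: "qpoch_inf x ?p = (1 - x) * qpoch_inf (?p * x) ?p"
      using qpoch_inf_step[OF p, of x] by (simp add: mult.commute)
    have s2: "qpoch_inf (?p * x) ?p = (1 - ?p * x) * qpoch_inf (?p ^ 2 * x) ?p"
      using qpoch_inf_step[OF p, of "?p * x"] by (simp add: mult_ac power2_eq_square)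
    have c1: "(A + B) * x = - (?p * (a + b) * t)" "A * B * x = - (?p ^ 2 * t)"
      using ab by (simp_all add: A_def B_def x_def field_simps power2_eq_square)
    have "W t = qpoch_inf (?p * x) ?p * ((1 - x) * F x)"
      unfolding W s1 by (simp only: mult_ac)
    also have "\<dots> = (1 - (A + B) * x) * (qpoch_inf (?p * x) ?p * F (?p * x))
        + A * B * x * (qpoch_inf (?p * x) ?p * F (?p ^ 2 * x))"
      unfolding F_def phi21_functional_eq[OF q nx] by (simp only: distrib_left mult_ac)
    also have "qpoch_inf (?p * x) ?p * F (?p ^ 2 * x) = (1 - ?p * x) * W (?p ^ 2 * t)"
      unfolding s2 W by (simp only: mult_ac)
    also have "qpoch_inf (?p * x) ?p * F (?p * x) = W (?p * t)" by (rule W(2)[symmetric])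
    finally show ?thesis unfolding c1 by (simp add: x_def mult_ac)
  qed
  have "D t = 0" if t: "norm t < R" for t
  proof (rule q_difference_zero[OF q _ _ _ _ t])
    show "0 \<le> norm (a + b) + 2" by (simp add: add_nonneg_nonneg)
    have "D holomorphic_on ball 0 R"
      unfolding D_def W_def
    proof (intro holomorphic_on_diff holomorphic_on_mult)
      show "(\<lambda>x. qpoch_inf (- a * b * x) ?p) holomorphic_on ball 0 R"
        using holomorphic_on_compose_gen[OF _ qpoch_inf_holomorphic[OF p, of UNIV], of "\<lambda>x. - a * b * x" "ball 0 R"]
        by (auto simp: o_def intro!: holomorphic_intros)
      show "(\<lambda>x. phi21 q A B (- a * b * x)) holomorphic_on ball 0 R"
      proof -
        have "(\<lambda>x. - a * b * x) holomorphic_on ball 0 R" by (intro holomorphic_intros)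
        moreover have "(\<lambda>x. - a * b * x) ` ball 0 R \<subseteq> phi21_domain q"
        proof (rule image_subsetI)
          fix x :: complex assume "x \<in> ball 0 R"
          then show "- a * b * x \<in> phi21_domain q" by (intro dom) simp
        qed
        ultimately show ?thesis
          using holomorphic_on_compose_gen[OF _ phi21_spec(1)[OF q, of A B], of "\<lambda>x. - a * b * x" "ball 0 R"]
          by (simp only: o_def)
      qed
      show "u_series q a b holomorphic_on ball 0 R" by (rule u_series_holomorphic[OF q])
    qed
    then have "continuous_on (ball 0 R) D" by (rule holomorphic_on_imp_continuous_on)
    moreover have "R > 0" using ab by (simp add: R_def)
    ultimately show "isCont D 0" by (simp add: continuous_on_eq_continuous_at)
    show "D 0 = 0" unfolding D_def W_def u_series_0
      using phi21_spec(2)[OF q, of 0 A B] by (simp add: phi21_series_0)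
    fix t :: complex assume t: "norm t < R"
    have "norm (a * b * t) < 1" using t unfolding R .
    then have "norm (?p * a * b * t) \<le> 1" using q by (simp add: norm_mult mult_le_one mult.assoc)
    then have n2: "norm (1 + ?p * a * b * t) \<le> 2"
      using norm_triangle_ineq[of 1 "?p * a * b * t"] by simp
    define X where "X = max (norm (D (?p * t))) (norm (D (?p ^ 2 * t)))"
    have X: "norm (D (?p * t)) \<le> X" "norm (D (?p ^ 2 * t)) \<le> X" "0 \<le> X" by (auto simp: X_def le_max_iff_disj)
    have "D t = (1 + ?p * (a + b) * t) * D (?p * t) - ?p ^ 2 * t * (1 + ?p * a * b * t) * D (?p ^ 2 * t)"
      unfolding D_def by (subst Weq[OF t], subst u_series_functional_eq[OF q]) (simp only: right_diff_distrib diff_diff_eq2 diff_add_eq diff_diff_eq add_diff_eq algebra_simps)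
    then have "norm (D t) \<le> norm (1 + ?p * (a + b) * t) * norm (D (?p * t)) + norm (?p ^ 2 * t * (1 + ?p * a * b * t)) * norm (D (?p ^ 2 * t))"
      using norm_triangle_ineq4 by (metis norm_mult)
    also have "\<dots> \<le> norm (1 + ?p * (a + b) * t) * X + norm (?p ^ 2 * t * (1 + ?p * a * b * t)) * X"
      using X by (intro add_mono mult_left_mono) auto
    also have "\<dots> = (norm (1 + ?p * (a + b) * t) + norm (?p ^ 2 * t * (1 + ?p * a * b * t))) * X"
      by (simp add: distrib_right)
    also have "\<dots> \<le> (1 + (norm (a + b) + 2) * norm t) * X"
    proof (intro mult_right_mono X)
      have "norm (1 + ?p * (a + b) * t) \<le> 1 + q * norm (a + b) * norm t"
        using norm_triangle_ineq[of 1 "?p * (a + b) * t"] q by (simp add: norm_mult)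
      also have "q * norm (a + b) * norm t \<le> 1 * norm (a + b) * norm t"
        using q by (intro mult_right_mono) auto
      finally have 1: "norm (1 + ?p * (a + b) * t) \<le> 1 + norm (a + b) * norm t" by simp
      have "norm (?p ^ 2 * t * (1 + ?p * a * b * t)) = q ^ 2 * norm t * norm (1 + ?p * a * b * t)"
        using q by (simp add: norm_mult norm_power)
      also have "\<dots> \<le> (1 * norm t) * 2"
        using q n2 by (intro mult_mono mult_right_mono power_le_one) auto
      finally show "norm (1 + ?p * (a + b) * t) + norm (?p ^ 2 * t * (1 + ?p * a * b * t)) \<le> 1 + (norm (a + b) + 2) * norm t"
        using 1 by (simp add: algebra_simps)
    qed
    finally show "norm (D t) \<le> (1 + (norm (a + b) + 2) * norm t) * max (norm (D (?p * t))) (norm (D (?p ^ 2 * t)))"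
      by (simp add: X_def)
  qed
  then have "D t = 0" using t R by blast
  then show ?thesis by (simp add: D_def W_def A_def B_def)
qed

text \<open>The identity extends to the domain of the continuation; at the excluded points \<open>u_fun\<close> is defined
  as a limit, and the series is continuous there.\<close>

theorem u_fun_eq_series:
  assumes q: "0 < q" "q < 1" and ab: "a \<noteq> 0" "b \<noteq> 0"
  shows "u_fun q a b t = u_series q a b t"
proof -
  let ?p = "complex_of_real q"
  have p: "norm ?p < 1" using q by simp
  define A B where "A = ?p / a" and "B = ?p / b"
  have on_domain: "qpoch_inf x ?p * phi21 q A B x = u_series q a b (- x / (a * b))" if "x \<in> phi21_domain q" for x
  proof (rule phi21_continuation_unique[OF q _ _ _ that])
    show "(\<lambda>x. qpoch_inf x ?p * phi21 q A B x) holomorphic_on phi21_domain q"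
      by (intro holomorphic_intros qpoch_inf_holomorphic p phi21_spec(1) q)
    show "(\<lambda>x. u_series q a b (- x / (a * b))) holomorphic_on phi21_domain q"
    proof -
      have "(\<lambda>x. - x / (a * b)) holomorphic_on phi21_domain q"
        using ab by (intro holomorphic_intros) auto
      from holomorphic_on_compose_gen[OF this u_series_holomorphic[OF q, of a b UNIV]]
      show ?thesis by (simp add: o_def)
    qed
    fix x :: complex assume x: "norm x < 1"
    have e: "- a * b * (- x / (a * b)) = x" using ab by simp
    have "norm (a * b * (- x / (a * b))) < 1" using x ab by simp
    from u_product_near_zero[OF q ab this]
    show "qpoch_inf x ?p * phi21 q A B x = u_series q a b (- x / (a * b))"
      unfolding e by (simp add: A_def B_def)
  qed
  define h where "h = (\<lambda>t. qpoch_inf (- a * b * t) ?p * phi21 q A B (- a * b * t))"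
  have hol: "(\<lambda>t. qpoch_inf (- a * b * t) ?p) holomorphic_on UNIV"
    using holomorphic_on_compose_gen[OF _ qpoch_inf_holomorphic[OF p, of UNIV], of "\<lambda>x. - a * b * x" UNIV]
    by (auto simp: o_def intro!: holomorphic_intros)
  have "eventually (\<lambda>s. - a * b * s \<in> phi21_domain q) (at t)"
  proof (cases "qpoch_inf (- a * b * t) ?p = 0")
    case True
    obtain r where r: "0 < r" "\<And>z. z \<in> ball t r - {t} \<Longrightarrow> qpoch_inf (- a * b * z) ?p \<noteq> 0"
      using isolated_zeros[OF hol open_UNIV connected_UNIV UNIV_I True UNIV_I[of 0]] by auto
    have "eventually (\<lambda>s. s \<in> ball t r - {t}) (at t)"
      using eventually_at_ball'[OF r(1), of t UNIV] by (auto elim!: eventually_mono)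
    then show ?thesis unfolding phi21_domain_iff[OF q] by (rule eventually_mono) (use r(2) in blast)
  next
    case False
    have "isCont (\<lambda>t. qpoch_inf (- a * b * t) ?p) t"
      using holomorphic_on_imp_continuous_on[OF hol] by (simp add: continuous_on_eq_continuous_at)
    then have "((\<lambda>t. qpoch_inf (- a * b * t) ?p) \<longlongrightarrow> qpoch_inf (- a * b * t) ?p) (at t)" by (simp add: isCont_def)
    then show ?thesis unfolding phi21_domain_iff[OF q] using False by (rule tendsto_imp_eventually_ne)
  qed
  then have "eventually (\<lambda>s. u_series q a b s = h s) (at t)"
  proof (rule eventually_mono)
    fix s assume "- a * b * s \<in> phi21_domain q"
    from on_domain[OF this] show "u_series q a b s = h s" using ab by (simp add: h_def)
  qed
  moreover have "(u_series q a b \<longlongrightarrow> u_series q a b t) (at t)"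
    using holomorphic_on_imp_continuous_on[OF u_series_holomorphic[OF q, of a b UNIV]]
    by (simp add: continuous_on_eq_continuous_at isCont_def)
  ultimately have "(h \<longlongrightarrow> u_series q a b t) (at t)" by (rule Lim_transform_eventually[rotated])
  then show ?thesis unfolding u_fun_def A_def B_def h_def by (rule remove_sings_eqI)
qed

section \<open>Kernels with a quasi-period\<close>

lemma borel_measurable_powi [measurable (raw)]:
  fixes f :: "'x \<Rightarrow> 'b::{real_normed_field, second_countable_topology}"
  assumes "f \<in> borel_measurable M"
  shows "(\<lambda>x. f x powi j) \<in> borel_measurable M"
proof (cases "j \<ge> 0")
  case True
  then show ?thesis using assms by (simp add: power_int_def)
next
  case False
  have "(\<lambda>x. inverse (f x) ^ nat (- j)) \<in> borel_measurable M" using assms by measurable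
  then show ?thesis using False by (simp add: power_int_def power_inverse)
qed

text \<open>The common structure of the three transforms. A point of the underlying space stands for
  \<open>t = \<omega> pos\<close> on the ray of direction \<open>\<omega>\<close>, \<open>sh\<close> for \<open>t \<mapsto> t / q\<close>, and \<open>nu\<close> is \<open>dt / t\<close> in
  logarithmic coordinates, or counting measure on a geometric progression. The number \<open>d\<close> bounds the
  distance of the points from the pole \<open>-1\<close>.\<close>

locale q_kernel =
  fixes q :: real and z \<omega> :: complex and nu :: "'x measure" and pos :: "'x \<Rightarrow> real"
    and sh :: "'x \<Rightarrow> 'x" and k :: "'x \<Rightarrow> complex" and d :: real
  assumes q: "0 < q" "q < 1" and z: "z \<noteq> 0" and omega: "norm \<omega> = 1"
    and pos: "\<And>x. 0 < pos x" and pos_measurable [measurable]: "pos \<in> borel_measurable nu"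
    and integrable_powi: "\<And>j. integrable nu (\<lambda>x. of_real (pos x) powi j * k x)"
    and invariant: "\<And>F :: 'x \<Rightarrow> complex. (\<integral>x. F (sh x) \<partial>nu) = (\<integral>x. F x \<partial>nu)"
    and pos_shift: "\<And>x. pos (sh x) = pos x / q"
    and k_shift: "\<And>x. k (sh x) = k x * (of_real q * z / (\<omega> * of_real (pos x)))"
    and total: "(\<integral>x. k x \<partial>nu) = 1"
    and d: "0 < d" "\<And>x. d \<le> norm (1 + \<omega> * of_real (pos x))"
begin

definition pt :: "'x \<Rightarrow> complex" where "pt x = \<omega> * of_real (pos x)"

definition stieltjes :: "int \<Rightarrow> complex" where
  "stieltjes j = (\<integral>x. pt x powi j / (1 + pt x) * k x \<partial>nu)"

lemma omega_nz: "\<omega> \<noteq> 0" using omega by auto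

lemma pt_nz: "pt x \<noteq> 0" using pos[of x] omega_nz by (auto simp: pt_def)

lemma norm_pt: "norm (pt x) = pos x"
  using pos[of x] omega by (simp add: pt_def norm_mult)

lemma pt_measurable [measurable]: "pt \<in> borel_measurable nu"
  unfolding pt_def by measurable

lemma k_measurable [measurable]: "k \<in> borel_measurable nu"
  using borel_measurable_integrable[OF integrable_powi[of 0]] by simp

lemma pt_shift: "pt (sh x) = pt x / of_real q"
  by (simp add: pt_def pos_shift)

lemma integrable_pt: "integrable nu (\<lambda>x. pt x powi j * k x)"
proof -
  have "integrable nu (\<lambda>x. \<omega> powi j * (of_real (pos x) powi j * k x))"
    by (intro integrable_mult_right integrable_powi)
  then show ?thesis by (simp add: pt_def power_int_mult_distrib mult.assoc)
qed

lemma integrable_pt_bounded: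
  assumes "h \<in> borel_measurable nu" "\<And>x. norm (h x) \<le> C"
  shows "integrable nu (\<lambda>x. pt x powi j * h x * k x)"
proof (rule Bochner_Integration.integrable_bound)
  show "integrable nu (\<lambda>x. of_real C * (pt x powi j * k x))"
    by (intro integrable_mult_right integrable_pt)
  show "(\<lambda>x. pt x powi j * h x * k x) \<in> borel_measurable nu" using assms(1) by measurable
  have "norm (pt x powi j * h x * k x) \<le> norm (of_real C * (pt x powi j * k x))" for x
  proof -
    have "norm (h x) \<le> \<bar>C\<bar>" using assms(2)[of x] by linarith
    then have "norm (h x) * norm (pt x powi j * k x) \<le> \<bar>C\<bar> * norm (pt x powi j * k x)"
      by (rule mult_right_mono) simp
    then show ?thesis by (simp add: norm_mult mult_ac)
  qed
  then show "AE x in nu. norm (pt x powi j * h x * k x) \<le> norm (of_real C * (pt x powi j * k x))" by simp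
qed

text \<open>Invariance of the measure under \<open>t \<mapsto> t / q\<close> relates consecutive moments; the total mass starts
  the induction.\<close>

lemma moment: "(\<integral>x. pt x powi j * k x \<partial>nu) = z powi j / of_real (tri q j)"
proof -
  define m where "m j = (\<integral>x. pt x powi j * k x \<partial>nu)" for j
  have q0: "complex_of_real q \<noteq> 0" using q by simp
  have rec: "m (j + 1) = z / of_real (q powi j) * m j" for j
  proof -
    have "m (j + 1) = (\<integral>x. pt (sh x) powi (j + 1) * k (sh x) \<partial>nu)"
      unfolding m_def by (rule invariant[symmetric])
    also have "\<dots> = (\<integral>x. z / of_real (q powi j) * (pt x powi j * k x) \<partial>nu)"
    proof (intro Bochner_Integration.integral_cong refl)
      fix x
      have "pt (sh x) powi (j + 1) * k (sh x)
        = (pt x powi j * pt x) / (of_real q powi j * of_real q) * (k x * (of_real q * z / pt x))"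
        unfolding pt_shift k_shift pt_def[symmetric] using pt_nz[of x] q0
        by (simp add: power_int_divide_distrib power_int_add)
      also have "\<dots> = z / of_real (q powi j) * (pt x powi j * k x)"
        using pt_nz[of x] q0 by (simp add: field_simps)
      finally show "pt (sh x) powi (j + 1) * k (sh x) = z / of_real (q powi j) * (pt x powi j * k x)" .
    qed
    also have "\<dots> = z / of_real (q powi j) * m j" unfolding m_def by (rule integral_mult_right_zero)
    finally show ?thesis .
  qed
  have nz: "tri q j \<noteq> 0" for j using tri_pos[OF q(1), of j] by simp
  have ts: "tri q (j + 1) = tri q j * q powi j" for j using tri_Suc[of q j] q by simp
  have "m j = z powi j / of_real (tri q j)"
  proof (induction j rule: int_induct[where k = 0])
    case base
    then show ?case using total by (simp add: m_def)
  next
    case (step1 i)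
    then show ?case unfolding rec ts using z by (simp add: power_int_add mult_ac)
  next
    case (step2 i)
    have "z / of_real (q powi (i - 1)) * m (i - 1) = z powi i / of_real (tri q i)"
      using rec[of "i - 1"] step2 by simp
    moreover have "z powi i = z powi (i - 1) * z" using z power_int_add[of z "i - 1" 1] by simp
    moreover have "tri q i = tri q (i - 1) * q powi (i - 1)" using ts[of "i - 1"] by simp
    ultimately show ?case using z q nz[of "i - 1"] by (simp add: field_simps)
  qed
  then show ?thesis by (simp add: m_def)
qed

lemma one_plus_pt_nz: "1 + pt x \<noteq> 0"
  using d(2)[of x] d(1) unfolding pt_def by (metis norm_zero not_less)

lemma inverse_one_plus_pt: "norm (1 / (1 + pt x)) \<le> 1 / d"
proof -
  have "0 < norm (1 + pt x)" using one_plus_pt_nz by simp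
  then have "1 / norm (1 + pt x) \<le> 1 / d"
    using d(1) d(2)[of x] unfolding pt_def[symmetric] by (intro divide_left_mono) auto
  then show ?thesis by (simp add: norm_divide)
qed

lemma integrable_stieltjes: "integrable nu (\<lambda>x. pt x powi j / (1 + pt x) * k x)"
  using integrable_pt_bounded[of "\<lambda>x. 1 / (1 + pt x)" "1 / d" j] inverse_one_plus_pt by simp

text \<open>\<open>t\<^sup>j + t\<^bsup>j+1\<^esup> = t\<^sup>j (1 + t)\<close>.\<close>

lemma stieltjes_step: "stieltjes j + stieltjes (j + 1) = z powi j / of_real (tri q j)"
proof -
  have "stieltjes j + stieltjes (j + 1) = (\<integral>x. pt x powi j / (1 + pt x) * k x + pt x powi (j + 1) / (1 + pt x) * k x \<partial>nu)"
    unfolding stieltjes_def by (intro Bochner_Integration.integral_add[symmetric] integrable_stieltjes)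
  also have "\<dots> = (\<integral>x. pt x powi j * k x \<partial>nu)"
  proof (intro Bochner_Integration.integral_cong refl)
    fix x
    show "pt x powi j / (1 + pt x) * k x + pt x powi (j + 1) / (1 + pt x) * k x = pt x powi j * k x"
    proof -
      have "pt x powi j / (1 + pt x) * k x + pt x powi (j + 1) / (1 + pt x) * k x
        = (pt x powi j * k x + pt x powi j * pt x * k x) / (1 + pt x)"
        using pt_nz[of x] by (simp add: power_int_add add_divide_distrib mult_ac)
      also have "pt x powi j * k x + pt x powi j * pt x * k x = pt x powi j * k x * (1 + pt x)"
        by (simp add: algebra_simps)
      finally show ?thesis using one_plus_pt_nz[of x] by simp
    qed
  qed
  finally show ?thesis unfolding moment .
qed

text \<open>Each substitution \<open>t \<mapsto> t / q\<close> removes one factor \<open>q\<close> from the denominator and lowers the power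
  of \<open>t\<close> by one.\<close>

lemma scaled_moment:
  "(\<integral>x. pt x powi j / (1 + pt x * of_real q ^ m) * k x \<partial>nu) * of_real (q powi (j * int m))
    = of_real (q ^ (Suc m choose 2)) * z ^ m * stieltjes (j - int m)"
proof (induction m arbitrary: j)
  case 0
  then show ?case by (simp add: stieltjes_def numeral_2_eq_2)
next
  case (Suc m)
  have q0: "complex_of_real q \<noteq> 0" using q by simp
  define KK where "KK j m = (\<integral>x. pt x powi j / (1 + pt x * of_real q ^ m) * k x \<partial>nu)" for j m
  have "KK j (Suc m) = (\<integral>x. pt (sh x) powi j / (1 + pt (sh x) * of_real q ^ Suc m) * k (sh x) \<partial>nu)"
    unfolding KK_def by (rule invariant[symmetric])
  also have "\<dots> = (\<integral>x. (z * of_real (q powi (1 - j))) * (pt x powi (j - 1) / (1 + pt x * of_real q ^ m) * k x) \<partial>nu)"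
  proof (intro Bochner_Integration.integral_cong refl)
    fix x
    have "pt (sh x) * of_real q ^ Suc m = pt x * of_real q ^ m" using q0 by (simp add: pt_shift)
    moreover have "pt (sh x) powi j * k (sh x) = z * of_real (q powi (1 - j)) * (pt x powi (j - 1) * k x)"
    proof -
      have "pt x powi j = pt x powi (j - 1) * pt x" using pt_nz[of x] power_int_add[of "pt x" "j - 1" 1] by simp
      moreover have "complex_of_real q powi (1 - j) = of_real q / of_real q powi j"
        using q0 by (simp add: power_int_diff)
      ultimately show ?thesis
        unfolding pt_shift k_shift pt_def[symmetric] using pt_nz[of x] q0
        by (simp add: power_int_divide_distrib)
    qed
    ultimately show "pt (sh x) powi j / (1 + pt (sh x) * of_real q ^ Suc m) * k (sh x)
      = (z * of_real (q powi (1 - j))) * (pt x powi (j - 1) / (1 + pt x * of_real q ^ m) * k x)"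
      by (metis (no_types, lifting) times_divide_eq_left times_divide_eq_right)
  qed
  also have "\<dots> = z * of_real (q powi (1 - j)) * KK (j - 1) m"
    unfolding KK_def by (rule integral_mult_right_zero)
  finally have "KK j (Suc m) * of_real (q powi (j * int (Suc m)))
     = z * KK (j - 1) m * of_real (q powi (1 - j) * q powi (j * int (Suc m)))" by simp
  also have "q powi (1 - j) * q powi (j * int (Suc m)) = q powi ((j - 1) * int m) * q ^ Suc m"
  proof -
    have "q powi (1 - j) * q powi (j * int (Suc m)) = q powi ((1 - j) + j * int (Suc m))"
      using q by (subst power_int_add) auto
    also have "(1 - j) + j * int (Suc m) = (j - 1) * int m + int (Suc m)" by (simp add: algebra_simps)
    also have "q powi \<dots> = q powi ((j - 1) * int m) * q powi int (Suc m)"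
      by (rule power_int_add) (use q in simp)
    also have "q powi int (Suc m) = q ^ Suc m" by (rule power_int_of_nat)
    finally show ?thesis .
  qed
  also have "z * KK (j - 1) m * complex_of_real (q powi ((j - 1) * int m) * q ^ Suc m)
     = z * of_real (q ^ Suc m) * (KK (j - 1) m * of_real (q powi ((j - 1) * int m)))" by (simp only: of_real_mult mult_ac)
  also have "KK (j - 1) m * of_real (q powi ((j - 1) * int m)) = of_real (q ^ (Suc m choose 2)) * z ^ m * stieltjes (j - 1 - int m)"
    unfolding KK_def by (rule Suc.IH)
  also have "z * of_real (q ^ Suc m) * (of_real (q ^ (Suc m choose 2)) * z ^ m * stieltjes (j - 1 - int m))
     = of_real (q ^ (Suc (Suc m) choose 2)) * z ^ Suc m * stieltjes (j - int (Suc m))"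
  proof -
    have "j - 1 - int m = j - int (Suc m)" by simp
    then show ?thesis by (simp only: choose_two_Suc[of "Suc m"] power_add of_real_mult power_Suc mult_ac)
  qed
  finally show ?case unfolding KK_def .
qed

end

text \<open>Since consecutive \<open>stieltjes\<close> add up to a moment, all of them are fixed by a single one.\<close>

lemma q_kernel_stieltjes_eq:
  assumes "q_kernel q z w1 nu1 p1 s1 k1 d1" "q_kernel q z w2 nu2 p2 s2 k2 d2"
    and "q_kernel.stieltjes w1 nu1 p1 k1 0 = q_kernel.stieltjes w2 nu2 p2 k2 0"
  shows "q_kernel.stieltjes w1 nu1 p1 k1 j = q_kernel.stieltjes w2 nu2 p2 k2 j"
proof -
  interpret A: q_kernel q z w1 nu1 p1 s1 k1 d1 by fact
  interpret B: q_kernel q z w2 nu2 p2 s2 k2 d2 by fact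
  show ?thesis
  proof (induction j rule: int_induct[where k = 0])
    case base
    then show ?case using assms(3) by simp
  next
    case (step1 i)
    then show ?case using A.stieltjes_step[of i] B.stieltjes_step[of i] by (metis add_left_cancel)
  next
    case (step2 i)
    then show ?case using A.stieltjes_step[of "i - 1"] B.stieltjes_step[of "i - 1"]
      by (metis add_right_cancel diff_add_cancel)
  qed
qed

context q_kernel begin

text \<open>The expansion of \<open>\<^sub>2\<phi>\<^sub>1(-t)\<close> integrated term by term: the polynomial part gives the partial sum by
  \<open>moment\<close>, the poles give \<open>scaled_moment\<close>. On the positive ray all denominators are at least
  \<open>1\<close>, which justifies the interchange.\<close>

lemma remainder_series:
  assumes om1: "\<omega> = 1" and N: "max (norm a) (norm b) * q ^ N < 1"
  shows "(\<lambda>m. borel_coeff q a b m * of_real q ^ (Suc m choose 2) * z ^ m * stieltjes (int N - int m)) sums T \<Longrightarrow>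
    (\<integral>x. phi21 q a b (- pt x) * k x \<partial>nu) = U_partial q a b N z + K0 q a b * (- 1) ^ N * T"
    and "\<exists>T. (\<lambda>m. borel_coeff q a b m * of_real q ^ (Suc m choose 2) * z ^ m * stieltjes (int N - int m)) sums T"
    and "integrable nu (\<lambda>x. phi21 q a b (- pt x) * k x)"
proof -
  let ?p = "complex_of_real q" and ?c = "borel_coeff q a b"
  define g where "g m x = pt x powi int N * (?c m * (?p ^ N) ^ m / (1 + pt x * ?p ^ m)) * k x" for m x
  have ptr: "pt x = of_real (pos x)" for x unfolding pt_def unfolding om1 by simp
  have den: "norm (1 / (1 + pt x * ?p ^ m)) \<le> 1" for x m
  proof -
    have "0 \<le> pos x * q ^ m" using pos[of x] q by simp
    then have "norm (complex_of_real (1 + pos x * q ^ m)) \<ge> 1" by (simp only: norm_of_real)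
    then have "norm (1 + pt x * ?p ^ m) \<ge> 1" by (simp add: ptr)
    then show ?thesis by (simp add: norm_divide divide_le_eq)
  qed
  have cden: "norm (?c m * (?p ^ N) ^ m / (1 + pt x * ?p ^ m)) \<le> norm (?c m * (?p ^ N) ^ m)" for x m
    using mult_left_mono[OF den[of x m], of "norm (?c m * (?p ^ N) ^ m)"] by (simp add: norm_mult norm_divide)
  have gi: "integrable nu (g m)" for m
    unfolding g_def by (rule integrable_pt_bounded[OF _ cden]) measurable
  have sc: "summable (\<lambda>m. norm (?c m * (?p ^ N) ^ m))" by (rule borel_coeff_summable_power[OF q N])
  have gn: "norm (g m x) \<le> norm (?c m * (?p ^ N) ^ m) * norm (pt x powi int N * k x)" for m x
  proof -
    have "norm (g m x) = norm (?c m * (?p ^ N) ^ m / (1 + pt x * ?p ^ m)) * norm (pt x powi int N * k x)"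
      unfolding g_def norm_mult[symmetric] by (simp only: mult_ac)
    then show ?thesis using mult_right_mono[OF cden[of m x], of "norm (pt x powi int N * k x)"] by simp
  qed
  have gs: "AE x in nu. summable (\<lambda>m. norm (g m x))"
    by (intro AE_I2 summable_comparison_test'[OF summable_mult2[OF sc]]) (use gn in auto)
  have "(\<integral>x. norm (g m x) \<partial>nu) \<le> norm (?c m * (?p ^ N) ^ m) * (\<integral>x. norm (pt x powi int N * k x) \<partial>nu)" for m
    unfolding integral_mult_right_zero[symmetric]
    by (intro integral_mono integrable_norm gi integrable_mult_right integrable_pt gn)
  then have gsi: "summable (\<lambda>m. \<integral>x. norm (g m x) \<partial>nu)"
    by (intro summable_comparison_test'[OF summable_mult2[OF sc]]) auto
  have gint: "(\<integral>x. g m x \<partial>nu) = ?c m * ?p ^ (Suc m choose 2) * z ^ m * stieltjes (int N - int m)" for m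
  proof -
    have "(\<integral>x. g m x \<partial>nu) = (\<integral>x. ?c m * (?p ^ N) ^ m * (pt x powi int N / (1 + pt x * ?p ^ m) * k x) \<partial>nu)"
      by (intro Bochner_Integration.integral_cong refl) (simp add: g_def)
    also have "\<dots> = ?c m * (?p ^ N) ^ m * (\<integral>x. pt x powi int N / (1 + pt x * ?p ^ m) * k x \<partial>nu)"
      by (rule integral_mult_right_zero)
    also have "\<dots> = ?c m * ((\<integral>x. pt x powi int N / (1 + pt x * ?p ^ m) * k x \<partial>nu) * of_real (q powi (int N * int m)))"
      by (simp add: power_int_mult mult_ac)
    finally show ?thesis unfolding scaled_moment by (simp add: mult_ac)
  qed
  have sums: "(\<lambda>m. ?c m * ?p ^ (Suc m choose 2) * z ^ m * stieltjes (int N - int m)) sums (\<integral>x. (\<Sum>m. g m x) \<partial>nu)"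
    using sums_integral[OF gi gs gsi] unfolding gint .
  then show "\<exists>T. (\<lambda>m. ?c m * ?p ^ (Suc m choose 2) * z ^ m * stieltjes (int N - int m)) sums T" by blast
  have phi: "phi21 q a b (- pt x) * k x = (\<Sum>n<N. phi21_coeff q a b n * (- 1) ^ n * (pt x powi int n * k x))
      + K0 q a b * (- 1) ^ N * (\<Sum>m. g m x)" for x
  proof -
    have "- pt x \<in> phi21_domain q" unfolding ptr by (rule neg_real_in_phi21_domain[OF q pos])
    then have "phi21 q a b (- pt x) = phi21_expansion q a b N (- pt x)" by (rule phi21_eq_expansion[OF q N])
    moreover have "(\<Sum>m. g m x) = pt x ^ N * (\<Sum>m. ?c m * (?p ^ N) ^ m / (1 + pt x * ?p ^ m)) * k x"
    proof -
      have s: "summable (\<lambda>m. ?c m * (?p ^ N) ^ m / (1 + pt x * ?p ^ m))"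
        by (rule summable_comparison_test'[OF sc]) (use cden in auto)
      have "(\<lambda>m. g m x) sums (pt x powi int N * (\<Sum>m. ?c m * (?p ^ N) ^ m / (1 + pt x * ?p ^ m)) * k x)"
        unfolding g_def by (intro sums_mult sums_mult2 summable_sums s)
      then show ?thesis by (simp add: sums_iff)
    qed
    moreover have "(- pt x) ^ n = (- 1) ^ n * pt x ^ n" for n by (rule power_minus)
    ultimately show ?thesis unfolding phi21_expansion_def
      by (simp add: distrib_left sum_distrib_left mult_ac)
  qed
  have i1: "integrable nu (\<lambda>x. \<Sum>n<N. phi21_coeff q a b n * (- 1) ^ n * (pt x powi int n * k x))"
    by (intro Bochner_Integration.integrable_sum integrable_mult_right integrable_pt)
  have i2: "integrable nu (\<lambda>x. K0 q a b * (- 1) ^ N * (\<Sum>m. g m x))"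
    by (intro integrable_mult_right integrable_suminf gi gs gsi)
  show "integrable nu (\<lambda>x. phi21 q a b (- pt x) * k x)"
    unfolding phi by (rule Bochner_Integration.integrable_add[OF i1 i2])
  assume "(\<lambda>m. ?c m * ?p ^ (Suc m choose 2) * z ^ m * stieltjes (int N - int m)) sums T"
  from sums_unique2[OF this sums] have T: "(\<integral>x. (\<Sum>m. g m x) \<partial>nu) = T" by simp
  have "(\<integral>x. phi21 q a b (- pt x) * k x \<partial>nu)
     = (\<integral>x. (\<Sum>n<N. phi21_coeff q a b n * (- 1) ^ n * (pt x powi int n * k x)) \<partial>nu) + K0 q a b * (- 1) ^ N * T"
    unfolding phi Bochner_Integration.integral_add[OF i1 i2] integral_mult_right_zero T ..
  also have "(\<integral>x. (\<Sum>n<N. phi21_coeff q a b n * (- 1) ^ n * (pt x powi int n * k x)) \<partial>nu)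
     = (\<Sum>n<N. phi21_coeff q a b n * (- 1) ^ n * (z powi int n / of_real (tri q (int n))))"
    by (subst Bochner_Integration.integral_sum)
       (auto intro!: integrable_mult_right integrable_pt simp: moment simp del: power_int_of_nat)
  also have "\<dots> = U_partial q a b N z"
    unfolding U_partial_def
  proof (intro sum.cong refl)
    fix n
    have "(- z) ^ n = (- 1) ^ n * z ^ n" by (rule power_minus)
    then show "phi21_coeff q a b n * (- 1) ^ n * (z powi int n / of_real (tri q (int n)))
      = qpoch a ?p n * qpoch b ?p n / qpoch ?p ?p n * of_real (q powi (- int (n choose 2))) * (- z) ^ n"
      by (simp add: phi21_coeff_def tri_of_nat power_int_minus divide_inverse mult_ac)
  qed
  finally show "(\<integral>x. phi21 q a b (- pt x) * k x \<partial>nu) = U_partial q a b N z + K0 q a b * (- 1) ^ N * T" .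
qed

end

section \<open>Majorants and the remainder bound\<close>

lemma tri_diff_nat:
  assumes "q \<noteq> 0"
  shows "tri q (int N - int m) * q ^ (N * m) = tri q (int N) * q ^ (Suc m choose 2)"
proof -
  have "tri q (int N - int m) = tri q (int N) * tri q (- int m) * q powi (- int (N * m))"
    using tri_add[OF assms, of "int N" "- int m"] by simp
  moreover have "q powi (- int (N * m)) * q ^ (N * m) = 1"
    using assms unfolding power_int_minus power_int_of_nat by simp
  ultimately show ?thesis by (simp add: tri_neg_of_nat mult.assoc)
qed

locale positive_q_kernel =
  fixes q r :: real and nu :: "'x measure" and pos :: "'x \<Rightarrow> real"
    and sh :: "'x \<Rightarrow> 'x" and kap :: "'x \<Rightarrow> real"
  assumes kernel: "q_kernel q (of_real r) 1 nu pos sh (\<lambda>x. of_real (kap x)) 1"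
    and r: "0 < r" and kap: "\<And>x. 0 \<le> kap x"

sublocale positive_q_kernel \<subseteq> q_kernel q "of_real r" 1 nu pos sh "\<lambda>x. of_real (kap x)" 1
  by (rule kernel)

context positive_q_kernel begin

lemma kap_integrable: "integrable nu (\<lambda>x. pos x powi j * kap x)"
proof -
  have "integrable nu (\<lambda>x. complex_of_real (pos x powi j * kap x))"
    using integrable_powi[of j] by simp
  then show ?thesis by (simp only: complex_of_real_integrable_eq)
qed

lemma kap_moment: "(\<integral>x. pos x powi j * kap x \<partial>nu) = r powi j / tri q j"
proof -
  have "complex_of_real (\<integral>x. pos x powi j * kap x \<partial>nu) = (\<integral>x. pt x powi j * of_real (kap x) \<partial>nu)"
    unfolding integral_complex_of_real[symmetric] by (simp add: pt_def)
  also have "\<dots> = complex_of_real (r powi j / tri q j)" unfolding moment by simp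
  finally show ?thesis by (simp only: of_real_eq_iff)
qed

text \<open>The powers of \<open>q\<close> in the moments undo the weights \<open>q\<^bsup>m(m+1)/2\<^esup>\<close> in \<open>W\<close> up to the
  geometric factor \<open>q\<^bsup>Nm\<^esup>\<close>, so \<open>W\<close> integrates to the value of \<open>\<Sum> w\<^sub>m s\<^sup>m\<close> at \<open>s = q\<^sup>N\<close>.\<close>

lemma kap_series:
  assumes w: "\<And>m. 0 \<le> w m" "summable (\<lambda>m. w m * (q ^ N) ^ m)"
    and s: "\<And>y. 0 < y \<Longrightarrow> (\<lambda>m. w m * q ^ (Suc m choose 2) * y ^ m) sums W y"
  shows "integrable nu (\<lambda>x. pos x ^ N * W (r / pos x) * kap x)"
    and "(\<integral>x. pos x ^ N * W (r / pos x) * kap x \<partial>nu) = r ^ N / tri q (int N) * (\<Sum>m. w m * (q ^ N) ^ m)"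
proof -
  define g where "g m x = w m * q ^ (Suc m choose 2) * r ^ m * (pos x powi (int N - int m) * kap x)" for m x
  have gi: "integrable nu (g m)" for m
    unfolding g_def by (intro integrable_mult_right kap_integrable)
  have g0: "0 \<le> g m x" for m x
    using w(1)[of m] q r pos[of x] kap[of x] by (simp add: g_def)
  have gint: "(\<integral>x. g m x \<partial>nu) = r ^ N / tri q (int N) * (w m * (q ^ N) ^ m)" for m
  proof -
    have "(\<integral>x. g m x \<partial>nu) = w m * q ^ (Suc m choose 2) * r ^ m * (r powi (int N - int m) / tri q (int N - int m))"
      unfolding g_def integral_mult_right_zero kap_moment ..
    also have "\<dots> = w m * (r ^ m * r powi (int N - int m)) * (q ^ (Suc m choose 2) / tri q (int N - int m))"
      by (simp only: times_divide_eq_right mult_ac)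
    also have "r ^ m * r powi (int N - int m) = r ^ N"
      using r by (simp add: power_int_diff)
    also have "q ^ (Suc m choose 2) / tri q (int N - int m) = q ^ (N * m) / tri q (int N)"
    proof -
      have "q \<noteq> 0" using q by simp
      from tri_diff_nat[OF this, of N m] show ?thesis
        using tri_pos[OF q(1), of "int N"] tri_pos[OF q(1), of "int N - int m"] by (simp add: divide_eq_eq field_simps)
    qed
    finally show ?thesis by (simp add: power_mult)
  qed
  have gx: "(\<lambda>m. g m x) sums (pos x ^ N * W (r / pos x) * kap x)" for x
  proof -
    have "(\<lambda>m. pos x ^ N * kap x * (w m * q ^ (Suc m choose 2) * (r / pos x) ^ m)) sums (pos x ^ N * kap x * W (r / pos x))"
      by (intro sums_mult s) (use r pos[of x] in simp)
    moreover have "pos x ^ N * kap x * (w m * q ^ (Suc m choose 2) * (r / pos x) ^ m) = g m x" for m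
      using pos[of x] by (simp add: g_def power_int_diff power_divide)
    ultimately show ?thesis by (simp add: mult_ac)
  qed
  then have eq: "(\<Sum>m. g m x) = pos x ^ N * W (r / pos x) * kap x" for x by (simp add: sums_iff)
  have gs: "AE x in nu. summable (\<lambda>m. norm (g m x))"
    using gx g0 by (intro AE_I2) (auto simp: sums_iff)
  have gsi: "summable (\<lambda>m. \<integral>x. norm (g m x) \<partial>nu)"
    using g0 gint w by (simp add: summable_mult)
  show "integrable nu (\<lambda>x. pos x ^ N * W (r / pos x) * kap x)"
    using integrable_suminf[OF gi gs gsi] unfolding eq .
  have "(\<lambda>m. r ^ N / tri q (int N) * (w m * (q ^ N) ^ m)) sums (\<integral>x. pos x ^ N * W (r / pos x) * kap x \<partial>nu)"
    using sums_integral[OF gi gs gsi] unfolding gint eq .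
  moreover have "(\<lambda>m. r ^ N / tri q (int N) * (w m * (q ^ N) ^ m)) sums (r ^ N / tri q (int N) * (\<Sum>m. w m * (q ^ N) ^ m))"
    by (intro sums_mult summable_sums w)
  ultimately show "(\<integral>x. pos x ^ N * W (r / pos x) * kap x \<partial>nu) = r ^ N / tri q (int N) * (\<Sum>m. w m * (q ^ N) ^ m)"
    by (rule sums_unique2)
qed

end

text \<open>The majorant in the hypothesis on \<open>u\<close> has the form required by \<open>kap_series\<close>; its weights
  \<open>c\<^sup>m / (q; q)\<^sub>m\<close> generate \<open>1 / (c s; q)\<^sub>\<infinity>\<close>.\<close>

lemma majorant_sums:
  fixes q c y :: real
  assumes q: "0 < q" "q < 1"
  shows "(\<lambda>m. c ^ m / qpoch q q m * q ^ (Suc m choose 2) * y ^ m) sums qpoch_inf (- c * q * y) q"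
proof -
  have "(\<lambda>m. euler_coeff q m * (- c * q * y) ^ m) sums qpoch_inf (- c * q * y) q"
    by (rule euler_product) (use q in simp)
  moreover have "euler_coeff q m * (- c * q * y) ^ m = c ^ m / qpoch q q m * q ^ (Suc m choose 2) * y ^ m" for m
  proof -
    have "(- c * q * y) ^ m = (- 1) ^ m * (c ^ m * q ^ m * y ^ m)"
      by (metis mult_minus_left power_minus power_mult_distrib)
    moreover have "(- 1) ^ m * (- 1) ^ m = (1::real)" by (simp flip: power_mult_distrib)
    ultimately show ?thesis by (simp add: euler_coeff_def choose_two_Suc power_add)
  qed
  ultimately show ?thesis by simp
qed

text \<open>The source kernel defines the function whose remainder is estimated. The target kernel lives on
  a ray with \<open>Re (z / \<omega>) \<ge> 0\<close>, where \<open>u(z / t)\<close> is controlled, and has the same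
  \<open>stieltjes\<close> integral of index \<open>0\<close>. So both give the same series for the remainder, and the
  one on the target ray can be resummed to an integral of \<open>u\<close> and estimated.\<close>

theorem remainder_bound:
  fixes M H c dt :: real
  assumes src: "q_kernel q z 1 nu1 pos1 sh1 k1 d1"
    and tgt: "q_kernel q z \<omega> nu pos sh k dt"
    and plus: "positive_q_kernel q (norm z) nu pos sh kap"
    and same: "q_kernel.stieltjes 1 nu1 pos1 k1 0 = q_kernel.stieltjes \<omega> nu pos k 0"
    and dom: "\<And>x. norm (k x) \<le> H * kap x" and H: "0 \<le> H"
    and ray: "0 \<le> Re (z / \<omega>)"
    and ab: "a \<noteq> 0" "b \<noteq> 0" and c: "c = max (norm a) (norm b)" and cN: "c * q ^ N < 1"
    and M: "\<And>t. Re t \<ge> 0 \<Longrightarrow> norm (u_fun q a b t) \<le> M * qpoch_inf (- c * q * norm t) q"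
  shows "norm ((\<integral>x. phi21 q a b (- of_real (pos1 x)) * k1 x \<partial>nu1) - U_partial q a b N z)
    \<le> norm (z ^ N) * norm (K0 q a b) * (M * (H / dt) * q powi (- int (N choose 2)) / qpoch_inf (c * q ^ N) q)"
proof -
  interpret A: q_kernel q z 1 nu1 pos1 sh1 k1 d1 by (rule src)
  interpret B: q_kernel q z \<omega> nu pos sh k dt by (rule tgt)
  interpret P: positive_q_kernel q "norm z" nu pos sh kap by (rule plus)
  let ?p = "complex_of_real q" and ?c = "borel_coeff q a b"
  note q = A.q
  have cN': "max (norm a) (norm b) * q ^ N < 1" using cN c by simp
  have c0: "0 \<le> c" unfolding c by (simp add: le_max_iff_disj)
  have dt: "0 < dt" by (rule B.d)
  obtain T where T: "(\<lambda>m. ?c m * ?p ^ (Suc m choose 2) * z ^ m * A.stieltjes (int N - int m)) sums T"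
    using A.remainder_series(2)[OF refl cN'] by blast
  have "(\<integral>x. phi21 q a b (- A.pt x) * k1 x \<partial>nu1) = U_partial q a b N z + K0 q a b * (- 1) ^ N * T"
    by (rule A.remainder_series(1)[OF refl cN' T])
  then have R: "norm ((\<integral>x. phi21 q a b (- of_real (pos1 x)) * k1 x \<partial>nu1) - U_partial q a b N z) = norm (K0 q a b) * norm T"
    by (simp add: A.pt_def norm_mult norm_power)
  define g where "g m x = ?c m * ?p ^ (Suc m choose 2) * z ^ m * (B.pt x powi (int N - int m) / (1 + B.pt x) * k x)" for m x
  have gi: "integrable nu (g m)" for m
    unfolding g_def by (intro integrable_mult_right B.integrable_stieltjes)
  have gint: "(\<integral>x. g m x \<partial>nu) = ?c m * ?p ^ (Suc m choose 2) * z ^ m * A.stieltjes (int N - int m)" for m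
    unfolding g_def integral_mult_right_zero q_kernel_stieltjes_eq[OF src tgt same] B.stieltjes_def ..
  have gx: "(\<lambda>m. g m x) sums (B.pt x ^ N / (1 + B.pt x) * u_fun q a b (z / B.pt x) * k x)" for x
  proof -
    have "(\<lambda>m. B.pt x ^ N / (1 + B.pt x) * k x * (?c m * ?p ^ (Suc m choose 2) * (z / B.pt x) ^ m))
       sums (B.pt x ^ N / (1 + B.pt x) * k x * u_series q a b (z / B.pt x))"
      by (intro sums_mult u_series_sums q)
    moreover have "B.pt x ^ N / (1 + B.pt x) * k x * (?c m * ?p ^ (Suc m choose 2) * (z / B.pt x) ^ m) = g m x" for m
      using B.pt_nz[of x] by (simp add: g_def power_int_diff power_divide mult_ac)
    ultimately show ?thesis unfolding u_fun_eq_series[OF q ab] by (simp add: mult_ac)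
  qed
  \<comment> \<open>Absolute convergence is that of the positive kernel, with the coefficients replaced by their moduli.\<close>
  have gb: "norm (g m x) \<le> H / dt * (norm (?c m) * q ^ (Suc m choose 2) * norm z ^ m * (pos x powi (int N - int m) * kap x))" for m x
  proof -
    have "norm (g m x) = (norm (?c m) * q ^ (Suc m choose 2) * norm z ^ m) * pos x powi (int N - int m) * norm (1 / (1 + B.pt x)) * norm (k x)"
      using q by (simp add: g_def norm_mult norm_divide norm_power norm_power_int B.norm_pt)
    also have "\<dots> \<le> (norm (?c m) * q ^ (Suc m choose 2) * norm z ^ m) * pos x powi (int N - int m) * (1 / dt) * (H * kap x)"
      using q B.pos[of x] dt by (intro mult_mono mult_left_mono B.inverse_one_plus_pt dom) auto
    finally show ?thesis by (simp add: mult_ac)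
  qed
  have wsum: "summable (\<lambda>m. norm (?c m) * (q ^ N) ^ m)"
    using borel_coeff_summable_power[OF q cN'] q by (simp add: norm_mult norm_power)
  have gsi: "summable (\<lambda>m. \<integral>x. norm (g m x) \<partial>nu)"
  proof (rule summable_comparison_test'[where N = 0])
    show "summable (\<lambda>m. H / dt * (norm z ^ N / tri q (int N) * (norm (?c m) * (q ^ N) ^ m)))"
      by (intro summable_mult wsum)
    fix m
    have "(\<integral>x. norm (g m x) \<partial>nu) \<le> (\<integral>x. H / dt * (norm (?c m) * q ^ (Suc m choose 2) * norm z ^ m * (pos x powi (int N - int m) * kap x)) \<partial>nu)"
      by (intro integral_mono integrable_norm gi integrable_mult_right P.kap_integrable gb)
    also have "\<dots> = H / dt * (norm (?c m) * q ^ (Suc m choose 2) * norm z ^ m * (norm z powi (int N - int m) / tri q (int N - int m)))"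
      unfolding integral_mult_right_zero P.kap_moment ..
    also have "\<dots> = H / dt * (norm z ^ N / tri q (int N) * (norm (?c m) * (q ^ N) ^ m))"
    proof -
      have "q \<noteq> 0" using q by simp
      from tri_diff_nat[OF this, of N m] have "q ^ (Suc m choose 2) / tri q (int N - int m) = q ^ (N * m) / tri q (int N)"
        using tri_pos[OF q(1), of "int N"] tri_pos[OF q(1), of "int N - int m"] by (simp add: divide_eq_eq field_simps)
      moreover have "norm z ^ m * norm z powi (int N - int m) = norm z ^ N"
        using A.z by (simp add: power_int_diff)
      moreover have "norm (?c m) * q ^ (Suc m choose 2) * norm z ^ m * (norm z powi (int N - int m) / tri q (int N - int m))
        = norm (?c m) * (norm z ^ m * norm z powi (int N - int m)) * (q ^ (Suc m choose 2) / tri q (int N - int m))"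
        by (simp only: times_divide_eq_right times_divide_eq_left mult_ac)
      ultimately show ?thesis by (simp add: power_mult mult_ac)
    qed
    finally show "norm (\<integral>x. norm (g m x) \<partial>nu) \<le> H / dt * (norm z ^ N / tri q (int N) * (norm (?c m) * (q ^ N) ^ m))"
      by simp
  qed
  have gs: "AE x in nu. summable (\<lambda>m. norm (g m x))"
  proof (intro AE_I2)
    fix x
    have "(\<lambda>m. norm (g m x)) = (\<lambda>m. norm (B.pt x ^ N / (1 + B.pt x) * k x) * norm (?c m * ?p ^ (Suc m choose 2) * (z / B.pt x) ^ m))"
      using B.pt_nz[of x] by (auto simp: g_def power_int_diff power_divide norm_mult norm_divide fun_eq_iff mult_ac)
    then show "summable (\<lambda>m. norm (g m x))"
      by (simp only:) (intro summable_mult u_series_summable q)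
  qed
  have sum_eq: "(\<Sum>m. g m x) = B.pt x ^ N / (1 + B.pt x) * u_fun q a b (z / B.pt x) * k x" for x
    using gx[of x] by (simp add: sums_iff)
  have "(\<lambda>m. ?c m * ?p ^ (Suc m choose 2) * z ^ m * A.stieltjes (int N - int m)) sums
      (\<integral>x. B.pt x ^ N / (1 + B.pt x) * u_fun q a b (z / B.pt x) * k x \<partial>nu)"
    using sums_integral[OF gi gs gsi] unfolding gint sum_eq .
  then have TI: "T = (\<integral>x. B.pt x ^ N / (1 + B.pt x) * u_fun q a b (z / B.pt x) * k x \<partial>nu)"
    using sums_unique2 T by blast
  have int_u: "integrable nu (\<lambda>x. B.pt x ^ N / (1 + B.pt x) * u_fun q a b (z / B.pt x) * k x)"
    using integrable_suminf[OF gi gs gsi] unfolding sum_eq .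
  define W where "W y = qpoch_inf (- c * q * y) q" for y
  define w where "w m = c ^ m / qpoch q q m" for m
  have "0 \<le> c * q ^ N" using c0 q by simp
  then have cn: "norm (c * q ^ N) < 1" using cN by simp
  have qp: "0 < qpoch q q m" for m
  proof -
    have "q * q ^ i < 1" for i using q power_less_one_iff[of q "Suc i"] by simp
    then show ?thesis unfolding qpoch_def by (intro prod_pos) auto
  qed
  have w0: "0 \<le> w m" for m using c0 qp[of m] by (simp add: w_def)
  have "(\<lambda>m. (c * q ^ N) ^ m / qpoch q q m) sums (1 / qpoch_inf (c * q ^ N) q)"
    using euler_inverse_product[of q "c * q ^ N"] cn q by simp
  then have ws: "(\<lambda>m. w m * (q ^ N) ^ m) sums (1 / qpoch_inf (c * q ^ N) q)"
    by (simp add: w_def power_mult_distrib)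
  have Ws: "(\<lambda>m. w m * q ^ (Suc m choose 2) * y ^ m) sums W y" for y
    unfolding w_def W_def by (rule majorant_sums[OF q])
  note series = P.kap_series[where w = w and N = N and W = W, OF w0 sums_summable[OF ws] Ws]
  have "norm T \<le> (\<integral>x. norm (B.pt x ^ N / (1 + B.pt x) * u_fun q a b (z / B.pt x) * k x) \<partial>nu)"
    unfolding TI by (rule integral_norm_bound)
  also have "\<dots> \<le> (\<integral>x. M * (H / dt) * (pos x ^ N * W (norm z / pos x) * kap x) \<partial>nu)"
  proof (intro integral_mono integrable_norm int_u integrable_mult_right series(1))
    fix x
    have "z / B.pt x = (z / \<omega>) / of_real (pos x)" by (simp add: B.pt_def)
    then have "Re (z / B.pt x) = Re (z / \<omega>) / pos x" by (simp only: Re_divide_of_real)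
    then have "Re (z / B.pt x) \<ge> 0" using ray B.pos[of x] by simp
    from M[OF this] have u: "norm (u_fun q a b (z / B.pt x)) \<le> M * W (norm z / pos x)"
      by (simp add: W_def norm_divide B.norm_pt)
    have "norm (B.pt x ^ N / (1 + B.pt x) * u_fun q a b (z / B.pt x) * k x)
        = pos x ^ N * norm (1 / (1 + B.pt x)) * norm (u_fun q a b (z / B.pt x)) * norm (k x)"
      by (simp add: norm_mult norm_divide norm_power B.norm_pt)
    also have "\<dots> \<le> pos x ^ N * (1 / dt) * (M * W (norm z / pos x)) * (H * kap x)"
      using B.pos[of x] dt order_trans[OF norm_ge_zero u]
      by (intro mult_mono mult_left_mono B.inverse_one_plus_pt u dom) auto
    finally show "norm (B.pt x ^ N / (1 + B.pt x) * u_fun q a b (z / B.pt x) * k x)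
        \<le> M * (H / dt) * (pos x ^ N * W (norm z / pos x) * kap x)" by (simp add: mult_ac)
  qed
  also have "\<dots> = M * (H / dt) * (norm z ^ N / tri q (int N) * (1 / qpoch_inf (c * q ^ N) q))"
    unfolding integral_mult_right_zero series(2) using ws by (simp add: sums_iff)
  finally have "norm T \<le> norm z ^ N * (M * (H / dt) * q powi (- int (N choose 2)) / qpoch_inf (c * q ^ N) q)"
    by (simp add: tri_of_nat power_int_minus divide_inverse mult_ac)
  then have "norm (K0 q a b) * norm T \<le> norm (K0 q a b) * (norm z ^ N * (M * (H / dt) * q powi (- int (N choose 2)) / qpoch_inf (c * q ^ N) q))"
    by (rule mult_left_mono) simp
  then show ?thesis unfolding R by (simp add: norm_power mult_ac)
qed

section \<open>Shifting the line of integration\<close>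

lemma eventually_gt_real_nat: "eventually (\<lambda>n. (a::real) < real n) sequentially"
  using filterlim_real_sequentially unfolding filterlim_at_top_dense by blast

lemma normal_density_tendsto_0:
  assumes s: "s > 0"
  shows "(\<lambda>n. normal_density m s (real n)) \<longlonglongrightarrow> 0" "(\<lambda>n. normal_density m s (- real n)) \<longlonglongrightarrow> 0"
proof -
  have le: "normal_density m s x \<le> (1 / sqrt (2 * pi * s\<^sup>2) * (2 * s\<^sup>2)) * inverse ((x - m)\<^sup>2)" if "x \<noteq> m" for x
  proof -
    define y where "y = (x - m)\<^sup>2 / (2 * s\<^sup>2)"
    have y: "y > 0" using that s by (simp add: y_def)
    have "y \<le> exp y" using exp_ge_add_one_self[of y] by linarith
    then have "exp (- y) \<le> 1 / y" using y by (simp add: exp_minus field_simps)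
    then have "1 / sqrt (2 * pi * s\<^sup>2) * exp (- y) \<le> 1 / sqrt (2 * pi * s\<^sup>2) * (1 / y)"
      by (intro mult_left_mono) auto
    then show ?thesis by (simp add: normal_density_def y_def field_simps)
  qed
  have ev: "eventually (\<lambda>n. real n > \<bar>m\<bar>) sequentially" by (rule eventually_gt_real_nat)
  have lim: "(\<lambda>n. K * inverse ((real n - m)\<^sup>2)) \<longlonglongrightarrow> 0" for K m
    by real_asymp
  show "(\<lambda>n. normal_density m s (real n)) \<longlonglongrightarrow> 0"
    by (rule tendsto_sandwich[OF _ _ tendsto_const lim[of "1 / sqrt (2 * pi * s\<^sup>2) * (2 * s\<^sup>2)" m]])
       (use ev le in \<open>auto elim!: eventually_mono\<close>)
  have lim2: "(\<lambda>n. K * inverse ((- real n - m)\<^sup>2)) \<longlonglongrightarrow> 0" for K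
    using lim[of K "- m"] by (simp add: power2_eq_square algebra_simps)
  show "(\<lambda>n. normal_density m s (- real n)) \<longlonglongrightarrow> 0"
    by (rule tendsto_sandwich[OF _ _ tendsto_const lim2[of "1 / sqrt (2 * pi * s\<^sup>2) * (2 * s\<^sup>2)"]])
       (use ev le in \<open>auto elim!: eventually_mono\<close>)
qed

lemma strip_open: "open {w. A < Im w \<and> Im w < B}"
  by (intro open_Collect_conj open_Collect_less continuous_intros)

lemma strip_convex: "convex {w. A < Im w \<and> Im w < B}"
proof -
  have "{w. A < Im w \<and> Im w < B} = {w. Im w > A} \<inter> {w. Im w < B}" by auto
  then show ?thesis by (simp add: convex_Int convex_halfspace_Im_gt convex_halfspace_Im_lt)
qed

lemma horizontal_continuous:
  assumes "f holomorphic_on {w. A < Im w \<and> Im w < B}" "A < y" "y < B"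
  shows "continuous_on X (\<lambda>x. f (Complex x y))"
proof -
  have "continuous_on X (\<lambda>x. Complex x y)" unfolding Complex_eq by (intro continuous_intros)
  then show ?thesis
    by (rule continuous_on_compose2[OF holomorphic_on_imp_continuous_on[OF assms(1)]]) (use assms in auto)
qed

text \<open>Cauchy's theorem for a strip: the primitive takes nearly equal values at the two ends of a
  far vertical segment.\<close>

lemma contour_shift:
  fixes f :: "complex \<Rightarrow> complex"
  assumes f: "f holomorphic_on {w. A < Im w \<and> Im w < B}"
    and y: "A < y1" "y1 < B" "A < y2" "y2 < B"
    and s: "s > 0"
    and bound: "\<And>x y. y \<in> closed_segment y1 y2 \<Longrightarrow> norm (f (Complex x y)) \<le> C * normal_density m s x"
  shows "(\<integral>x. f (Complex x y1) \<partial>lborel) = (\<integral>x. f (Complex x y2) \<partial>lborel)"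
proof -
  let ?S = "{w. A < Im w \<and> Im w < B}"
  obtain F where F: "\<And>w. w \<in> ?S \<Longrightarrow> (F has_field_derivative f w) (at w within ?S)"
    using holomorphic_convex_primitive'[OF strip_convex strip_open f] by blast
  have line: "(\<lambda>n. F (Complex n y) - F (Complex (- real n) y)) \<longlonglongrightarrow> (\<integral>x. f (Complex x y) \<partial>lborel)"
    if y: "y \<in> closed_segment y1 y2" "A < y" "y < B" for y
  proof -
    have cont: "continuous_on X (\<lambda>x. f (Complex x y))" for X
      by (rule horizontal_continuous[OF f]) (use y in auto)
    have meas: "(\<lambda>x. f (Complex x y)) \<in> borel_measurable lborel"
      using borel_measurable_continuous_onI[OF cont] by simp
    have "(\<lambda>n. \<integral>x. indicator {- real n..real n} x *\<^sub>R f (Complex x y) \<partial>lborel) \<longlonglongrightarrow> (\<integral>x. f (Complex x y) \<partial>lborel)"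
    proof (rule integral_dominated_convergence[where w = "\<lambda>x. C * normal_density m s x"])
      show "(\<lambda>x. f (Complex x y)) \<in> borel_measurable lborel" by (rule meas)
      then show "(\<lambda>x. indicator {- real n..real n} x *\<^sub>R f (Complex x y)) \<in> borel_measurable lborel" for n
        by measurable
      show "integrable lborel (\<lambda>x. C * normal_density m s x)" using s by simp
      show "AE x in lborel. norm (indicator {- real n..real n} x *\<^sub>R f (Complex x y)) \<le> C * normal_density m s x" for n
      proof (intro AE_I2)
        fix x
        show "norm (indicator {- real n..real n} x *\<^sub>R f (Complex x y)) \<le> C * normal_density m s x"
          using bound[OF y(1), of x] order_trans[OF norm_ge_zero bound[OF y(1), of x]] by (auto simp: indicator_def)
      qed
      show "AE x in lborel. (\<lambda>n. indicator {- real n..real n} x *\<^sub>R f (Complex x y)) \<longlonglongrightarrow> f (Complex x y)"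
      proof (intro AE_I2)
        fix x :: real
        have "eventually (\<lambda>n. real n > \<bar>x\<bar>) sequentially" by (rule eventually_gt_real_nat)
        then have "eventually (\<lambda>n. indicator {- real n..real n} x *\<^sub>R f (Complex x y) = f (Complex x y)) sequentially"
          by (rule eventually_mono) (auto simp: indicator_def)
        then show "(\<lambda>n. indicator {- real n..real n} x *\<^sub>R f (Complex x y)) \<longlonglongrightarrow> f (Complex x y)"
          by (rule tendsto_eventually)
      qed
    qed
    moreover have "(\<integral>x. indicator {- real n..real n} x *\<^sub>R f (Complex x y) \<partial>lborel) = F (Complex n y) - F (Complex (- real n) y)" for n
    proof (rule integral_FTC_Icc)
      show "((\<lambda>x. F (Complex x y)) has_vector_derivative f (Complex x y)) (at x within {- real n..real n})" for x
      proof -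
        have "((\<lambda>x. Complex x y) has_vector_derivative 1) (at x within {- real n..real n})"
          unfolding Complex_eq by (auto intro!: derivative_eq_intros)
        moreover have "(F has_field_derivative f (Complex x y)) (at (Complex x y))"
          using F[of "Complex x y"] y at_within_open[OF _ strip_open, of "Complex x y" A B] by simp
        ultimately show ?thesis
          using field_vector_diff_chain_within[of "\<lambda>x. Complex x y" 1 x "{- real n..real n}" F "f (Complex x y)"]
          by (auto simp: o_def intro: has_field_derivative_at_within)
      qed
    qed (use cont in auto)
    ultimately show ?thesis by simp
  qed
  have vert: "norm (F (Complex x y1) - F (Complex x y2)) \<le> (C * \<bar>y1 - y2\<bar>) * normal_density m s x" for x
  proof -
    have seg: "\<exists>y\<in>closed_segment y1 y2. w = Complex x y \<and> A < y \<and> y < B" if "w \<in> closed_segment (Complex x y1) (Complex x y2)" for w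
    proof -
      have "\<exists>u. 0 \<le> u \<and> u \<le> 1 \<and> w = (1 - u) *\<^sub>R Complex x y1 + u *\<^sub>R Complex x y2"
        using that by (simp only: in_segment)
      then obtain u where u: "0 \<le> u" "u \<le> 1" "w = (1 - u) *\<^sub>R Complex x y1 + u *\<^sub>R Complex x y2"
        by (elim exE conjE)
      have "w = Complex x ((1 - u) *\<^sub>R y1 + u *\<^sub>R y2)"
        unfolding u by (simp add: complex_eq_iff algebra_simps)
      moreover have c: "(1 - u) *\<^sub>R y1 + u *\<^sub>R y2 \<in> closed_segment y1 y2" using u by (auto simp: in_segment)
      moreover have "closed_segment y1 y2 \<subseteq> {A<..<B}"
        by (rule closed_segment_subset) (use y in auto)
      ultimately show ?thesis by auto
    qed
    have "norm (F (Complex x y1) - F (Complex x y2)) \<le> (C * normal_density m s x) * norm (Complex x y1 - Complex x y2)"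
    proof (rule field_differentiable_bound[of "closed_segment (Complex x y1) (Complex x y2)" F f])
      fix w assume "w \<in> closed_segment (Complex x y1) (Complex x y2)"
      then obtain y where yy: "y \<in> closed_segment y1 y2" "w = Complex x y" "A < y" "y < B" using seg by blast
      show "norm (f w) \<le> C * normal_density m s x" unfolding yy(2) by (rule bound[OF yy(1)])
      have "w \<in> ?S" using yy by simp
      then have "(F has_field_derivative f w) (at w)"
        using F[of w] at_within_open[OF _ strip_open, of w A B] by simp
      then show "(F has_field_derivative f w) (at w within closed_segment (Complex x y1) (Complex x y2))"
        by (rule has_field_derivative_at_within)
    qed auto
    moreover have "Complex x y1 - Complex x y2 = \<i> * of_real (y1 - y2)" by (simp add: complex_eq_iff)
    then have "norm (Complex x y1 - Complex x y2) = \<bar>y1 - y2\<bar>"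
      by (simp only: norm_mult norm_of_real norm_ii mult_1_left)
    ultimately show ?thesis by (simp add: mult_ac)
  qed
  have v1: "(\<lambda>n. F (Complex n y1) - F (Complex n y2)) \<longlonglongrightarrow> 0"
    by (rule Lim_null_comparison[OF _ tendsto_mult_right_zero[OF normal_density_tendsto_0(1)[OF s, of m], of "C * \<bar>y1 - y2\<bar>"]])
       (use vert in auto)
  have v2: "(\<lambda>n. F (Complex (- real n) y1) - F (Complex (- real n) y2)) \<longlonglongrightarrow> 0"
    by (rule Lim_null_comparison[OF _ tendsto_mult_right_zero[OF normal_density_tendsto_0(2)[OF s, of m], of "C * \<bar>y1 - y2\<bar>"]])
       (use vert in auto)
  have "(\<lambda>n. (F (Complex n y1) - F (Complex (- real n) y1)) - (F (Complex n y2) - F (Complex (- real n) y2)))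
     \<longlonglongrightarrow> (\<integral>x. f (Complex x y1) \<partial>lborel) - (\<integral>x. f (Complex x y2) \<partial>lborel)"
    by (intro tendsto_diff line) (use y in auto)
  moreover have "(\<lambda>n. (F (Complex n y1) - F (Complex (- real n) y1)) - (F (Complex n y2) - F (Complex (- real n) y2))) \<longlonglongrightarrow> 0 - 0"
    using tendsto_diff[OF v1 v2] by (simp add: algebra_simps)
  ultimately have "(\<integral>x. f (Complex x y1) \<partial>lborel) - (\<integral>x. f (Complex x y2) \<partial>lborel) = 0 - 0"
    using LIMSEQ_unique by blast
  then show ?thesis by simp
qed

lemma integral_exp_substitution:
  fixes G :: "real \<Rightarrow> complex"
  assumes cont: "continuous_on UNIV G" and int: "integrable lborel G"
    and f: "\<And>t. 0 < t \<Longrightarrow> f t = G (ln t) / of_real t"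
  shows "(LBINT t:{0<..}. f t) = (\<integral>x. G x \<partial>lborel)"
proof -
  let ?f = "\<lambda>t. G (ln t) / of_real t"
  have ab: "(\<lambda>x. \<bar>exp x\<bar> *\<^sub>R ?f (exp x)) absolutely_integrable_on UNIV"
    and e: "(\<lambda>x::real. \<bar>exp x\<bar> *\<^sub>R ?f (exp x)) = G"
  proof -
    show e: "(\<lambda>x::real. \<bar>exp x\<bar> *\<^sub>R ?f (exp x)) = G" by (simp add: fun_eq_iff scaleR_conv_of_real)
    have "set_integrable lborel UNIV G" using int by (simp add: set_integrable_def)
    then have "set_integrable lebesgue UNIV G"
      unfolding set_integrable_def using borel_measurable_integrable[OF int] by (simp add: integrable_completion int)
    then show "(\<lambda>x. \<bar>exp x\<bar> *\<^sub>R ?f (exp x)) absolutely_integrable_on UNIV" unfolding e .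
  qed
  have range: "range (exp :: real \<Rightarrow> real) = {0<..}"
    by (auto simp: image_iff) (metis exp_ln)
  have "?f absolutely_integrable_on (exp ` UNIV) \<and> integral (exp ` UNIV) ?f = integral UNIV G"
    by (subst has_absolute_integral_change_of_variables_real[symmetric, where h = exp])
       (use ab e in \<open>auto intro!: derivative_eq_intros DERIV_subset[OF DERIV_exp] inj_onI\<close>)
  then have 1: "?f absolutely_integrable_on {0<..}" "integral {0<..} ?f = integral UNIV G"
    unfolding range by auto
  have "continuous_on {0<..} ?f"
    by (intro continuous_intros continuous_on_compose2[OF cont]) auto
  then have m: "(\<lambda>x. indicator {0<..} x *\<^sub>R ?f x) \<in> borel_measurable borel"
    by (intro borel_measurable_continuous_on_indicator) auto
  then have 2: "set_integrable lborel {0<..} ?f"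
    using 1(1) unfolding set_integrable_def by (subst (asm) integrable_completion) auto
  have "(LBINT t:{0<..}. f t) = (LBINT t:{0<..}. ?f t)"
    unfolding set_lebesgue_integral_def using f by (intro Bochner_Integration.integral_cong) (auto simp: indicator_def)
  also have "\<dots> = integral {0<..} ?f" by (rule set_borel_integral_eq_integral(2)[OF 2])
  also have "\<dots> = integral UNIV G" by (rule 1(2))
  also have "\<dots> = (LBINT x:UNIV. G x)"
    by (rule set_borel_integral_eq_integral(2)[symmetric]) (simp add: set_integrable_def int)
  also have "\<dots> = (\<integral>x. G x \<partial>lborel)" by (simp add: set_lebesgue_integral_def)
  finally show ?thesis .
qed

text \<open>The entire continuation of a normal density of mean \<open>-\<alpha>/2\<close> and variance \<open>\<alpha>\<close>. For
  \<open>\<alpha> = - ln q\<close> and \<open>w = ln (t / z)\<close> it is the kernel \<open>C\<^sub>q E\<^sub>q(t / z)\<close>.\<close>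

definition gaussian :: "real \<Rightarrow> complex \<Rightarrow> complex" where
  "gaussian \<alpha> w = exp (- ((w + of_real (\<alpha> / 2))\<^sup>2) / of_real (2 * \<alpha>)) / of_real (sqrt (2 * pi * \<alpha>))"

lemma gaussian_holomorphic [holomorphic_intros]:
  assumes "\<alpha> > 0" "f holomorphic_on S"
  shows "(\<lambda>w. gaussian \<alpha> (f w)) holomorphic_on S"
  unfolding gaussian_def using assms by (intro holomorphic_intros) auto

text \<open>Leaving the real axis by \<open>y\<close> costs the factor \<open>exp(y\<^sup>2 / (2 \<alpha>))\<close>: this is the origin of
  \<open>exp(-\<zeta>\<^sup>2 / (2 ln q))\<close> in the final bounds.\<close>

lemma norm_gaussian:
  assumes "\<alpha> > 0"
  shows "norm (gaussian \<alpha> (Complex x y)) = exp (y\<^sup>2 / (2 * \<alpha>)) * normal_density (- \<alpha> / 2) (sqrt \<alpha>) x"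
proof -
  have "Re (- ((Complex x y + of_real (\<alpha> / 2))\<^sup>2) / of_real (2 * \<alpha>)) = (y\<^sup>2 - (x + \<alpha> / 2)\<^sup>2) / (2 * \<alpha>)"
    unfolding Re_divide_of_real by (simp add: power2_eq_square)
  then have "norm (gaussian \<alpha> (Complex x y)) = exp (y\<^sup>2 / (2 * \<alpha>) - (x + \<alpha> / 2)\<^sup>2 / (2 * \<alpha>)) / sqrt (2 * pi * \<alpha>)"
    using assms unfolding gaussian_def norm_divide norm_exp_eq_Re by (simp add: diff_divide_distrib)
  also have "exp (y\<^sup>2 / (2 * \<alpha>) - (x + \<alpha> / 2)\<^sup>2 / (2 * \<alpha>)) = exp (y\<^sup>2 / (2 * \<alpha>)) * exp (- ((x + \<alpha> / 2)\<^sup>2 / (2 * \<alpha>)))"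
    by (simp add: exp_add[symmetric])
  also have "\<dots> / sqrt (2 * pi * \<alpha>) = exp (y\<^sup>2 / (2 * \<alpha>)) * normal_density (- \<alpha> / 2) (sqrt \<alpha>) x"
    using assms by (simp add: normal_density_def)
  finally show ?thesis .
qed

lemma gaussian_of_real:
  assumes "\<alpha> > 0"
  shows "gaussian \<alpha> (of_real x) = of_real (normal_density (- \<alpha> / 2) (sqrt \<alpha>) x)"
proof -
  have "- ((complex_of_real x + of_real (\<alpha> / 2))\<^sup>2) / of_real (2 * \<alpha>) = of_real (- ((x + \<alpha> / 2)\<^sup>2) / (2 * \<alpha>))"
    by simp
  then have "gaussian \<alpha> (of_real x) = exp (of_real (- ((x + \<alpha> / 2)\<^sup>2) / (2 * \<alpha>))) / of_real (sqrt (2 * pi * \<alpha>))"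
    unfolding gaussian_def by simp
  also have "\<dots> = of_real (exp (- ((x + \<alpha> / 2)\<^sup>2) / (2 * \<alpha>))) / of_real (sqrt (2 * pi * \<alpha>))"
    by (simp only: exp_of_real)
  finally show ?thesis using assms by (simp add: normal_density_def)
qed

lemma gaussian_shift:
  assumes "\<alpha> > 0"
  shows "gaussian \<alpha> (w + of_real \<alpha>) = gaussian \<alpha> w * (of_real (exp (- \<alpha>)) * exp (- w))"
proof -
  have "- ((w + of_real \<alpha> + of_real (\<alpha> / 2))\<^sup>2) / of_real (2 * \<alpha>)
    = - ((w + of_real (\<alpha> / 2))\<^sup>2) / of_real (2 * \<alpha>) + (- of_real \<alpha> - w)"
    using assms by (simp add: field_simps power2_eq_square)
  then have "exp (- ((w + of_real \<alpha> + of_real (\<alpha> / 2))\<^sup>2) / of_real (2 * \<alpha>))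
    = exp (- ((w + of_real (\<alpha> / 2))\<^sup>2) / of_real (2 * \<alpha>)) * (exp (- of_real \<alpha>) * exp (- w))"
    unfolding exp_add[symmetric] by simp
  moreover have "exp (- complex_of_real \<alpha>) = of_real (exp (- \<alpha>))" by (simp only: exp_of_real of_real_minus[symmetric])
  ultimately show ?thesis unfolding gaussian_def by simp
qed

lemma exp_times_normal_density:
  assumes "\<alpha> > 0"
  shows "exp (j * x) * normal_density m (sqrt \<alpha>) x
    = exp (j * m + j\<^sup>2 * \<alpha> / 2) * normal_density (m + j * \<alpha>) (sqrt \<alpha>) x"
proof -
  have "j * x + - (x - m)\<^sup>2 / (2 * \<alpha>) = (j * m + j\<^sup>2 * \<alpha> / 2) + - (x - (m + j * \<alpha>))\<^sup>2 / (2 * \<alpha>)"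
    using assms by (simp add: field_simps power2_eq_square)
  then have "exp (j * x) * exp (- (x - m)\<^sup>2 / (2 * \<alpha>)) = exp (j * m + j\<^sup>2 * \<alpha> / 2) * exp (- (x - (m + j * \<alpha>))\<^sup>2 / (2 * \<alpha>))"
    unfolding exp_add[symmetric] by simp
  then show ?thesis using assms by (simp add: normal_density_def)
qed

lemma one_plus_norm_ge_1:
  assumes "0 \<le> Re w"
  shows "1 \<le> norm (1 + w)"
  using complex_Re_le_cmod[of "1 + w"] assms by simp

lemma cos_nonneg_imp_abs_le:
  assumes "0 \<le> cos y" "\<bar>y\<bar> < pi"
  shows "\<bar>y\<bar> \<le> pi / 2"
proof (rule ccontr)
  assume "\<not> \<bar>y\<bar> \<le> pi / 2"
  then have "0 < sin (\<bar>y\<bar> - pi / 2)" using assms by (intro sin_gt_zero) auto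
  then show False using assms by (simp add: sin_diff)
qed

text \<open>Both continuous kernels are a Gaussian times a function \<open>B\<close> of period \<open>\<alpha>\<close> in the logarithmic
  coordinate: \<open>1\<close> for \<open>E\<close>, the reciprocal of a dual theta function for \<open>\<theta>\<close>. The strip
  \<open>|Im w| < \<pi>\<close> is that of the arguments \<open>t / z\<close> off the negative axis, where \<open>1 / \<theta>\<close> has its
  poles.\<close>

locale strip_factor =
  fixes q \<alpha> :: real and B :: "complex \<Rightarrow> complex"
  assumes q: "0 < q" "q < 1" and alpha: "\<alpha> = - ln q"
    and B_holomorphic: "B holomorphic_on {w. - pi < Im w \<and> Im w < pi}"
    and B_periodic: "\<And>w. B (w + of_real \<alpha>) = B w"
    and B_bounded: "\<And>Y. 0 \<le> Y \<Longrightarrow> Y < pi \<Longrightarrow> \<exists>C\<ge>0. \<forall>w. \<bar>Im w\<bar> \<le> Y \<longrightarrow> norm (B w) \<le> C"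
    and mass: "(\<integral>x. gaussian \<alpha> (of_real x) * B (of_real x) \<partial>lborel) = 1"
begin

lemma alpha_pos: "0 < \<alpha>" using q alpha by simp

lemma exp_alpha: "exp \<alpha> = 1 / q" "exp (- \<alpha>) = q"
  using q unfolding alpha by (simp_all add: exp_minus inverse_eq_divide)

definition strip_kernel :: "complex \<Rightarrow> complex" where
  "strip_kernel w = gaussian \<alpha> w * B w"

lemma strip_kernel_holomorphic:
  "(\<lambda>w. strip_kernel (w - c)) holomorphic_on {w. Im c - pi < Im w \<and> Im w < Im c + pi}"
proof -
  have g: "(\<lambda>w. gaussian \<alpha> (w - c)) holomorphic_on {w. Im c - pi < Im w \<and> Im w < Im c + pi}"
    by (intro holomorphic_intros alpha_pos)
  have "(\<lambda>w. w - c) holomorphic_on {w. Im c - pi < Im w \<and> Im w < Im c + pi}"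
    by (intro holomorphic_intros)
  moreover have "(\<lambda>w. w - c) ` {w. Im c - pi < Im w \<and> Im w < Im c + pi} \<subseteq> {w. - pi < Im w \<and> Im w < pi}"
    by auto
  ultimately have "(\<lambda>w. B (w - c)) holomorphic_on {w. Im c - pi < Im w \<and> Im w < Im c + pi}"
    using holomorphic_on_compose_gen[OF _ B_holomorphic, of "\<lambda>w. w - c"] by (simp only: o_def)
  with g show ?thesis unfolding strip_kernel_def by (rule holomorphic_on_mult)
qed

lemma strip_kernel_shift: "strip_kernel (w + of_real \<alpha>) = strip_kernel w * (of_real q * exp (- w))"
  unfolding strip_kernel_def gaussian_shift[OF alpha_pos] exp_alpha B_periodic by simp

lemma normal_density_translate: "normal_density m s (x - t) = normal_density (m + t) s x"
  by (simp add: normal_density_def algebra_simps)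

lemma strip_kernel_bound:
  assumes "0 \<le> Y" "Y < pi"
  obtains C where "0 \<le> C" "\<And>x y. \<bar>y - Im c\<bar> \<le> Y \<Longrightarrow>
     norm (strip_kernel (Complex x y - c)) \<le> C * normal_density (Re c - \<alpha> / 2) (sqrt \<alpha>) x"
proof -
  obtain C where C: "0 \<le> C" "\<And>w. \<bar>Im w\<bar> \<le> Y \<Longrightarrow> norm (B w) \<le> C" using B_bounded[OF assms] by blast
  show ?thesis
  proof (rule that[of "exp (Y\<^sup>2 / (2 * \<alpha>)) * C"])
    show "0 \<le> exp (Y\<^sup>2 / (2 * \<alpha>)) * C" using C by simp
    fix x y assume y: "\<bar>y - Im c\<bar> \<le> Y"
    have c: "Complex x y - c = Complex (x - Re c) (y - Im c)" by (simp add: complex_eq_iff)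
    have "(y - Im c)\<^sup>2 \<le> Y\<^sup>2" using y assms by (simp add: abs_le_square_iff[symmetric])
    then have "exp ((y - Im c)\<^sup>2 / (2 * \<alpha>)) \<le> exp (Y\<^sup>2 / (2 * \<alpha>))"
      using alpha_pos by (simp add: divide_right_mono)
    moreover have "norm (B (Complex x y - c)) \<le> C" using y by (intro C(2)) simp
    ultimately have "exp ((y - Im c)\<^sup>2 / (2 * \<alpha>)) * norm (B (Complex x y - c)) \<le> exp (Y\<^sup>2 / (2 * \<alpha>)) * C"
      by (intro mult_mono) auto
    then have "normal_density (Re c - \<alpha> / 2) (sqrt \<alpha>) x * (exp ((y - Im c)\<^sup>2 / (2 * \<alpha>)) * norm (B (Complex x y - c)))
      \<le> normal_density (Re c - \<alpha> / 2) (sqrt \<alpha>) x * (exp (Y\<^sup>2 / (2 * \<alpha>)) * C)"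
      by (intro mult_left_mono) auto
    then show "norm (strip_kernel (Complex x y - c)) \<le> exp (Y\<^sup>2 / (2 * \<alpha>)) * C * normal_density (Re c - \<alpha> / 2) (sqrt \<alpha>) x"
      unfolding strip_kernel_def norm_mult c norm_gaussian[OF alpha_pos] normal_density_translate
      by (simp add: mult_ac)
  qed
qed

text \<open>The total mass may be computed on the line through \<open>Im c\<close>, where the kernel is a real translate.\<close>

lemma strip_kernel_integral:
  assumes "\<bar>y - Im c\<bar> < pi"
  shows "(\<integral>x. strip_kernel (Complex x y - c) \<partial>lborel) = 1"
proof -
  define Y where "Y = \<bar>y - Im c\<bar>"
  have Y: "0 \<le> Y" "Y < pi" using assms by (auto simp: Y_def)
  obtain C where C: "0 \<le> C" "\<And>x y. \<bar>y - Im c\<bar> \<le> Y \<Longrightarrow>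
     norm (strip_kernel (Complex x y - c)) \<le> C * normal_density (Re c - \<alpha> / 2) (sqrt \<alpha>) x"
    using strip_kernel_bound[OF Y] by blast
  have "(\<integral>x. strip_kernel (Complex x y - c) \<partial>lborel) = (\<integral>x. strip_kernel (Complex x (Im c) - c) \<partial>lborel)"
  proof (rule contour_shift[OF strip_kernel_holomorphic[of c]])
    fix x y' assume "y' \<in> closed_segment y (Im c)"
    then have "\<bar>y' - Im c\<bar> \<le> Y" unfolding Y_def closed_segment_eq_real_ivl by (auto split: if_splits)
    then show "norm (strip_kernel (Complex x y' - c)) \<le> C * normal_density (Re c - \<alpha> / 2) (sqrt \<alpha>) x"
      by (rule C(2))
  qed (use assms alpha_pos in auto)
  also have "\<dots> = (\<integral>x. strip_kernel (of_real (- Re c + 1 * x)) \<partial>lborel)"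
    by (intro Bochner_Integration.integral_cong refl arg_cong[of _ _ strip_kernel]) (simp add: complex_eq_iff)
  also have "\<dots> = (\<integral>x. strip_kernel (of_real x) \<partial>lborel)"
    using lborel_integral_real_affine[of 1 "\<lambda>x. strip_kernel (of_real x)" "- Re c"] by simp
  finally show ?thesis using mass by (simp add: strip_kernel_def)
qed

lemma exp_Complex: "exp (Complex x y) = cis y * of_real (exp x)"
  by (simp add: exp_eq_polar)

text \<open>The kernel on the ray of argument \<open>y\<close>, in the logarithmic coordinate of that ray. The condition
  \<open>cos y \<ge> 0\<close> keeps \<open>|1 + t| \<ge> 1\<close>.\<close>

lemma strip_q_kernel:
  assumes z: "z \<noteq> 0" and y: "\<bar>y - Arg z\<bar> < pi" "0 \<le> cos y"
  shows "q_kernel q z (cis y) lborel exp (\<lambda>x. x + \<alpha>) (\<lambda>x. strip_kernel (Complex x y - Ln z)) 1"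
proof
  have ImLn: "Im (Ln z) = Arg z" using z by (simp add: Arg_def)
  show "0 < q" "q < 1" by (rule q)+
  show "z \<noteq> 0" by (rule z)
  show "(\<integral>x. strip_kernel (Complex x y - Ln z) \<partial>lborel) = 1"
    by (rule strip_kernel_integral) (use y ImLn in simp)
  show "exp (x + \<alpha>) = exp x / q" for x using exp_alpha by (simp add: exp_add)
  show "(\<integral>x. F (x + \<alpha>) \<partial>lborel) = (\<integral>x. F x \<partial>lborel)" for F :: "real \<Rightarrow> complex"
    using lborel_integral_real_affine[of 1 F \<alpha>] by (simp add: add.commute)
  show "strip_kernel (Complex (x + \<alpha>) y - Ln z)
     = strip_kernel (Complex x y - Ln z) * (of_real q * z / (cis y * of_real (exp x)))" for x
  proof -
    have "Complex (x + \<alpha>) y - Ln z = (Complex x y - Ln z) + of_real \<alpha>" by (simp add: complex_eq_iff)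
    moreover have "exp (- (Complex x y - Ln z)) = z / (cis y * of_real (exp x))"
      using z by (simp add: exp_diff exp_Complex)
    ultimately show ?thesis by (simp only: strip_kernel_shift times_divide_eq_right)
  qed
  show "1 \<le> norm (1 + cis y * of_real (exp x))" for x
    by (rule one_plus_norm_ge_1) (use y in simp)
  show "integrable lborel (\<lambda>x. of_real (exp x) powi j * strip_kernel (Complex x y - Ln z))" for j
  proof -
    define Y where "Y = \<bar>y - Im (Ln z)\<bar>"
    have Y: "0 \<le> Y" "Y < pi" using y ImLn by (auto simp: Y_def)
    obtain C where C: "0 \<le> C" "\<And>x y. \<bar>y - Im (Ln z)\<bar> \<le> Y \<Longrightarrow>
       norm (strip_kernel (Complex x y - Ln z)) \<le> C * normal_density (Re (Ln z) - \<alpha> / 2) (sqrt \<alpha>) x"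
      using strip_kernel_bound[OF Y, of "Ln z"] by blast
    define m where "m = Re (Ln z) - \<alpha> / 2"
    have pw: "complex_of_real (exp x) powi j = of_real (exp (of_int j * x))" for x
      by (simp add: exp_of_real[symmetric] exp_power_int)
    show ?thesis
    proof (rule Bochner_Integration.integrable_bound)
      show "integrable lborel (\<lambda>x. C * exp (of_int j * m + (of_int j)\<^sup>2 * \<alpha> / 2) * normal_density (m + of_int j * \<alpha>) (sqrt \<alpha>) x)"
        using alpha_pos by simp
      have "continuous_on UNIV (\<lambda>x. strip_kernel (Complex x y - Ln z))"
        by (rule horizontal_continuous[OF strip_kernel_holomorphic[of "Ln z"]]) (use y ImLn in auto)
      then have "(\<lambda>x. strip_kernel (Complex x y - Ln z)) \<in> borel_measurable lborel"
        using borel_measurable_continuous_onI by simp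
      then show "(\<lambda>x. complex_of_real (exp x) powi j * strip_kernel (Complex x y - Ln z)) \<in> borel_measurable lborel"
        unfolding pw by measurable
      show "AE x in lborel. norm (complex_of_real (exp x) powi j * strip_kernel (Complex x y - Ln z))
         \<le> norm (C * exp (of_int j * m + (of_int j)\<^sup>2 * \<alpha> / 2) * normal_density (m + of_int j * \<alpha>) (sqrt \<alpha>) x)"
      proof (intro AE_I2)
        fix x
        have "norm (complex_of_real (exp x) powi j * strip_kernel (Complex x y - Ln z))
           \<le> exp (of_int j * x) * (C * normal_density m (sqrt \<alpha>) x)"
          unfolding pw norm_mult m_def using C(2)[of y x] Y_def by (intro mult_mono) auto
        also have "\<dots> = C * (exp (of_int j * x) * normal_density m (sqrt \<alpha>) x)" by simp
        also have "\<dots> = C * exp (of_int j * m + (of_int j)\<^sup>2 * \<alpha> / 2) * normal_density (m + of_int j * \<alpha>) (sqrt \<alpha>) x"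
          unfolding exp_times_normal_density[OF alpha_pos] by simp
        finally show "norm (complex_of_real (exp x) powi j * strip_kernel (Complex x y - Ln z))
         \<le> norm (C * exp (of_int j * m + (of_int j)\<^sup>2 * \<alpha> / 2) * normal_density (m + of_int j * \<alpha>) (sqrt \<alpha>) x)"
          using C(1) by simp
      qed
    qed
  qed
qed (auto)

text \<open>The pole \<open>t = -1\<close> lies on the boundary of the strip \<open>|Im w| < \<pi>\<close>, so the ray can be turned
  within the right half-plane without crossing it.\<close>

lemma strip_stieltjes_eq:
  assumes z: "z \<noteq> 0" and y: "\<bar>y1 - Arg z\<bar> < pi" "\<bar>y2 - Arg z\<bar> < pi" "0 \<le> cos y1" "0 \<le> cos y2"
    "\<bar>y1\<bar> < pi" "\<bar>y2\<bar> < pi"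
  shows "q_kernel.stieltjes (cis y1) lborel exp (\<lambda>x. strip_kernel (Complex x y1 - Ln z)) 0
    = q_kernel.stieltjes (cis y2) lborel exp (\<lambda>x. strip_kernel (Complex x y2 - Ln z)) 0"
proof -
  have ImLn: "Im (Ln z) = Arg z" using z by (simp add: Arg_def)
  define f where "f w = strip_kernel (w - Ln z) / (1 + exp w)" for w
  have stieltjes: "q_kernel.stieltjes (cis y) lborel exp (\<lambda>x. strip_kernel (Complex x y - Ln z)) 0
    = (\<integral>x. f (Complex x y) \<partial>lborel)" if y: "\<bar>y - Arg z\<bar> < pi" "0 \<le> cos y" for y
  proof -
    interpret q_kernel q z "cis y" lborel exp "\<lambda>x. x + \<alpha>" "\<lambda>x. strip_kernel (Complex x y - Ln z)" 1
      by (rule strip_q_kernel[OF z y])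
    show ?thesis unfolding stieltjes_def by (simp add: f_def pt_def exp_Complex)
  qed
  define Y where "Y = max \<bar>y1 - Arg z\<bar> \<bar>y2 - Arg z\<bar>"
  have Y: "0 \<le> Y" "Y < pi" using y by (auto simp: Y_def)
  define A B' where "A = max (- pi) (Arg z - pi)" and "B' = min pi (Arg z + pi)"
  obtain C where C: "0 \<le> C" "\<And>x y. \<bar>y - Im (Ln z)\<bar> \<le> Y \<Longrightarrow>
     norm (strip_kernel (Complex x y - Ln z)) \<le> C * normal_density (Re (Ln z) - \<alpha> / 2) (sqrt \<alpha>) x"
    using strip_kernel_bound[OF Y, of "Ln z"] by blast
  have seg: "\<bar>y' - Arg z\<bar> \<le> Y" "0 \<le> cos y'" if "y' \<in> closed_segment y1 y2" for y'
  proof -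
    have "y' \<in> {min y1 y2..max y1 y2}" using that by (auto simp: closed_segment_eq_real_ivl split: if_splits)
    then show "\<bar>y' - Arg z\<bar> \<le> Y" unfolding Y_def by auto
    have "\<bar>y1\<bar> \<le> pi / 2" "\<bar>y2\<bar> \<le> pi / 2"
      using y cos_nonneg_imp_abs_le by blast+
    then have "- (pi / 2) \<le> y'" "y' \<le> pi / 2" using \<open>y' \<in> {min y1 y2..max y1 y2}\<close> by auto
    then show "0 \<le> cos y'" by (intro cos_ge_zero) auto
  qed
  have "(\<integral>x. f (Complex x y1) \<partial>lborel) = (\<integral>x. f (Complex x y2) \<partial>lborel)"
  proof (rule contour_shift[where A = A and B = B'])
    have nz: "1 + exp w \<noteq> 0" if "A < Im w" "Im w < B'" for w
    proof
      assume "1 + exp w = 0"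
      then have "exp w = exp (\<i> * pi)" by (simp add: add_eq_0_iff)
      then obtain n :: int where "w = \<i> * pi + of_int (2 * n) * pi * \<i>" unfolding exp_eq by auto
      then have "Im w = (1 + 2 * of_int n) * pi" by (simp add: algebra_simps)
      moreover have "\<bar>Im w\<bar> < pi" using that by (auto simp: A_def B'_def)
      ultimately have "\<bar>1 + 2 * of_int n\<bar> * pi < 1 * pi" by (simp add: abs_mult)
      then have "\<bar>1 + 2 * real_of_int n\<bar> < 1" by (simp add: mult_less_cancel_right)
      then have "\<bar>1 + 2 * n\<bar> < 1" by linarith
      then show False by presburger
    qed
    have sub: "{w. A < Im w \<and> Im w < B'} \<subseteq> {w. Im (Ln z) - pi < Im w \<and> Im w < Im (Ln z) + pi}"
      using ImLn by (auto simp: A_def B'_def)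
    show "f holomorphic_on {w. A < Im w \<and> Im w < B'}"
      unfolding f_def using nz
      by (intro holomorphic_on_divide holomorphic_on_subset[OF strip_kernel_holomorphic[of "Ln z"] sub] holomorphic_intros) auto
    fix x y' assume y': "y' \<in> closed_segment y1 y2"
    have "1 \<le> norm (1 + exp (Complex x y'))"
      by (rule one_plus_norm_ge_1) (use seg(2)[OF y'] in \<open>simp add: exp_Complex\<close>)
    moreover have "norm (strip_kernel (Complex x y' - Ln z)) \<le> C * normal_density (Re (Ln z) - \<alpha> / 2) (sqrt \<alpha>) x"
      by (rule C(2)) (use seg(1)[OF y'] ImLn in simp)
    ultimately have "norm (strip_kernel (Complex x y' - Ln z)) \<le> (C * normal_density (Re (Ln z) - \<alpha> / 2) (sqrt \<alpha>) x) * norm (1 + exp (Complex x y'))"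
      by (metis mult_left_mono mult.right_neutral norm_ge_zero order_trans)
    then show "norm (f (Complex x y')) \<le> C * normal_density (Re (Ln z) - \<alpha> / 2) (sqrt \<alpha>) x"
      unfolding f_def norm_divide
      by (subst pos_divide_le_eq) (use \<open>1 \<le> norm (1 + exp (Complex x y'))\<close> in \<open>linarith | assumption\<close>)+
  qed (use y alpha_pos in \<open>auto simp: A_def B'_def\<close>)
  then show ?thesis using stieltjes y by simp
qed

end

section \<open>Fourier series and folding\<close>

lemma eq_zero_if_norm_le:
  fixes a :: complex
  assumes "\<And>e. e > 0 \<Longrightarrow> norm a \<le> e * K"
  shows "a = 0"
proof (rule ccontr)
  assume "a \<noteq> 0"
  define e where "e = norm a / (2 * (\<bar>K\<bar> + 1))"
  have "e > 0" using \<open>a \<noteq> 0\<close> by (simp add: e_def)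
  have "norm a \<le> e * K" by (rule assms[OF \<open>e > 0\<close>])
  also have "\<dots> \<le> e * (\<bar>K\<bar> + 1)" using \<open>e > 0\<close> by (intro mult_left_mono) auto
  also have "\<dots> = norm a / 2" by (simp add: e_def field_simps add_nonneg_eq_0_iff)
  finally show False using \<open>a \<noteq> 0\<close> by simp
qed

text \<open>Trigonometric polynomials are dense among the continuous functions on the circle, so a
  continuous periodic function all of whose Fourier coefficients vanish integrates to zero
  against its own conjugate.\<close>

lemma fourier_uniqueness:
  fixes D :: "real \<Rightarrow> complex"
  assumes L: "L > 0" and cont: "continuous_on UNIV D" and per: "\<And>x. D (x + L) = D x"
    and coeff: "\<And>n::int. integral {0..L} (\<lambda>x. D x * cis (2 * pi * of_int n * x / L)) = 0"
  shows "D x = 0"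
proof -
  define c where "c x = cis (2 * pi * x / L)" for x
  have D_int: "D (x + of_int k * L) = D x" for k x
  proof (induction k rule: int_induct[where k = 0])
    case (step1 i)
    then show ?case using per[of "x + of_int i * L"] by (simp add: algebra_simps)
  next
    case (step2 i)
    then show ?case using per[of "x + of_int (i - 1) * L"] by (simp add: algebra_simps)
  qed simp
  have D_eq: "D x = D y" if "c x = c y" for x y
  proof -
    have "\<exists>n::int. 2 * pi * x / L = 2 * pi * y / L + 2 * pi * of_int n"
      using that sin_cos_eq_iff[of "2 * pi * x / L" "2 * pi * y / L"] by (simp add: c_def complex_eq_iff)
    then obtain n :: int where "2 * pi * x / L = 2 * pi * y / L + 2 * pi * of_int n" by blast
    then have "2 * pi * x / L = 2 * pi * (y + of_int n * L) / L" using L by (simp add: field_simps)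
    then have "x = y + of_int n * L" using L by simp
    then show ?thesis using D_int by simp
  qed
  \<comment> \<open>\<open>D\<close> as a function on the unit circle. Across the cut of \<open>Arg\<close> its continuity is seen from \<open>Arg2pi\<close>.\<close>
  define d where "d z = D (L * Arg z / (2 * pi))" for z
  have d_c: "d (c x) = D x" for x
  proof -
    have "c (L * Arg (c x) / (2 * pi)) = c x"
      using L cis_Arg[of "c x"] by (simp add: c_def sgn_eq)
    then show ?thesis unfolding d_def by (rule D_eq)
  qed
  have d_2pi: "d z = D (L * Arg2pi z / (2 * pi))" if "norm z = 1" for z
  proof -
    have "c (L * Arg2pi z / (2 * pi)) = z"
      using L Arg2pi_eq[of z] that by (simp add: c_def cis_conv_exp)
    then show ?thesis using d_c by metis
  qed
  have dcont: "continuous_on (sphere 0 1) d"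
    unfolding continuous_on_eq_continuous_within
  proof
    fix z :: complex assume z: "z \<in> sphere 0 1"
    have Dc: "isCont D t" for t using cont by (simp add: continuous_on_eq_continuous_at)
    show "continuous (at z within sphere 0 1) d"
    proof (cases "z \<in> \<real>\<^sub>\<le>\<^sub>0")
      case False
      then have "isCont Arg z" by (rule continuous_at_Arg)
      then have "isCont (\<lambda>z. L * Arg z / (2 * pi)) z" by (intro continuous_intros) auto
      from isCont_o2[OF this Dc] have "isCont d z" by (simp add: d_def[abs_def])
      then show ?thesis by (rule continuous_at_imp_continuous_at_within)
    next
      case True
      then have "z \<notin> \<real>\<^sub>\<ge>\<^sub>0" using z by (auto simp: complex_nonpos_Reals_iff complex_nonneg_Reals_iff cmod_def)
      then have "isCont Arg2pi z" by (rule continuous_at_Arg2pi)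
      then have "isCont (\<lambda>z. L * Arg2pi z / (2 * pi)) z" by (intro continuous_intros) auto
      from isCont_o2[OF this Dc] have "isCont (\<lambda>z. D (L * Arg2pi z / (2 * pi))) z" .
      then have "continuous (at z within sphere 0 1) (\<lambda>z. D (L * Arg2pi z / (2 * pi)))"
        by (rule continuous_at_imp_continuous_at_within)
      then show ?thesis
        by (rule continuous_transform_within[OF _ zero_less_one z]) (use d_2pi in auto)
    qed
  qed
  \<comment> \<open>\<open>D h\<close> has vanishing Fourier coefficients. This property is stable under multiplication of \<open>h\<close> by linear functions of \<open>cis\<close>, hence by polynomials.\<close>
  define V where "V h \<longleftrightarrow> continuous_on UNIV h \<and>
     (\<forall>n::int. integral {0..L} (\<lambda>x. D x * h x * cis (2 * pi * of_int n * x / L)) = 0)" for h :: "real \<Rightarrow> complex"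
  have ex: "continuous_on X (\<lambda>x. cis (2 * pi * of_int n * x / L))" for n :: int and X
    unfolding cis_conv_exp by (intro continuous_intros) (use L in auto)
  have ig: "(\<lambda>x. D x * h x * cis (2 * pi * of_int n * x / L)) integrable_on {0..L}"
    if "continuous_on UNIV h" for h n
    by (intro integrable_continuous_interval continuous_on_mult ex continuous_on_subset[OF cont] continuous_on_subset[OF that] subset_UNIV)
  have poly: "V h \<Longrightarrow> V (\<lambda>x. h x * of_real (p (c x)))" if "real_polynomial_function p" for p :: "complex \<Rightarrow> real" and h
    using that
  proof (induction p arbitrary: h rule: real_polynomial_function.induct)
    case (linear p)
    interpret p: bounded_linear p by fact
    define A B where "A = (of_real (p 1) - \<i> * of_real (p \<i>)) / 2" and "B = (of_real (p 1) + \<i> * of_real (p \<i>)) / 2"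
    have pc: "complex_of_real (p (c x)) = A * cis (2 * pi * x / L) + B * cis (- (2 * pi * x / L))" for x
    proof -
      have "c x = cos (2 * pi * x / L) *\<^sub>R 1 + sin (2 * pi * x / L) *\<^sub>R \<i>" by (simp add: c_def complex_eq_iff)
      then have "p (c x) = cos (2 * pi * x / L) * p 1 + sin (2 * pi * x / L) * p \<i>" by (simp add: p.add p.scaleR)
      then show ?thesis by (simp add: A_def B_def complex_eq_iff field_simps)
    qed
    have hc: "continuous_on UNIV h" using linear.prems by (simp add: V_def)
    have "integral {0..L} (\<lambda>x. D x * (h x * of_real (p (c x))) * cis (2 * pi * of_int n * x / L)) = 0" for n :: int
    proof -
      have "D x * (h x * of_real (p (c x))) * cis (2 * pi * of_int n * x / L)
        = A * (D x * h x * cis (2 * pi * of_int (n + 1) * x / L)) + B * (D x * h x * cis (2 * pi * of_int (n - 1) * x / L))" for x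
      proof -
        have "cis (2 * pi * of_int (n + 1) * x / L) = cis (2 * pi * of_int n * x / L) * cis (2 * pi * x / L)"
          "cis (2 * pi * of_int (n - 1) * x / L) = cis (2 * pi * of_int n * x / L) * cis (- (2 * pi * x / L))"
          by (simp_all add: cis_mult field_simps add_divide_distrib diff_divide_distrib)
        then show ?thesis unfolding pc by (simp add: algebra_simps)
      qed
      then have "integral {0..L} (\<lambda>x. D x * (h x * of_real (p (c x))) * cis (2 * pi * of_int n * x / L))
        = integral {0..L} (\<lambda>x. A * (D x * h x * cis (2 * pi * of_int (n + 1) * x / L))) + integral {0..L} (\<lambda>x. B * (D x * h x * cis (2 * pi * of_int (n - 1) * x / L)))"
        using ig[OF hc] by (subst Henstock_Kurzweil_Integration.integral_add[symmetric]) (auto intro!: integrable_on_mult_right simp del: of_int_add of_int_diff)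
      also have "\<dots> = A * 0 + B * 0"
        using linear.prems unfolding V_def by (simp del: of_int_add of_int_diff)
      finally show ?thesis by simp
    qed
    moreover have "continuous_on UNIV (\<lambda>x. h x * complex_of_real (p (c x)))"
      unfolding pc cis_conv_exp by (intro continuous_intros hc) (use L in auto)
    ultimately show ?case by (simp add: V_def)
  next
    case (const k)
    have "integral {0..L} (\<lambda>x. D x * (h x * of_real k) * cis (2 * pi * of_int n * x / L)) = of_real k * 0" for n :: int
    proof -
      have "integral {0..L} (\<lambda>x. of_real k * (D x * h x * cis (2 * pi * of_int n * x / L))) = of_real k * 0"
        using const unfolding V_def by simp
      then show ?thesis by (simp add: mult_ac)
    qed
    then show ?case using const by (auto simp: V_def intro!: continuous_intros)
  next
    case (add f g)
    have 1: "V (\<lambda>x. h x * of_real (f (c x)))" "V (\<lambda>x. h x * of_real (g (c x)))" using add by auto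
    have "integral {0..L} (\<lambda>x. D x * (h x * of_real (f (c x)) + h x * of_real (g (c x))) * cis (2 * pi * of_int n * x / L)) = 0 + 0" for n :: int
      using 1 ig unfolding V_def distrib_left distrib_right
      by (subst Henstock_Kurzweil_Integration.integral_add) auto
    then show ?case using 1 unfolding V_def by (auto simp: distrib_left intro!: continuous_on_add)
  next
    case (mult f g)
    have "V (\<lambda>x. h x * of_real (f (c x)) * of_real (g (c x)))" by (intro mult)
    then show ?case by (simp add: mult.assoc)
  qed
  have V1: "V (\<lambda>x. 1)" using coeff by (simp add: V_def)
  have ci: "(\<lambda>x. D x * h x) integrable_on {0..L}" if "continuous_on UNIV h" for h
    by (intro integrable_continuous_interval continuous_intros continuous_on_subset[OF cont] continuous_on_subset[OF that]) auto
  have orth: "integral {0..L} (\<lambda>x. D x * of_real (r (D x))) = 0"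
    if r: "continuous_on UNIV r" for r :: "complex \<Rightarrow> real"
  proof (rule eq_zero_if_norm_le)
    fix e :: real assume e: "e > 0"
    have "continuous_on (sphere 0 1) (\<lambda>z. r (d z))"
      by (rule continuous_on_compose2[OF r dcont]) auto
    from Stone_Weierstrass_real_polynomial_function[OF compact_sphere this e]
    obtain g where g: "real_polynomial_function g" "\<And>z. z \<in> sphere 0 1 \<Longrightarrow> \<bar>r (d z) - g z\<bar> < e" by blast
    have gV: "V (\<lambda>x. of_real (g (c x)))" using poly[OF g(1) V1] by simp
    then have g0: "integral {0..L} (\<lambda>x. D x * of_real (g (c x))) = 0"
      using V_def[of "\<lambda>x. of_real (g (c x))"] by (auto dest: spec[of _ 0])
    have gc: "continuous_on UNIV (\<lambda>x. complex_of_real (g (c x)))" using gV by (simp add: V_def)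
    have rc: "continuous_on UNIV (\<lambda>x. complex_of_real (r (D x)))"
      by (intro continuous_intros continuous_on_compose2[OF r cont]) auto
    have "integral {0..L} (\<lambda>x. D x * of_real (r (D x))) = integral {0..L} (\<lambda>x. D x * of_real (r (D x))) - integral {0..L} (\<lambda>x. D x * of_real (g (c x)))"
      using g0 by simp
    also have "\<dots> = integral {0..L} (\<lambda>x. D x * (of_real (r (D x)) - of_real (g (c x))))"
      unfolding right_diff_distrib by (rule Henstock_Kurzweil_Integration.integral_diff[symmetric]) (intro ci rc gc)+
    also have "norm \<dots> \<le> integral {0..L} (\<lambda>x. e * norm (D x))"
    proof (rule integral_norm_bound_integral)
      show "(\<lambda>x. D x * (of_real (r (D x)) - of_real (g (c x)))) integrable_on {0..L}"
        by (intro ci continuous_intros rc gc)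
      show "(\<lambda>x. e * norm (D x)) integrable_on {0..L}"
        by (intro integrable_continuous_interval continuous_intros continuous_on_subset[OF cont]) auto
      fix x
      have "c x \<in> sphere 0 1" by (simp add: c_def)
      from g(2)[OF this] have "\<bar>r (D x) - g (c x)\<bar> \<le> e" unfolding d_c by simp
      then have "norm (complex_of_real (r (D x)) - of_real (g (c x))) \<le> e"
        by (simp only: of_real_diff[symmetric] norm_of_real)
      then have "norm (D x) * norm (complex_of_real (r (D x)) - of_real (g (c x))) \<le> norm (D x) * e" by (rule mult_left_mono) simp
      then show "norm (D x * (of_real (r (D x)) - of_real (g (c x)))) \<le> e * norm (D x)" by (simp add: norm_mult mult.commute)
    qed
    finally show "norm (integral {0..L} (\<lambda>x. D x * of_real (r (D x)))) \<le> e * integral {0..L} (\<lambda>x. norm (D x))"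
      by (simp add: integral_mult_right)
  qed
  have rD: "continuous_on UNIV (\<lambda>x. complex_of_real (Re (D x)))" "continuous_on UNIV (\<lambda>x. complex_of_real (Im (D x)))"
    by (intro continuous_intros cont)+
  have "integral {0..L} (\<lambda>x. D x * of_real (Re (D x))) - \<i> * integral {0..L} (\<lambda>x. D x * of_real (Im (D x))) = 0"
    using orth[of Re] orth[of Im] by (simp add: continuous_on_Re continuous_on_Im continuous_on_id)
  also have "integral {0..L} (\<lambda>x. D x * of_real (Re (D x))) - \<i> * integral {0..L} (\<lambda>x. D x * of_real (Im (D x)))
     = integral {0..L} (\<lambda>x. D x * of_real (Re (D x)) - \<i> * (D x * of_real (Im (D x))))"
    unfolding integral_mult_right[symmetric]
    by (rule Henstock_Kurzweil_Integration.integral_diff[symmetric]) (auto intro!: ci rD integrable_on_mult_right)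
  also have "(\<lambda>x. D x * of_real (Re (D x)) - \<i> * (D x * of_real (Im (D x)))) = (\<lambda>x. of_real ((norm (D x))\<^sup>2))"
  proof (rule ext)
    fix x
    have "(norm (D x))\<^sup>2 = Re (D x) * Re (D x) + Im (D x) * Im (D x)"
      unfolding cmod_power2 by (simp add: power2_eq_square)
    then show "D x * of_real (Re (D x)) - \<i> * (D x * of_real (Im (D x))) = of_real ((norm (D x))\<^sup>2)"
      by (simp add: complex_eq_iff del: of_real_power)
  qed
  finally have "integral {0..L} (\<lambda>x. complex_of_real ((norm (D x))\<^sup>2)) = 0" .
  moreover have nint: "(\<lambda>x. (norm (D x))\<^sup>2) integrable_on {0..L}"
    by (intro integrable_continuous_interval continuous_intros continuous_on_subset[OF cont]) auto
  moreover have "integral {0..L} (complex_of_real \<circ> (\<lambda>x. (norm (D x))\<^sup>2)) = of_real (integral {0..L} (\<lambda>x. (norm (D x))\<^sup>2))"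
    by (rule integral_linear[OF nint bounded_linear_of_real])
  ultimately have "integral {0..L} (\<lambda>x. (norm (D x))\<^sup>2) = 0"
    by (simp add: o_def)
  moreover have "continuous_on {0..L} (\<lambda>x. (norm (D x))\<^sup>2)"
    by (intro continuous_intros continuous_on_subset[OF cont] subset_UNIV)
  ultimately have "\<forall>x\<in>{0..L}. (norm (D x))\<^sup>2 = 0"
    using integral_eq_0_iff[of 0 L "\<lambda>x. (norm (D x))\<^sup>2"] L by simp
  then have z: "D x = 0" if "x \<in> {0..L}" for x using that by simp
  define k where "k = \<lfloor>x / L\<rfloor>"
  have k: "of_int k \<le> x / L" "x / L < of_int k + 1" unfolding k_def by linarith+
  then have "of_int k * L \<le> x" "x < (of_int k + 1) * L" using L by (simp_all add: field_simps)
  then have "x - of_int k * L \<in> {0..L}" by (simp add: algebra_simps)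
  then have "D (x - of_int k * L) = 0" by (rule z)
  then show ?thesis using D_int[of "x - of_int k * L" k] by simp
qed

lemma infsum_int_decode:
  fixes f :: "int \<Rightarrow> complex"
  assumes "f abs_summable_on UNIV"
  shows "summable (\<lambda>i. norm (f (int_decode i)))" "infsum f UNIV = (\<Sum>i. f (int_decode i))"
proof -
  have b: "bij_betw int_decode UNIV UNIV" by (rule bij_int_decode)
  have "(\<lambda>i. norm (f (int_decode i))) summable_on UNIV"
    using assms by (subst summable_on_reindex_bij_betw[OF b])
  then show "summable (\<lambda>i. norm (f (int_decode i)))" by (rule summable_on_imp_summable)
  have "((\<lambda>i. f (int_decode i)) has_sum infsum f UNIV) UNIV"
    using has_sum_infsum[OF abs_summable_summable[OF assms]] by (subst has_sum_reindex_bij_betw[OF b])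
  then show "infsum f UNIV = (\<Sum>i. f (int_decode i))" using has_sum_imp_sums sums_unique by blast
qed

lemma integral_infsum_int:
  fixes f :: "int \<Rightarrow> 'x \<Rightarrow> complex"
  assumes f: "\<And>n. integrable M (f n)" and s: "\<And>x. (\<lambda>n. f n x) abs_summable_on UNIV"
    and i: "(\<lambda>n. \<integral>x. norm (f n x) \<partial>M) summable_on UNIV"
  shows "(\<integral>x. (\<Sum>\<^sub>\<infinity>n. f n x) \<partial>M) = (\<Sum>\<^sub>\<infinity>n. \<integral>x. f n x \<partial>M)"
proof -
  have b: "bij_betw int_decode UNIV UNIV" by (rule bij_int_decode)
  have i': "summable (\<lambda>i. \<integral>x. norm (f (int_decode i) x) \<partial>M)"
    using i by (subst (asm) summable_on_reindex_bij_betw[OF b, symmetric]) (rule summable_on_imp_summable)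
  have "(\<lambda>n. \<integral>x. f n x \<partial>M) abs_summable_on UNIV"
    by (rule Infinite_Sum.abs_summable_on_comparison_test[of "\<lambda>n. \<integral>x. norm (f n x) \<partial>M"])
       (use i integral_norm_bound in \<open>auto intro: order_trans\<close>)
  then have "(\<Sum>\<^sub>\<infinity>n. \<integral>x. f n x \<partial>M) = (\<Sum>i. \<integral>x. f (int_decode i) x \<partial>M)" by (rule infsum_int_decode)
  also have "\<dots> = (\<integral>x. (\<Sum>i. f (int_decode i) x) \<partial>M)"
    by (rule integral_suminf[symmetric]) (use f i' infsum_int_decode(1)[OF s] in auto)
  also have "\<dots> = (\<integral>x. (\<Sum>\<^sub>\<infinity>n. f n x) \<partial>M)"
    by (intro Bochner_Integration.integral_cong refl infsum_int_decode(2)[OF s, symmetric])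
  finally show ?thesis ..
qed

lemma floor_cell:
  fixes x L :: real
  assumes "L > 0"
  shows "x \<in> {of_int n * L..<(of_int n + 1) * L} \<longleftrightarrow> n = \<lfloor>x / L\<rfloor>"
proof -
  have "x \<in> {of_int n * L..<(of_int n + 1) * L} \<longleftrightarrow> of_int n \<le> x / L \<and> x / L < of_int n + 1"
    using assms by (simp add: field_simps)
  then show ?thesis using floor_eq_iff[of "x / L" n] by auto
qed

text \<open>The line is tiled by the translates of a period.\<close>

lemma fold_integral:
  fixes f :: "real \<Rightarrow> complex"
  assumes L: "L > 0" and f: "integrable lborel f"
    and s: "\<And>x. (\<lambda>n. f (x + of_int n * L)) abs_summable_on UNIV"
  shows "(\<integral>x. indicator {0..<L} x *\<^sub>R (\<Sum>\<^sub>\<infinity>n. f (x + of_int n * L)) \<partial>lborel) = (\<integral>x. f x \<partial>lborel)"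
proof -
  define cell where "cell n = {of_int n * L..<(of_int n + 1) * L}" for n :: int
  define g where "g n x = indicator (cell n) x *\<^sub>R f x" for n x
  define h where "h n x = indicator {0..<L} x *\<^sub>R f (x + of_int n * L)" for n :: int and x
  have gi: "integrable lborel (g n)" for n
    unfolding g_def cell_def by (intro integrable_mult_indicator f) auto
  have gx: "g n x = (if n = \<lfloor>x / L\<rfloor> then f x else 0)" for n x
    unfolding g_def cell_def using floor_cell[OF L, of x n] by (simp add: indicator_def)
  have gs: "(\<lambda>n. g n x) abs_summable_on UNIV" for x
  proof -
    have "(\<lambda>n. norm (g n x)) summable_on {\<lfloor>x / L\<rfloor>}" by simp
    then show ?thesis by (rule summable_on_cong_neutral[THEN iffD1, rotated -1]) (auto simp: gx)
  qed
  have gsum: "(\<Sum>\<^sub>\<infinity>n. g n x) = f x" for x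
  proof -
    have "(\<Sum>\<^sub>\<infinity>n. g n x) = (\<Sum>\<^sub>\<infinity>n\<in>{\<lfloor>x / L\<rfloor>}. g n x)" by (rule infsum_cong_neutral) (auto simp: gx)
    then show ?thesis by (simp add: gx)
  qed
  have gh: "g n (of_int n * L + 1 * x) = h n x" for n x
  proof -
    have "(of_int n * L + 1 * x \<in> cell n) = (x \<in> {0..<L})" by (auto simp: cell_def algebra_simps)
    then show ?thesis by (simp add: g_def h_def indicator_def add.commute)
  qed
  have hi: "integrable lborel (h n)" for n
    using lborel_integrable_real_affine[OF gi[of n], of 1 "of_int n * L"] unfolding gh by simp
  have hint: "(\<integral>x. h n x \<partial>lborel) = (\<integral>x. g n x \<partial>lborel)" for n
    using lborel_integral_real_affine[of 1 "g n" "of_int n * L"] unfolding gh by simp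
  have hnorm: "(\<integral>x. norm (h n x) \<partial>lborel) = (\<integral>x. norm (g n x) \<partial>lborel)" for n
    using lborel_integral_real_affine[of 1 "\<lambda>x. norm (g n x)" "of_int n * L"] unfolding gh by simp
  have gsi: "(\<lambda>n. \<integral>x. norm (g n x) \<partial>lborel) summable_on UNIV"
  proof (rule nonneg_bdd_above_summable_on)
    show "bdd_above (sum (\<lambda>n. \<integral>x. norm (g n x) \<partial>lborel) ` {F. F \<subseteq> UNIV \<and> finite F})"
    proof (rule bdd_aboveI2)
      fix F :: "int set" assume "F \<in> {F. F \<subseteq> UNIV \<and> finite F}"
      then have F: "finite F" by simp
      have "(\<Sum>n\<in>F. \<integral>x. norm (g n x) \<partial>lborel) = (\<integral>x. (\<Sum>n\<in>F. norm (g n x)) \<partial>lborel)"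
        by (rule Bochner_Integration.integral_sum[symmetric]) (intro integrable_norm gi)
      also have "\<dots> \<le> (\<integral>x. norm (f x) \<partial>lborel)"
      proof (rule integral_mono)
        show "integrable lborel (\<lambda>x. \<Sum>n\<in>F. norm (g n x))" by (intro Bochner_Integration.integrable_sum integrable_norm gi)
        show "(\<Sum>n\<in>F. norm (g n x)) \<le> norm (f x)" for x
          using F by (simp add: gx if_distrib cong: if_cong)
      qed (use f in auto)
      finally show "(\<Sum>n\<in>F. \<integral>x. norm (g n x) \<partial>lborel) \<le> (\<integral>x. norm (f x) \<partial>lborel)" .
    qed
  qed simp
  have hs: "(\<lambda>n. h n x) abs_summable_on UNIV" for x
    using summable_on_cmult_right[OF s[of x], of "\<bar>indicator {0..<L} x\<bar>"] by (simp add: h_def)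
  have "(\<integral>x. f x \<partial>lborel) = (\<Sum>\<^sub>\<infinity>n. \<integral>x. g n x \<partial>lborel)"
    using integral_infsum_int[OF gi gs gsi] by (simp add: gsum)
  also have "\<dots> = (\<Sum>\<^sub>\<infinity>n. \<integral>x. h n x \<partial>lborel)" unfolding hint ..
  also have "\<dots> = (\<integral>x. (\<Sum>\<^sub>\<infinity>n. h n x) \<partial>lborel)"
    by (rule integral_infsum_int[symmetric]) (use hi hs gsi hnorm in auto)
  also have "\<dots> = (\<integral>x. indicator {0..<L} x *\<^sub>R (\<Sum>\<^sub>\<infinity>n. f (x + of_int n * L)) \<partial>lborel)"
    by (intro Bochner_Integration.integral_cong refl) (simp add: h_def infsum_scaleR_right)
  finally show ?thesis ..
qed

lemma integrable_period:
  fixes h :: "real \<Rightarrow> complex"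
  assumes "continuous_on {0..L} h"
  shows "integrable lborel (\<lambda>x. indicator {0..L} x *\<^sub>R h x)" "integrable lborel (\<lambda>x. indicator {0..<L} x *\<^sub>R h x)"
proof -
  show i: "integrable lborel (\<lambda>x. indicator {0..L} x *\<^sub>R h x)"
    by (rule borel_integrable_compact) (use assms in auto)
  have "set_integrable lborel {0..<L} h"
    by (rule set_integrable_subset[of lborel "{0..L}"]) (use i in \<open>auto simp: set_integrable_def\<close>)
  then show "integrable lborel (\<lambda>x. indicator {0..<L} x *\<^sub>R h x)" by (simp add: set_integrable_def)
qed

lemma integral_period_eq:
  fixes h :: "real \<Rightarrow> complex"
  assumes "continuous_on {0..L} h"
  shows "(\<integral>x. indicator {0..<L} x *\<^sub>R h x \<partial>lborel) = integral {0..L} h"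
proof -
  note i = integrable_period[OF assms]
  have "AE x in lborel. indicator {0..<L} x *\<^sub>R h x = indicator {0..L} x *\<^sub>R h x"
    using AE_lborel_singleton[of L] by eventually_elim (auto simp: indicator_def)
  moreover note i[THEN borel_measurable_integrable]
  ultimately have "(\<integral>x. indicator {0..<L} x *\<^sub>R h x \<partial>lborel) = (\<integral>x. indicator {0..L} x *\<^sub>R h x \<partial>lborel)"
    by (intro integral_cong_AE) auto
  also have "\<dots> = integral {0..L} h"
    using set_borel_integral_eq_integral(2)[of "{0..L}" h] i(1) by (simp add: set_lebesgue_integral_def set_integrable_def)
  finally show ?thesis .
qed

lemma gaussian_fourier:
  assumes s: "s > 0"
  shows "(\<integral>x. of_real (normal_density m s x) * cis (t * x) \<partial>lborel) = cis (t * m) * of_real (exp (- ((t * s)\<^sup>2 / 2)))"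
proof -
  have nd: "normal_density m s (m + s * x) = std_normal_density x / s" for x
    using s by (simp add: normal_density_def power_mult_distrib real_sqrt_mult)
  have "(\<integral>x. of_real (normal_density m s x) * cis (t * x) \<partial>lborel)
    = \<bar>s\<bar> *\<^sub>R (\<integral>x. of_real (normal_density m s (m + s * x)) * cis (t * (m + s * x)) \<partial>lborel)"
    by (rule lborel_integral_real_affine) (use s in simp)
  also have "(\<integral>x. of_real (normal_density m s (m + s * x)) * cis (t * (m + s * x)) \<partial>lborel)
    = (\<integral>x. (cis (t * m) / of_real s) * (of_real (std_normal_density x) * iexp (t * s * x)) \<partial>lborel)"
    unfolding nd by (intro Bochner_Integration.integral_cong refl)
       (simp add: cis_conv_exp exp_add distrib_left mult_ac)
  also have "\<dots> = (cis (t * m) / of_real s) * (\<integral>x. of_real (std_normal_density x) * iexp (t * s * x) \<partial>lborel)"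
    by (rule integral_mult_right_zero)
  also have "(\<integral>x. of_real (std_normal_density x) * iexp (t * s * x) \<partial>lborel) = char std_normal_distribution (t * s)"
    unfolding char_def by (subst integral_density) (auto simp: scaleR_conv_of_real)
  also have "\<dots> = of_real (exp (- ((t * s)\<^sup>2) / 2))" unfolding char_std_normal_distribution ..
  finally show ?thesis using s by (simp add: scaleR_conv_of_real)
qed

lemma fourier_coefficient_of_series:
  fixes b :: "int \<Rightarrow> complex"
  assumes L: "L > 0" and b: "b abs_summable_on UNIV"
  shows "(\<integral>x. indicator {0..<L} x *\<^sub>R ((\<Sum>\<^sub>\<infinity>k. b k * cis (2 * pi * of_int k * x / L)) * cis (2 * pi * of_int n * x / L)) \<partial>lborel)
    = of_real L * b (- n)"
proof -
  define f where "f k x = indicator {0..<L} x *\<^sub>R (b k * cis (2 * pi * of_int k * x / L) * cis (2 * pi * of_int n * x / L))" for k :: int and x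
  have f_eq: "f k x = b k * (indicator {0..<L} x *\<^sub>R cis (2 * pi * of_int (k + n) * x / L))" for k x
    by (simp add: f_def cis_mult add_divide_distrib algebra_simps)
  have ccont: "continuous_on X (\<lambda>x. cis (2 * pi * of_int k * x / L))" for k :: int and X
    unfolding cis_conv_exp by (intro continuous_intros) (use L in auto)
  have ii: "integrable lborel (\<lambda>x. indicator {0..<L} x *\<^sub>R cis (2 * pi * of_int k * x / L))" for k :: int
    by (rule integrable_period(2)[OF ccont])
  have int: "(\<integral>x. indicator {0..<L} x *\<^sub>R cis (2 * pi * of_int k * x / L) \<partial>lborel) = (if k = 0 then of_real L else 0)" for k :: int
  proof (cases "k = 0")
    case True
    then show ?thesis unfolding integral_period_eq[OF ccont] using L by (simp add: scaleR_conv_of_real)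
  next
    case False
    define c where "c = \<i> * of_real (2 * pi * of_int k / L)"
    have c: "c \<noteq> 0" using False L by (simp add: c_def)
    have e: "cis (2 * pi * of_int k * x / L) = exp (c * of_real x)" for x
      by (simp add: cis_conv_exp c_def mult_ac)
    have "((\<lambda>x. exp (c * of_real x)) has_integral exp (c * of_real L) / c - exp (c * of_real 0) / c) {0..L}"
    proof (rule fundamental_theorem_of_calculus)
      show "((\<lambda>x. exp (c * of_real x) / c) has_vector_derivative exp (c * of_real x)) (at x within {0..L})" for x
      proof -
        have "((\<lambda>w. exp (c * w) / c) has_field_derivative exp (c * of_real x)) (at (of_real x))"
          using c by (auto intro!: derivative_eq_intros)
        from has_vector_derivative_real_field[OF this] show ?thesis by simp
      qed
    qed (use L in simp)
    moreover have "exp (c * of_real L) = 1"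
      using L unfolding e[symmetric] by simp
    ultimately have "((\<lambda>x. exp (c * of_real x)) has_integral 0) {0..L}" by simp
    then show ?thesis unfolding integral_period_eq[OF ccont] unfolding e using False by (simp add: integral_unique)
  qed
  have fi: "integrable lborel (f k)" for k unfolding f_eq by (intro integrable_mult_right ii)
  have fint: "(\<integral>x. f k x \<partial>lborel) = b k * (if k + n = 0 then of_real L else 0)" for k
    unfolding f_eq integral_mult_right_zero int ..
  have fs: "(\<lambda>k. f k x) abs_summable_on UNIV" for x
    using summable_on_cmult_right[OF b, of "indicator {0..<L} x"] by (simp add: f_def norm_mult mult.commute)
  have "(\<integral>x. norm (f k x) \<partial>lborel) = norm (b k) * (\<integral>x. indicator {0..<L} x \<partial>lborel)" for k
    unfolding f_eq by (simp add: norm_mult)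
  then have fsi: "(\<lambda>k. \<integral>x. norm (f k x) \<partial>lborel) summable_on UNIV"
    using summable_on_cmult_left[OF b, of "\<integral>x. indicator {0..<L} x \<partial>lborel"] by simp
  have "(\<integral>x. (\<Sum>\<^sub>\<infinity>k. f k x) \<partial>lborel) = (\<Sum>\<^sub>\<infinity>k. b k * (if k + n = 0 then of_real L else 0))"
    using integral_infsum_int[OF fi fs fsi] unfolding fint .
  also have "\<dots> = (\<Sum>\<^sub>\<infinity>k\<in>{- n}. b k * (if k + n = 0 then of_real L else 0))"
    by (rule infsum_cong_neutral) auto
  finally have "(\<integral>x. (\<Sum>\<^sub>\<infinity>k. f k x) \<partial>lborel) = of_real L * b (- n)" by simp
  moreover have "(\<Sum>\<^sub>\<infinity>k. f k x) = indicator {0..<L} x *\<^sub>R ((\<Sum>\<^sub>\<infinity>k. b k * cis (2 * pi * of_int k * x / L)) * cis (2 * pi * of_int n * x / L))" for x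
    unfolding f_def by (simp add: infsum_scaleR_right infsum_cmult_left')
  ultimately show ?thesis by simp
qed

section \<open>Jacobi's imaginary transformation\<close>

text \<open>The dual theta function \<open>\<Sum> (-1)\<^sup>k qhat\<^bsup>k\<^sup>2\<^esup> exp(2 \<pi> \<i> k w / \<alpha>)\<close> with
  \<open>\<alpha> = - ln q\<close>, that is, Jacobi's \<open>\<theta>\<^sub>4(\<pi> w / \<alpha>)\<close> of nome \<open>qhat\<close>, written as a product. The
  half period added to \<open>w\<close> produces the sign.\<close>

definition theta_hat :: "real \<Rightarrow> complex \<Rightarrow> complex" where
  "theta_hat q w = theta_q ((qhat q)\<^sup>2) (of_real (qhat q) * exp (2 * of_real pi * \<i> * (w + of_real (- ln q / 2)) / of_real (- ln q)))"

lemma qhat_bounds: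
  assumes "0 < q" "q < 1"
  shows "0 < qhat q" "qhat q < 1" "0 < (qhat q)\<^sup>2" "(qhat q)\<^sup>2 < 1"
proof -
  show 1: "0 < qhat q" by (simp add: qhat_def)
  show 2: "qhat q < 1" using assms by (simp add: qhat_def divide_neg_neg divide_pos_neg)
  show "0 < (qhat q)\<^sup>2" using 1 by simp
  show "(qhat q)\<^sup>2 < 1" using 1 2 by (simp add: power_less_one_iff)
qed

lemma theta_q_exp_holomorphic:
  assumes q: "0 < q" "q < 1" and g: "g holomorphic_on S"
  shows "(\<lambda>w. theta_q q (exp (g w))) holomorphic_on S"
proof -
  have p: "norm (complex_of_real q) < 1" using q by simp
  have comp: "(\<lambda>w. qpoch_inf (h w) (complex_of_real q)) holomorphic_on S" if "h holomorphic_on S" for h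
    using holomorphic_on_compose_gen[OF that qpoch_inf_holomorphic[OF p, of UNIV]] by (simp add: o_def)
  show ?thesis unfolding theta_q_def by (intro holomorphic_on_mult comp holomorphic_intros g) auto
qed

text \<open>Completing the square: the translates of a Gaussian are the terms of the theta series.\<close>

lemma gaussian_int_shift:
  assumes q: "0 < q" "q < 1" and alpha: "\<alpha> = - ln q"
  shows "gaussian \<alpha> (w + of_int n * of_real \<alpha>) = gaussian \<alpha> w * (of_real (tri q (- n)) * exp w powi (- n))"
proof -
  have a: "\<alpha> > 0" using q alpha by simp
  have q_eq: "q = exp (- \<alpha>)" using q alpha by simp
  define T where "T = (- n) * (- n - 1) div 2"
  have T: "2 * real_of_int T = of_int n * of_int n + of_int n"
  proof -
    have "2 * T = n * n + n" unfolding T_def double_triangular by (simp add: algebra_simps)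
    then show ?thesis by (metis of_int_add of_int_mult of_int_numeral)
  qed
  have tri: "tri q (- n) = exp (- \<alpha> * of_int T)"
    unfolding tri_def T_def q_eq by (simp add: exp_power_int mult.commute)
  have tri_c: "complex_of_real (tri q (- n)) = exp (- of_real \<alpha> * of_int T)"
    unfolding tri by (simp add: exp_of_real[symmetric])
  have pw: "exp w powi (- n) = exp (- of_int n * w)" by (simp add: exp_power_int)
  have T': "complex_of_int T = (of_int n * of_int n + of_int n) / 2"
  proof -
    have "complex_of_real (2 * real_of_int T) = complex_of_real (of_int n * of_int n + of_int n)" unfolding T ..
    then show ?thesis by (simp add: eq_divide_eq mult.commute)
  qed
  have "- ((w + of_int n * of_real \<alpha> + of_real (\<alpha> / 2))\<^sup>2) / of_real (2 * \<alpha>)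
    = - ((w + of_real (\<alpha> / 2))\<^sup>2) / of_real (2 * \<alpha>) + (- of_real \<alpha> * of_int T + - of_int n * w)"
    unfolding T' using a by (simp add: field_simps power2_eq_square)
  then have "exp (- ((w + of_int n * of_real \<alpha> + of_real (\<alpha> / 2))\<^sup>2) / of_real (2 * \<alpha>))
    = exp (- ((w + of_real (\<alpha> / 2))\<^sup>2) / of_real (2 * \<alpha>)) * (exp (- of_real \<alpha> * of_int T) * exp (- of_int n * w))"
    unfolding exp_add[symmetric] by simp
  then show ?thesis unfolding gaussian_def tri_c pw by simp
qed

lemma gaussian_translates:
  assumes q: "0 < q" "q < 1" and alpha: "\<alpha> = - ln q"
  shows "(\<lambda>n. gaussian \<alpha> (w + of_int n * of_real \<alpha>)) abs_summable_on UNIV"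
    and "(\<Sum>\<^sub>\<infinity>n. gaussian \<alpha> (w + of_int n * of_real \<alpha>)) = gaussian \<alpha> w * theta_q q (exp w)"
proof -
  have b: "bij_betw uminus (UNIV :: int set) UNIV" by (rule bij_uminus)
  have s: "(\<lambda>n. of_real (tri q n) * exp w powi n) abs_summable_on UNIV" by (rule summable_tri[OF q])
  then have "(\<lambda>n. of_real (tri q (- n)) * exp w powi (- n)) abs_summable_on UNIV"
    by (subst summable_on_reindex_bij_betw[OF b, where f = "\<lambda>n. norm (complex_of_real (tri q n) * exp w powi n)"])
  from summable_on_cmult_right[OF this, of "norm (gaussian \<alpha> w)"]
  show "(\<lambda>n. gaussian \<alpha> (w + of_int n * of_real \<alpha>)) abs_summable_on UNIV"
    unfolding gaussian_int_shift[OF assms] by (simp only: norm_mult)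
  have "(\<Sum>\<^sub>\<infinity>n. gaussian \<alpha> (w + of_int n * of_real \<alpha>)) = gaussian \<alpha> w * (\<Sum>\<^sub>\<infinity>n. of_real (tri q (- n)) * exp w powi (- n))"
    unfolding gaussian_int_shift[OF assms] by (rule infsum_cmult_right')
  also have "(\<Sum>\<^sub>\<infinity>n. of_real (tri q (- n)) * exp w powi (- n)) = theta_q q (exp w)"
    unfolding theta_q_eq_series[OF q exp_not_eq_zero] theta_series_def
    by (rule infsum_reindex_bij_betw[OF b])
  finally show "(\<Sum>\<^sub>\<infinity>n. gaussian \<alpha> (w + of_int n * of_real \<alpha>)) = gaussian \<alpha> w * theta_q q (exp w)" .
qed

lemma theta_hat_series:
  assumes q: "0 < q" "q < 1" and alpha: "\<alpha> = - ln q"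
  shows "(\<lambda>k. of_real (qhat q powi (k * k)) * cis (pi * of_int k)) abs_summable_on UNIV"
    and "theta_hat q (of_real x) = (\<Sum>\<^sub>\<infinity>k. (of_real (qhat q powi (k * k)) * cis (pi * of_int k)) * cis (2 * pi * of_int k * x / \<alpha>))"
proof -
  have a: "\<alpha> > 0" using q alpha by simp
  note qh = qhat_bounds[OF q]
  have tq: "tri ((qhat q)\<^sup>2) k * qhat q powi k = qhat q powi (k * k)" for k
  proof -
    have "tri ((qhat q)\<^sup>2) k = qhat q powi (2 * (k * (k - 1) div 2))"
      unfolding tri_def by (simp only: power_int_mult power_int_numeral)
    also have "2 * (k * (k - 1) div 2) = k * k - k" unfolding double_triangular by (simp add: algebra_simps)
    finally show ?thesis using qh by (simp add: power_int_diff)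
  qed
  have "(\<lambda>k. of_real (tri ((qhat q)\<^sup>2) k) * (complex_of_real (qhat q)) powi k) abs_summable_on UNIV"
    by (rule summable_tri[OF qh(3,4)])
  then show "(\<lambda>k. of_real (qhat q powi (k * k)) * cis (pi * of_int k)) abs_summable_on UNIV"
    unfolding tq[symmetric] by (simp add: norm_mult norm_power_int)
  define y where "y = exp (2 * of_real pi * \<i> * (of_real x + of_real (\<alpha> / 2)) / of_real \<alpha>)"
  have y: "y = cis (2 * pi * x / \<alpha> + pi)"
    unfolding y_def cis_conv_exp using a by (intro arg_cong[of _ _ exp]) (simp add: field_simps)
  have yk: "y powi k = cis (pi * of_int k) * cis (2 * pi * of_int k * x / \<alpha>)" for k
    unfolding y cis_power_int cis_mult by (simp add: algebra_simps)
  have "theta_hat q (of_real x) = theta_series ((qhat q)\<^sup>2) (of_real (qhat q) * y)"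
    unfolding theta_hat_def y_def alpha using qh by (intro theta_q_eq_series) auto
  also have "\<dots> = (\<Sum>\<^sub>\<infinity>k. (of_real (qhat q powi (k * k)) * cis (pi * of_int k)) * cis (2 * pi * of_int k * x / \<alpha>))"
    unfolding theta_series_def power_int_mult_distrib yk tq[symmetric] by (simp add: mult_ac)
  finally show "theta_hat q (of_real x) = \<dots>" .
qed

lemma theta_hat_holomorphic:
  assumes q: "0 < q" "q < 1"
  shows "theta_hat q holomorphic_on S"
proof -
  note qh = qhat_bounds[OF q]
  have e: "of_real (qhat q) * exp w = exp (of_real (ln (qhat q)) + w)" for w :: complex
    using qh by (simp add: exp_add exp_of_real)
  have "(\<lambda>w. theta_q ((qhat q)\<^sup>2) (exp (of_real (ln (qhat q)) + 2 * of_real pi * \<i> * (w + of_real (- ln q / 2)) / of_real (- ln q)))) holomorphic_on S"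
    by (intro theta_q_exp_holomorphic[OF qh(3,4)] holomorphic_intros) (use q in auto)
  then show ?thesis unfolding theta_hat_def[abs_def] e .
qed

text \<open>Poisson summation. The left-hand side is \<open>\<alpha>\<close> times the sum of all translates of the Gaussian
  by multiples of \<open>\<alpha>\<close>, so its Fourier coefficients are values of the Fourier transform of the
  Gaussian, and these are the coefficients of the dual theta series.\<close>

lemma theta_modular_real:
  assumes q: "0 < q" "q < 1" and alpha: "\<alpha> = - ln q"
  shows "of_real \<alpha> * (gaussian \<alpha> (of_real x) * theta_q q (exp (of_real x))) = theta_hat q (of_real x)"
proof -
  have a: "\<alpha> > 0" using q alpha by simp
  define A where "A x = gaussian \<alpha> (of_real x) * theta_q q (exp (of_real x))" for x :: real
  define D where "D x = of_real \<alpha> * A x - theta_hat q (of_real x)" for x :: real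
  have Ahol: "(\<lambda>w. gaussian \<alpha> w * theta_q q (exp w)) holomorphic_on UNIV"
    by (intro holomorphic_intros theta_q_exp_holomorphic[OF q] a)
  have Acont: "continuous_on X A" for X
    unfolding A_def[abs_def]
    by (rule continuous_on_compose2[OF holomorphic_on_imp_continuous_on[OF Ahol]]) (auto intro!: continuous_intros)
  have Tcont: "continuous_on X (\<lambda>x::real. theta_hat q (of_real x))" for X
    by (rule continuous_on_compose2[OF holomorphic_on_imp_continuous_on[OF theta_hat_holomorphic[OF q, of UNIV]]])
       (auto intro!: continuous_intros)
  have "D x = 0"
  proof (rule fourier_uniqueness[OF a])
    show "continuous_on UNIV D" unfolding D_def by (intro continuous_intros Acont Tcont)
    show "D (x + \<alpha>) = D x" for x
    proof -
      have "gaussian \<alpha> (of_real (x + \<alpha>)) = gaussian \<alpha> (of_real x) * (of_real q * exp (- of_real x))"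
        using gaussian_shift[OF a, of "of_real x"] q by (simp add: alpha)
      moreover have "theta_q q (exp (of_real (x + \<alpha>))) = exp (of_real x) / of_real q * theta_q q (exp (of_real x))"
      proof -
        have e: "exp (complex_of_real (x + \<alpha>)) = exp (of_real x) / of_real q"
          using q by (simp add: alpha exp_diff exp_of_real)
        have "exp (complex_of_real x) / of_real q \<noteq> 0" using q by simp
        from theta_q_step[OF q this] show ?thesis unfolding e using q by simp
      qed
      moreover have "theta_hat q (of_real (x + \<alpha>)) = theta_hat q (of_real x)"
      proof -
        have "cis (2 * pi * of_int k * (x + \<alpha>) / \<alpha>) = cis (2 * pi * of_int k * x / \<alpha>)" for k :: int
        proof -
          have "2 * pi * of_int k * (x + \<alpha>) / \<alpha> = 2 * pi * of_int k * x / \<alpha> + 2 * pi * of_int k"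
            using a by (simp add: field_simps)
          then show ?thesis by (simp add: cis_mult[symmetric] cis_multiple_2pi)
        qed
        then show ?thesis unfolding theta_hat_series(2)[OF assms] by simp
      qed
      ultimately show ?thesis using q by (simp add: D_def A_def exp_minus)
    qed
    fix n :: int
    have ccont: "continuous_on X (\<lambda>x. cis (2 * pi * of_int n * x / \<alpha>))" for X
      unfolding cis_conv_exp by (intro continuous_intros) (use a in auto)
    have cA: "continuous_on {0..\<alpha>} (\<lambda>x. A x * cis (2 * pi * of_int n * x / \<alpha>))"
      and cT: "continuous_on {0..\<alpha>} (\<lambda>x. theta_hat q (of_real x) * cis (2 * pi * of_int n * x / \<alpha>))"
      by (intro continuous_intros Acont Tcont ccont)+
    define t where "t = 2 * pi * of_int n / \<alpha>"
    define f where "f x = gaussian \<alpha> (of_real x) * cis (t * x)" for x :: real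
    have f_shift: "f (x + of_int m * \<alpha>) = gaussian \<alpha> (of_real x + of_int m * of_real \<alpha>) * cis (2 * pi * of_int n * x / \<alpha>)" for x and m :: int
    proof -
      have "t * (x + of_int m * \<alpha>) = 2 * pi * of_int n * x / \<alpha> + 2 * pi * of_int (n * m)"
        using a by (simp add: t_def field_simps)
      then show ?thesis by (simp add: f_def cis_mult[symmetric] cis_multiple_2pi del: of_int_mult)
    qed
    have fint: "integrable lborel f"
    proof (rule Bochner_Integration.integrable_bound)
      show "integrable lborel (normal_density (- \<alpha> / 2) (sqrt \<alpha>))" using a by simp
      show "f \<in> borel_measurable lborel"
      proof -
        have "continuous_on UNIV f" unfolding f_def[abs_def] gaussian_of_real[OF a] cis_conv_exp normal_density_def
          by (intro continuous_intros) (use a in auto)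
        then show ?thesis using borel_measurable_continuous_onI by simp
      qed
    qed (simp add: f_def gaussian_of_real[OF a] norm_mult)
    have fs: "(\<lambda>m. f (x + of_int m * \<alpha>)) abs_summable_on UNIV" for x
      unfolding f_shift norm_mult using gaussian_translates(1)[OF assms, of "of_real x"] by simp
    have "integral {0..\<alpha>} (\<lambda>x. A x * cis (2 * pi * of_int n * x / \<alpha>)) = (\<integral>x. indicator {0..<\<alpha>} x *\<^sub>R (A x * cis (2 * pi * of_int n * x / \<alpha>)) \<partial>lborel)"
      by (rule integral_period_eq[OF cA, symmetric])
    also have "\<dots> = (\<integral>x. indicator {0..<\<alpha>} x *\<^sub>R (\<Sum>\<^sub>\<infinity>m. f (x + of_int m * \<alpha>)) \<partial>lborel)"
      unfolding f_shift infsum_cmult_left' gaussian_translates(2)[OF assms] A_def ..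
    also have "\<dots> = (\<integral>x. f x \<partial>lborel)" by (rule fold_integral[OF a fint fs])
    also have "\<dots> = cis (t * (- \<alpha> / 2)) * of_real (exp (- ((t * sqrt \<alpha>)\<^sup>2 / 2)))"
      unfolding f_def gaussian_of_real[OF a] by (rule gaussian_fourier) (use a in simp)
    also have "t * (- \<alpha> / 2) = pi * of_int (- n)" using a by (simp add: t_def)
    also have "exp (- ((t * sqrt \<alpha>)\<^sup>2 / 2)) = qhat q powi (n * n)"
    proof -
      have "- ((t * sqrt \<alpha>)\<^sup>2 / 2) = of_int (n * n) * (2 * pi\<^sup>2 / ln q)"
        using a q by (simp add: t_def power_mult_distrib power_divide alpha power2_eq_square field_simps)
      then show ?thesis unfolding qhat_def exp_power_int by simp
    qed
    finally have 1: "integral {0..\<alpha>} (\<lambda>x. A x * cis (2 * pi * of_int n * x / \<alpha>)) = cis (pi * of_int (- n)) * of_real (qhat q powi (n * n))" .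
    have "integral {0..\<alpha>} (\<lambda>x. theta_hat q (of_real x) * cis (2 * pi * of_int n * x / \<alpha>))
       = (\<integral>x. indicator {0..<\<alpha>} x *\<^sub>R (theta_hat q (of_real x) * cis (2 * pi * of_int n * x / \<alpha>)) \<partial>lborel)"
      by (rule integral_period_eq[OF cT, symmetric])
    also have "\<dots> = of_real \<alpha> * (of_real (qhat q powi (- n * - n)) * cis (pi * of_int (- n)))"
      unfolding theta_hat_series(2)[OF assms]
      by (rule fourier_coefficient_of_series[OF a theta_hat_series(1)[OF assms]])
    finally have 2: "integral {0..\<alpha>} (\<lambda>x. theta_hat q (of_real x) * cis (2 * pi * of_int n * x / \<alpha>)) = \<dots>" .
    have "integral {0..\<alpha>} (\<lambda>x. D x * cis (2 * pi * of_int n * x / \<alpha>))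
      = integral {0..\<alpha>} (\<lambda>x. of_real \<alpha> * (A x * cis (2 * pi * of_int n * x / \<alpha>)) - theta_hat q (of_real x) * cis (2 * pi * of_int n * x / \<alpha>))"
      by (simp add: D_def algebra_simps)
    also have "\<dots> = of_real \<alpha> * integral {0..\<alpha>} (\<lambda>x. A x * cis (2 * pi * of_int n * x / \<alpha>))
       - integral {0..\<alpha>} (\<lambda>x. theta_hat q (of_real x) * cis (2 * pi * of_int n * x / \<alpha>))"
      unfolding integral_mult_right[symmetric]
      by (rule Henstock_Kurzweil_Integration.integral_diff)
         (intro integrable_on_mult_right integrable_continuous_interval cA cT)+
    finally show "integral {0..\<alpha>} (\<lambda>x. D x * cis (2 * pi * of_int n * x / \<alpha>)) = 0"
      unfolding 1 2 by (simp add: mult_ac)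
  qed
  then show ?thesis by (simp add: D_def A_def)
qed

text \<open>Jacobi's imaginary transformation: both sides are entire and agree on the real line.\<close>

theorem theta_modular:
  assumes q: "0 < q" "q < 1" and alpha: "\<alpha> = - ln q"
  shows "of_real \<alpha> * (gaussian \<alpha> w * theta_q q (exp w)) = theta_hat q w"
proof -
  have a: "\<alpha> > 0" using q alpha by simp
  define f where "f w = of_real \<alpha> * (gaussian \<alpha> w * theta_q q (exp w)) - theta_hat q w" for w
  have "f w = 0"
  proof (rule analytic_continuation[of f UNIV "range complex_of_real" 0])
    show "f holomorphic_on UNIV" unfolding f_def
      by (intro holomorphic_intros theta_q_exp_holomorphic[OF q] theta_hat_holomorphic[OF q] a)
    show "0 islimpt range complex_of_real"
      unfolding islimpt_approachable
    proof (intro allI impI)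
      fix e :: real assume "e > 0"
      then show "\<exists>x'\<in>range complex_of_real. x' \<noteq> 0 \<and> dist x' 0 < e"
        by (intro bexI[OF _ rangeI[of complex_of_real "e / 2"]]) auto
    qed
    show "f z = 0" if "z \<in> range complex_of_real" for z
      using that theta_modular_real[OF assms] by (auto simp: f_def)
  qed auto
  then show ?thesis by (simp add: f_def)
qed

section \<open>A lower bound for the dual theta function\<close>

text \<open>By \<open>|1 + w| \<ge> 1 - |w|\<close> the worst point on a circle \<open>|x| = r\<close> is \<open>-r\<close>. Pairing the factors
  of the two products, the dependence on \<open>r\<close> is through \<open>r + Q / r\<close> only, which is largest at
  the ends of the annulus.\<close>

lemma theta_q_lower_bound:
  assumes Q: "0 < Q" "Q < 1" and s: "0 < s" "s < 1" "Q / s < 1"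
    and x: "s \<le> norm x" "norm x \<le> Q / s"
  shows "qpoch_inf Q Q * (qpoch_inf s Q * qpoch_inf (Q / s) Q) \<le> norm (theta_q Q x)"
proof -
  let ?p = "complex_of_real Q"
  define r where "r = norm x"
  have r: "0 < r" "s \<le> r" "r \<le> Q / s" "r < 1" using x s order_le_less_trans[OF x(2) s(3)] by (auto simp: r_def)
  have p: "norm ?p < 1" "norm Q < 1" using Q by auto
  have rQ: "Q / r \<le> Q / s" using r s Q by (intro divide_left_mono) auto
  have sum_le: "r + Q / r \<le> s + Q / s"
  proof -
    have "(r - s) * (r - Q / s) \<le> 0" using r by (intro mult_nonneg_nonpos) auto
    moreover have "(r - s) * (r - t) = r * r + s * t - r * (s + t)" for t by (simp add: algebra_simps)
    ultimately have "r * r + Q \<le> r * (s + Q / s)" using s by simp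
    then have "(r * r + Q) / r \<le> s + Q / s" using r by (simp add: pos_divide_le_eq mult.commute)
    then show ?thesis using r by (simp add: add_divide_distrib)
  qed
  have "qpoch_inf s Q * qpoch_inf (Q / s) Q \<le> norm (qpoch_inf (- x) ?p) * norm (qpoch_inf (- ?p / x) ?p)"
  proof (rule LIMSEQ_le)
    show "(\<lambda>n. (\<Prod>i<n. 1 - s * Q ^ i) * (\<Prod>i<n. 1 - Q / s * Q ^ i)) \<longlonglongrightarrow> qpoch_inf s Q * qpoch_inf (Q / s) Q"
      by (intro tendsto_mult qpoch_inf_LIMSEQ p)
    show "(\<lambda>n. norm (\<Prod>i<n. 1 - (- x) * ?p ^ i) * norm (\<Prod>i<n. 1 - (- ?p / x) * ?p ^ i))
        \<longlonglongrightarrow> norm (qpoch_inf (- x) ?p) * norm (qpoch_inf (- ?p / x) ?p)"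
      by (intro tendsto_mult tendsto_norm qpoch_inf_LIMSEQ p)
    have "(\<Prod>i<n. 1 - s * Q ^ i) * (\<Prod>i<n. 1 - Q / s * Q ^ i) \<le> norm (\<Prod>i<n. 1 - (- x) * ?p ^ i) * norm (\<Prod>i<n. 1 - (- ?p / x) * ?p ^ i)" for n
      unfolding prod_norm[symmetric] prod.distrib[symmetric]
    proof (intro prod_mono conjI)
      fix i
      have R: "0 < Q ^ i" "Q ^ i \<le> 1" using Q by (auto intro: power_le_one)
      have le1: "a * Q ^ i < 1" if "0 < a" "a < 1" for a
      proof -
        have "a * Q ^ i \<le> a" by (rule mult_left_le) (use R that in auto)
        then show ?thesis using that by linarith
      qed
      have nn: "0 < Q / s" "0 < Q / r" using Q s r by auto
      have prod2: "(1 - u * Q ^ i) * (1 - v * Q ^ i) = 1 - Q ^ i * (u + v) + u * v * (Q ^ i)\<^sup>2" for u v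
        by (simp add: algebra_simps power2_eq_square)
      show "0 \<le> (1 - s * Q ^ i) * (1 - Q / s * Q ^ i)"
        using le1[OF s(1,2)] le1[OF nn(1) s(3)] by (intro mult_nonneg_nonneg) auto
      have "(1 - s * Q ^ i) * (1 - Q / s * Q ^ i) = 1 - Q ^ i * (s + Q / s) + Q * (Q ^ i)\<^sup>2"
        unfolding prod2 using s by simp
      also have "\<dots> \<le> 1 - Q ^ i * (r + Q / r) + Q * (Q ^ i)\<^sup>2"
        using mult_left_mono[OF sum_le, of "Q ^ i"] R by simp
      also have "\<dots> = (1 - r * Q ^ i) * (1 - Q / r * Q ^ i)"
        unfolding prod2 using r by simp
      also have "\<dots> \<le> norm (1 - (- x) * ?p ^ i) * norm (1 - (- ?p / x) * ?p ^ i)"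
      proof (intro mult_mono)
        show "1 - r * Q ^ i \<le> norm (1 - (- x) * ?p ^ i)"
          using norm_triangle_ineq2[of 1 "(- x) * ?p ^ i"] Q by (simp add: r_def norm_mult norm_power)
        show "1 - Q / r * Q ^ i \<le> norm (1 - (- ?p / x) * ?p ^ i)"
          using norm_triangle_ineq2[of 1 "(- ?p / x) * ?p ^ i"] Q by (simp add: r_def norm_mult norm_power norm_divide)
        show "0 \<le> 1 - Q / r * Q ^ i" using le1[OF nn(2)] rQ s by fastforce
      qed auto
      finally show "(1 - s * Q ^ i) * (1 - Q / s * Q ^ i) \<le> norm (1 - (- x) * ?p ^ i) * norm (1 - (- ?p / x) * ?p ^ i)" .
    qed
    then show "\<exists>N. \<forall>n\<ge>N. (\<Prod>i<n. 1 - s * Q ^ i) * (\<Prod>i<n. 1 - Q / s * Q ^ i) \<le> norm (\<Prod>i<n. 1 - (- x) * ?p ^ i) * norm (\<Prod>i<n. 1 - (- ?p / x) * ?p ^ i)"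
      by blast
  qed
  moreover have "norm (qpoch_inf ?p ?p) = qpoch_inf Q Q"
    using Q qpoch_inf_pos[of Q Q] by (simp add: qpoch_inf_of_real)
  ultimately show ?thesis using qpoch_inf_pos[of Q Q] Q unfolding theta_q_def norm_mult
    by (simp add: mult.assoc mult_left_mono)
qed

text \<open>The strip \<open>|Im w| \<le> Y\<close> is mapped to the annulus \<open>qhat / \<rho> \<le> |x| \<le> qhat \<rho>\<close>; it avoids the zeros
  of the theta function of base \<open>qhat\<^sup>2\<close> because \<open>qhat \<rho> < 1\<close> for \<open>Y < \<pi>\<close>.\<close>

lemma theta_hat_lower_bound:
  assumes q: "0 < q" "q < 1" and alpha: "\<alpha> = - ln q" and Y: "0 \<le> Y" "Y < pi" and w: "\<bar>Im w\<bar> \<le> Y"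
    and rho: "\<rho> = exp (2 * pi * Y / \<alpha>)"
  shows "qpoch_inf ((qhat q)\<^sup>2) ((qhat q)\<^sup>2) * (qpoch_inf (qhat q / \<rho>) ((qhat q)\<^sup>2) * qpoch_inf (qhat q * \<rho>) ((qhat q)\<^sup>2)) \<le> norm (theta_hat q w)"
    and "qhat q * \<rho> < 1" "1 \<le> \<rho>"
proof -
  have a: "\<alpha> > 0" using q alpha by simp
  note qh = qhat_bounds[OF q]
  have lq: "ln q = - \<alpha>" using alpha by simp
  show rho1: "1 \<le> \<rho>" using Y a by (simp add: rho)
  have qr: "qhat q * \<rho> = exp (2 * pi * (Y - pi) / \<alpha>)"
    unfolding qhat_def rho lq exp_add[symmetric] by (simp add: diff_divide_distrib algebra_simps power2_eq_square)
  show qr1: "qhat q * \<rho> < 1" unfolding qr using Y a by (simp add: divide_neg_pos mult_pos_neg)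
  define x where "x = of_real (qhat q) * exp (2 * of_real pi * \<i> * (w + of_real (- ln q / 2)) / of_real (- ln q))"
  have "Re (2 * of_real pi * \<i> * (w + of_real (- ln q / 2)) / of_real (- ln q)) = - (2 * pi * Im w / \<alpha>)"
    unfolding alpha[symmetric] Re_divide_of_real by simp
  then have nx: "norm x = qhat q * exp (- (2 * pi * Im w / \<alpha>))"
    using qh unfolding x_def norm_mult norm_exp_eq_Re by simp
  have up: "exp (- (2 * pi * Im w / \<alpha>)) \<le> \<rho>" and lo: "1 / \<rho> \<le> exp (- (2 * pi * Im w / \<alpha>))"
  proof -
    have i: "Im w \<le> Y" "- Im w \<le> Y" using w by auto
    have "2 * pi * (- Im w) / \<alpha> \<le> 2 * pi * Y / \<alpha>" using i a by (intro divide_right_mono mult_left_mono) auto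
    then show "exp (- (2 * pi * Im w / \<alpha>)) \<le> \<rho>" unfolding rho by simp
    have "2 * pi * Im w / \<alpha> \<le> 2 * pi * Y / \<alpha>" using i a by (intro divide_right_mono mult_left_mono) auto
    then have "exp (- (2 * pi * Y / \<alpha>)) \<le> exp (- (2 * pi * Im w / \<alpha>))" by simp
    then show "1 / \<rho> \<le> exp (- (2 * pi * Im w / \<alpha>))" unfolding rho by (simp add: exp_minus divide_inverse)
  qed
  have e: "(qhat q)\<^sup>2 / (qhat q / \<rho>) = qhat q * \<rho>" using qh by (simp add: power2_eq_square)
  have r0: "0 < \<rho>" using rho1 by simp
  have "qhat q / \<rho> \<le> qhat q / 1" using qh rho1 by (intro divide_left_mono) auto
  then have s1: "qhat q / \<rho> < 1" using qh by simp
  have lo': "qhat q / \<rho> \<le> norm x" unfolding nx using mult_left_mono[OF lo, of "qhat q"] qh by simp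
  have up': "norm x \<le> qhat q * \<rho>" unfolding nx using mult_left_mono[OF up, of "qhat q"] qh by simp
  have "qpoch_inf ((qhat q)\<^sup>2) ((qhat q)\<^sup>2) * (qpoch_inf (qhat q / \<rho>) ((qhat q)\<^sup>2) * qpoch_inf ((qhat q)\<^sup>2 / (qhat q / \<rho>)) ((qhat q)\<^sup>2)) \<le> norm (theta_q ((qhat q)\<^sup>2) x)"
    by (rule theta_q_lower_bound) (use qh r0 s1 qr1 lo' up' e in auto)
  then show "qpoch_inf ((qhat q)\<^sup>2) ((qhat q)\<^sup>2) * (qpoch_inf (qhat q / \<rho>) ((qhat q)\<^sup>2) * qpoch_inf (qhat q * \<rho>) ((qhat q)\<^sup>2)) \<le> norm (theta_hat q w)"
    unfolding e theta_hat_def x_def .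
qed

text \<open>The arithmetic-geometric mean inequality for a geometric progression.\<close>

lemma geometric_sum_ge_middle:
  fixes p :: real
  assumes "0 \<le> p"
  shows "real (2 * m + 1) * p ^ m \<le> (\<Sum>i<2 * m + 1. p ^ i)"
proof (induction m)
  case (Suc m)
  have "2 * m + 2 = Suc m + Suc m" by simp
  then have e: "p ^ (2 * m + 2) = p ^ Suc m * p ^ Suc m" by (simp only: power_add)
  have sq: "2 * p ^ Suc m \<le> 1 + p ^ (2 * m + 2)"
    unfolding e using zero_le_power2[of "1 - p ^ Suc m"] by (simp only: power2_eq_square) (simp add: algebra_simps)
  have "real (2 * Suc m + 1) * p ^ Suc m = p * (real (2 * m + 1) * p ^ m) + 2 * p ^ Suc m"
    by (simp add: algebra_simps)
  also have "\<dots> \<le> p * (\<Sum>i<2 * m + 1. p ^ i) + (1 + p ^ (2 * m + 2))"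
    using Suc assms sq by (intro add_mono mult_left_mono) auto
  also have "\<dots> = (\<Sum>i<2 * Suc m + 1. p ^ i)"
  proof -
    have "(\<Sum>i<2 * Suc m + 1. p ^ i) = (\<Sum>i<Suc (2 * m + 1). p ^ i) + p ^ (2 * m + 2)" by simp
    also have "(\<Sum>i<Suc (2 * m + 1). p ^ i) = 1 + (\<Sum>i<2 * m + 1. p ^ Suc i)"
      by (subst sum.lessThan_Suc_shift) simp
    also have "(\<Sum>i<2 * m + 1. p ^ Suc i) = p * (\<Sum>i<2 * m + 1. p ^ i)" by (simp only: sum_distrib_left power_Suc)
    finally show ?thesis by simp
  qed
  finally show ?case .
qed simp

text \<open>\<open>(1 - p\<^bsup>n+1\<^esup>) (1 - p\<^bsup>n-1\<^esup>) = (1 - p\<^sup>n)\<^sup>2 - p\<^bsup>n-1\<^esup> (1 - p)\<^sup>2\<close>, and for \<open>n = 4 k\<close> the mean inequality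
  compares \<open>p\<^bsup>n-2\<^esup> (1 - p)\<^sup>2\<close> with \<open>(1 - p\<^sup>n)\<^sup>2\<close>.\<close>

lemma paired_factor_bound:
  fixes p :: real
  assumes p: "0 < p" "p < 1" and k: "k \<ge> 1"
  shows "(1 - p ^ (4 * k))\<^sup>2 * (1 - p / (4 * real k - 1)\<^sup>2) \<le> (1 - p ^ (4 * k + 1)) * (1 - p ^ (4 * k - 1))"
proof -
  define m where "m = 2 * k - 1"
  have m: "4 * k - 1 = 2 * m + 1" "4 * k = 2 * m + 2" "real (2 * m + 1) = 4 * real k - 1" using k by (auto simp: m_def)
  have "(1 - p) * (real (2 * m + 1) * p ^ m) \<le> (1 - p) * (\<Sum>i<2 * m + 1. p ^ i)"
    using p by (intro mult_left_mono geometric_sum_ge_middle) auto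
  also have "\<dots> = 1 - p ^ (2 * m + 1)" by (rule one_diff_power_eq[symmetric])
  also have "\<dots> \<le> 1 - p ^ (2 * m + 2)" using p by (simp add: power_decreasing)
  finally have "((1 - p) * (real (2 * m + 1) * p ^ m))\<^sup>2 \<le> (1 - p ^ (2 * m + 2))\<^sup>2"
    using p by (intro power_mono) auto
  then have "(1 - p)\<^sup>2 * p ^ (2 * m) * (real (2 * m + 1))\<^sup>2 \<le> (1 - p ^ (2 * m + 2))\<^sup>2"
    unfolding power_even_eq power_mult_distrib by (simp only: mult_ac)
  then have "(1 - p)\<^sup>2 * p ^ (2 * m) \<le> (1 - p ^ (2 * m + 2))\<^sup>2 / (real (2 * m + 1))\<^sup>2"
    by (subst pos_le_divide_eq) auto
  then have "p * ((1 - p)\<^sup>2 * p ^ (2 * m)) \<le> p * ((1 - p ^ (2 * m + 2))\<^sup>2 / (real (2 * m + 1))\<^sup>2)"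
    using p by (intro mult_left_mono) auto
  moreover have "(1 - p ^ (4 * k + 1)) * (1 - p ^ (4 * k - 1)) = (1 - p ^ (2 * m + 2))\<^sup>2 - p * ((1 - p)\<^sup>2 * p ^ (2 * m))"
  proof -
    define y where "y = p ^ (2 * m)"
    have y: "p ^ (2 * m + 2 + 1) = y * (p * p * p)" "p ^ (2 * m + 1) = y * p" "p ^ (2 * m + 2) = y * (p * p)" "p ^ (2 * m) = y"
      by (simp_all only: y_def power_add power2_eq_square power_one_right mult.assoc)
    have "(1 - y * (p * p * p)) * (1 - y * p) = (1 - y * (p * p))\<^sup>2 - p * ((1 - p)\<^sup>2 * y)"
      by (simp add: power2_eq_square algebra_simps)
    then show ?thesis unfolding m(1) unfolding m(2) by (simp only: y)
  qed
  ultimately show ?thesis unfolding m(3) unfolding m(1)[symmetric] m(2)[symmetric] by (simp add: right_diff_distrib mult.commute)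
qed

lemma inverse_square_sum_bound:
  "(\<Sum>k=1..n. 1 / (4 * real k - 1)\<^sup>2) \<le> 1 / 2 - 1 / (2 * (real n + 1))"
proof (induction n)
  case (Suc n)
  have "2 * (real n + 1) * (real n + 2) \<le> (4 * real (Suc n) - 1)\<^sup>2"
    by (simp add: power2_eq_square algebra_simps)
  then have "1 / (4 * real (Suc n) - 1)\<^sup>2 \<le> 1 / (2 * (real n + 1) * (real n + 2))"
    by (intro divide_left_mono) auto
  also have "\<dots> = 1 / (2 * (real n + 1)) - 1 / (2 * (real n + 2))"
    by (simp add: divide_simps)
  finally have step: "1 / (4 * real (Suc n) - 1)\<^sup>2 \<le> 1 / (2 * (real n + 1)) - 1 / (2 * (real n + 2))" .
  have "(\<Sum>k=1..Suc n. 1 / (4 * real k - 1)\<^sup>2) = (\<Sum>k=1..n. 1 / (4 * real k - 1)\<^sup>2) + 1 / (4 * real (Suc n) - 1)\<^sup>2"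
    by simp
  moreover have "2 * (real (Suc n) + 1) = 2 * (real n + 2)" by simp
  ultimately show ?case using step Suc by (simp only:)
qed simp

text \<open>With \<open>p\<^sup>2 = qhat\<close> the right-hand side is the lower bound of the dual theta function on the strip of
  half-width \<open>\<pi>/2\<close>. Split off the factor \<open>1 - p\<close> and pair the remaining factors of exponents
  \<open>4 k - 1\<close> and \<open>4 k + 1\<close>. Compared with \<open>(1 - p\<^bsup>4k\<^esup>)\<^sup>2\<close> each pair loses at most the proportion
  \<open>p / (4 k - 1)\<^sup>2\<close>, in total at most \<open>p / 2\<close>, and \<open>(1 - p / 2) (1 + p) \<ge> 1\<close>.\<close>

lemma dual_theta_constant:
  fixes p :: real
  assumes p: "0 < p" "p < 1"
  shows "qpoch_inf (p ^ 4) (p ^ 4) ^ 3 * ((1 - p) / (1 + p))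
     \<le> qpoch_inf (p ^ 4) (p ^ 4) * (qpoch_inf (p ^ 3) (p ^ 4) * qpoch_inf p (p ^ 4))"
proof -
  define Q where "Q = p ^ 4"
  have Q: "0 < Q" "Q < 1" using p by (auto simp: Q_def power_less_one_iff)
  have Qn: "norm Q < 1" using Q by simp
  have key: "(1 - p / 2) * (\<Prod>i<n. 1 - Q * Q ^ i)\<^sup>2 \<le> (\<Prod>i<n. 1 - (p * Q) * Q ^ i) * (\<Prod>i<n. 1 - p ^ 3 * Q ^ i)" for n
  proof -
    have "(1 - p * (\<Sum>k=1..n. 1 / (4 * real k - 1)\<^sup>2)) * (\<Prod>i<n. 1 - Q * Q ^ i)\<^sup>2
        \<le> (\<Prod>i<n. 1 - (p * Q) * Q ^ i) * (\<Prod>i<n. 1 - p ^ 3 * Q ^ i)"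
    proof (induction n)
      case (Suc n)
      define S where "S = (\<Sum>k=1..n. 1 / (4 * real k - 1)\<^sup>2)"
      define P where "P = (\<Prod>i<n. 1 - Q * Q ^ i)\<^sup>2"
      define W where "W = (\<Prod>i<n. 1 - (p * Q) * Q ^ i) * (\<Prod>i<n. 1 - p ^ 3 * Q ^ i)"
      define e where "e = 1 / (4 * real (Suc n) - 1)\<^sup>2"
      have "0 \<le> 1 / (2 * (real n + 1))" by simp
      then have S2: "S \<le> 1 / 2" unfolding S_def using inverse_square_sum_bound[of n] by linarith
      have S1: "0 \<le> S" unfolding S_def by (intro sum_nonneg) simp
      note S = S1 S2
      have e0: "0 \<le> e" by (simp add: e_def)
      have e1: "e \<le> 1" unfolding e_def by (simp add: divide_le_eq power2_eq_square algebra_simps)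
      have IH: "(1 - p * S) * P \<le> W" using Suc by (simp add: S_def P_def W_def)
      have t: "(1 - Q * Q ^ n)\<^sup>2 * (1 - p * e) \<le> (1 - p * Q * Q ^ n) * (1 - p ^ 3 * Q ^ n)"
      proof -
        have "p ^ (4 * Suc n) = Q * Q ^ n" "p ^ (4 * Suc n + 1) = p * Q * Q ^ n" "p ^ (4 * Suc n - 1) = p ^ 3 * Q ^ n"
        proof -
          show e: "p ^ (4 * Suc n) = Q * Q ^ n" by (simp only: Q_def power_mult power_Suc)
          show "p ^ (4 * Suc n + 1) = p * Q * Q ^ n" unfolding power_add e by (simp only: power_one_right mult_ac)
          have "4 * Suc n - 1 = 3 + 4 * n" by simp
          then show "p ^ (4 * Suc n - 1) = p ^ 3 * Q ^ n" by (simp only: Q_def power_add power_mult)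
        qed
        then show ?thesis using paired_factor_bound[OF p, of "Suc n"] by (simp add: e_def)
      qed
      have pS: "p * S \<le> 1" "p * e \<le> 1" "0 \<le> p * S" "0 \<le> p * e"
        using p S e0 e1 by (auto intro!: mult_le_one)
      have "(1 - p * (S + e)) \<le> (1 - p * S) * (1 - p * e)"
        using mult_nonneg_nonneg[OF pS(3,4)] by (simp add: algebra_simps)
      then have "(1 - p * (S + e)) * (P * (1 - Q * Q ^ n)\<^sup>2) \<le> (1 - p * S) * (1 - p * e) * (P * (1 - Q * Q ^ n)\<^sup>2)"
        by (intro mult_right_mono) (auto simp: P_def)
      also have "\<dots> = ((1 - p * S) * P) * ((1 - Q * Q ^ n)\<^sup>2 * (1 - p * e))" by (simp only: mult_ac)
      also have "\<dots> \<le> W * ((1 - p * Q * Q ^ n) * (1 - p ^ 3 * Q ^ n))"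
      proof (rule mult_mono[OF IH t])
        have "0 \<le> (1 - p * S) * P" using pS by (simp add: P_def)
        then show "0 \<le> W" using IH by linarith
        show "0 \<le> (1 - Q * Q ^ n)\<^sup>2 * (1 - p * e)" using pS by simp
      qed
      finally show ?case by (simp add: S_def P_def W_def e_def power_mult_distrib mult_ac)
    qed simp
    moreover have "(1 - p / 2) \<le> 1 - p * (\<Sum>k=1..n. 1 / (4 * real k - 1)\<^sup>2)"
    proof -
      have "(\<Sum>k=1..n. 1 / (4 * real k - 1)\<^sup>2) \<le> 1 / 2"
        using inverse_square_sum_bound[of n] by (rule order_trans) simp
      from mult_left_mono[OF this, of p] show ?thesis using p by simp
    qed
    then have "(1 - p / 2) * (\<Prod>i<n. 1 - Q * Q ^ i)\<^sup>2 \<le> (1 - p * (\<Sum>k=1..n. 1 / (4 * real k - 1)\<^sup>2)) * (\<Prod>i<n. 1 - Q * Q ^ i)\<^sup>2"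
      by (rule mult_right_mono) simp
    ultimately show ?thesis by linarith
  qed
  have lim: "(1 - p / 2) * (qpoch_inf Q Q)\<^sup>2 \<le> qpoch_inf (p * Q) Q * qpoch_inf (p ^ 3) Q"
  proof (rule LIMSEQ_le)
    show "(\<lambda>n. (1 - p / 2) * (\<Prod>i<n. 1 - Q * Q ^ i)\<^sup>2) \<longlonglongrightarrow> (1 - p / 2) * (qpoch_inf Q Q)\<^sup>2"
      by (intro tendsto_intros qpoch_inf_LIMSEQ Qn)
    show "(\<lambda>n. (\<Prod>i<n. 1 - (p * Q) * Q ^ i) * (\<Prod>i<n. 1 - p ^ 3 * Q ^ i)) \<longlonglongrightarrow> qpoch_inf (p * Q) Q * qpoch_inf (p ^ 3) Q"
      by (intro tendsto_intros qpoch_inf_LIMSEQ Qn)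
  qed (use key in blast)
  have "p * p \<le> p * 1" using p by (intro mult_left_mono) auto
  then have "1 \<le> (1 + p) * (1 - p / 2)" by (simp add: algebra_simps)
  then have "1 / (1 + p) \<le> 1 - p / 2" using p by (simp add: divide_le_eq mult.commute)
  then have "1 / (1 + p) * (qpoch_inf Q Q)\<^sup>2 \<le> (1 - p / 2) * (qpoch_inf Q Q)\<^sup>2" by (rule mult_right_mono) simp
  also note lim
  finally have "(1 - p) * (1 / (1 + p) * (qpoch_inf Q Q)\<^sup>2) \<le> (1 - p) * (qpoch_inf (p * Q) Q * qpoch_inf (p ^ 3) Q)"
    using p by (intro mult_left_mono) auto
  also have "\<dots> = qpoch_inf (p ^ 3) Q * qpoch_inf p Q"
    using qpoch_inf_step[OF Qn, of p] by simp
  finally have "qpoch_inf Q Q * ((1 - p) * (1 / (1 + p) * (qpoch_inf Q Q)\<^sup>2)) \<le> qpoch_inf Q Q * (qpoch_inf (p ^ 3) Q * qpoch_inf p Q)"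
    using qpoch_inf_pos[of Q Q] Q by (intro mult_left_mono) auto
  moreover have "qpoch_inf Q Q * ((1 - p) * (1 / (1 + p) * (qpoch_inf Q Q)\<^sup>2)) = qpoch_inf Q Q ^ 3 * ((1 - p) / (1 + p))"
    by (simp add: power2_eq_square power3_eq_cube)
  ultimately show ?thesis unfolding Q_def by (simp only:)
qed

lemma theta_hat_lower_bound_half:
  assumes q: "0 < q" "q < 1" and w: "\<bar>Im w\<bar> \<le> pi / 2"
  shows "qpoch_inf ((qhat q)\<^sup>2) ((qhat q)\<^sup>2) ^ 3 * ((1 - sqrt (qhat q)) / (1 + sqrt (qhat q))) \<le> norm (theta_hat q w)"
proof -
  define p where "p = sqrt (qhat q)"
  note qh = qhat_bounds[OF q]
  have p: "0 < p" "p < 1" using qh by (auto simp: p_def)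
  have pq: "qhat q = p\<^sup>2" using qh by (simp add: p_def)
  have pp: "p = exp (pi\<^sup>2 / ln q)"
  proof -
    have "qhat q = exp (2 * (pi\<^sup>2 / ln q))" by (simp add: qhat_def)
    then have "p = sqrt ((exp (pi\<^sup>2 / ln q))\<^sup>2)" unfolding p_def by (simp only: exp_double)
    then show ?thesis by simp
  qed
  have r: "exp (2 * pi * (pi / 2) / (- ln q)) = 1 / p"
  proof -
    have "2 * pi * (pi / 2) / (- ln q) = - (pi\<^sup>2 / ln q)" by (simp add: power2_eq_square)
    then show ?thesis unfolding pp by (simp only: exp_minus inverse_eq_divide)
  qed
  have "qpoch_inf ((qhat q)\<^sup>2) ((qhat q)\<^sup>2) * (qpoch_inf (qhat q / (1 / p)) ((qhat q)\<^sup>2) * qpoch_inf (qhat q * (1 / p)) ((qhat q)\<^sup>2)) \<le> norm (theta_hat q w)"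
    by (rule theta_hat_lower_bound(1)[OF q refl _ _ w r[symmetric]]) auto
  moreover have "(qhat q)\<^sup>2 = p ^ 4" "qhat q / (1 / p) = p ^ 3" "qhat q * (1 / p) = p"
    using p by (simp_all add: pq power2_eq_square eval_nat_numeral)
  ultimately have "qpoch_inf (p ^ 4) (p ^ 4) * (qpoch_inf (p ^ 3) (p ^ 4) * qpoch_inf p (p ^ 4)) \<le> norm (theta_hat q w)" by simp
  with dual_theta_constant[OF p] have "qpoch_inf (p ^ 4) (p ^ 4) ^ 3 * ((1 - p) / (1 + p)) \<le> norm (theta_hat q w)" by linarith
  then show ?thesis using \<open>(qhat q)\<^sup>2 = p ^ 4\<close> by (simp add: p_def)
qed

lemma theta_hat_nonzero:
  assumes q: "0 < q" "q < 1" and w: "- pi < Im w" "Im w < pi"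
  shows "theta_hat q w \<noteq> 0"
proof -
  note qh = qhat_bounds[OF q]
  have y: "0 \<le> \<bar>Im w\<bar>" "\<bar>Im w\<bar> < pi" using w by auto
  note lb = theta_hat_lower_bound[OF q refl y order_refl refl]
  define r where "r = exp (2 * pi * \<bar>Im w\<bar> / - ln q)"
  have "1 \<le> r" "qhat q * r < 1" using lb(2,3) by (simp_all add: r_def)
  moreover have "qhat q / r \<le> qhat q / 1" using qh \<open>1 \<le> r\<close> by (intro divide_left_mono) auto
  ultimately have "0 < qpoch_inf ((qhat q)\<^sup>2) ((qhat q)\<^sup>2) * (qpoch_inf (qhat q / r) ((qhat q)\<^sup>2) * qpoch_inf (qhat q * r) ((qhat q)\<^sup>2))"
    using qh by (intro mult_pos_pos qpoch_inf_pos) auto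
  then show ?thesis using lb(1) unfolding r_def by auto
qed

lemma theta_q_of_real_pos:
  assumes q: "0 < q" "q < 1" and s: "s > 0"
  shows "\<exists>v>0. theta_q q (of_real s) = of_real v"
proof (intro exI conjI)
  have "- complex_of_real q / of_real s = of_real (- q / s)" by simp
  then show "theta_q q (of_real s) = of_real (qpoch_inf q q * qpoch_inf (- s) q * qpoch_inf (- q / s) q)"
    unfolding theta_q_def using q by (simp only: of_real_minus[symmetric] of_real_mult) (simp add: qpoch_inf_of_real del: of_real_minus of_real_divide)
  have "- q / s < 1" using q s by (simp add: divide_neg_pos order_less_trans[of _ 0])
  then show "0 < qpoch_inf q q * qpoch_inf (- s) q * qpoch_inf (- q / s) q"
    using q s by (intro mult_pos_pos qpoch_inf_pos) auto
qed

lemma strip_factor_one: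
  assumes q: "0 < q" "q < 1" and alpha: "\<alpha> = - ln q"
  shows "strip_factor q \<alpha> (\<lambda>w. 1)"
proof
  show "0 < q" "q < 1" "\<alpha> = - ln q" by fact+
  have a: "\<alpha> > 0" using q alpha by simp
  show "\<exists>C\<ge>0. \<forall>w. \<bar>Im w\<bar> \<le> Y \<longrightarrow> norm (1::complex) \<le> C" for Y by (intro exI[of _ 1]) auto
  show "(\<integral>x. gaussian \<alpha> (of_real x) * 1 \<partial>lborel) = 1"
    unfolding gaussian_of_real[OF a] mult_1_right using a by (simp add: integral_complex_of_real)
qed auto

text \<open>Total mass \<open>1\<close>: folded to one period, the Gaussian sums to \<open>theta_hat / \<alpha>\<close>, which the factor
  \<open>1 / theta_hat\<close> cancels.\<close>

lemma strip_factor_theta: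
  assumes q: "0 < q" "q < 1" and alpha: "\<alpha> = - ln q"
  shows "strip_factor q \<alpha> (\<lambda>w. 1 / theta_hat q w)"
proof
  show "0 < q" "q < 1" "\<alpha> = - ln q" by fact+
  have a: "\<alpha> > 0" using q alpha by simp
  note qh = qhat_bounds[OF q]
  show hol: "(\<lambda>w. 1 / theta_hat q w) holomorphic_on {w. - pi < Im w \<and> Im w < pi}"
    by (intro holomorphic_intros theta_hat_holomorphic[OF q]) (use theta_hat_nonzero[OF q] in auto)
  show per: "1 / theta_hat q (w + of_real \<alpha>) = 1 / theta_hat q w" for w
  proof -
    have "2 * of_real pi * \<i> * (w + of_real \<alpha> + of_real (- ln q / 2)) / of_real (- ln q)
       = 2 * of_real pi * \<i> * (w + of_real (- ln q / 2)) / of_real (- ln q) + 2 * of_real pi * \<i>"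
      unfolding alpha[symmetric] using a by (simp add: field_simps)
    then show ?thesis unfolding theta_hat_def by (simp only: exp_add exp_two_pi_i mult_1_right)
  qed
  show bdd: "\<exists>C\<ge>0. \<forall>w. \<bar>Im w\<bar> \<le> Y \<longrightarrow> norm (1 / theta_hat q w) \<le> C" if Y: "0 \<le> Y" "Y < pi" for Y
  proof -
    define r where "r = exp (2 * pi * Y / - ln q)"
    define lb where "lb = qpoch_inf ((qhat q)\<^sup>2) ((qhat q)\<^sup>2) * (qpoch_inf (qhat q / r) ((qhat q)\<^sup>2) * qpoch_inf (qhat q * r) ((qhat q)\<^sup>2))"
    have r: "1 \<le> r" "qhat q * r < 1"
      using theta_hat_lower_bound(2,3)[OF q refl Y, of 0 r] Y by (auto simp: r_def)
    have "qhat q / r \<le> qhat q / 1" using qh r by (intro divide_left_mono) auto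
    then have lb0: "0 < lb" unfolding lb_def
      using qh r by (intro mult_pos_pos qpoch_inf_pos) auto
    have "norm (1 / theta_hat q w) \<le> 1 / lb" if w: "\<bar>Im w\<bar> \<le> Y" for w
    proof -
      have "lb \<le> norm (theta_hat q w)" unfolding lb_def
        by (rule theta_hat_lower_bound(1)[OF q refl Y w]) (simp add: r_def)
      then have "1 / norm (theta_hat q w) \<le> 1 / lb" using lb0 by (intro divide_left_mono mult_pos_pos) linarith+
      then show ?thesis by (simp add: norm_divide)
    qed
    then show ?thesis using lb0 by (intro exI[of _ "1 / lb"]) auto
  qed
  show "(\<integral>x. gaussian \<alpha> (of_real x) * (1 / theta_hat q (of_real x)) \<partial>lborel) = 1"
  proof -
    define f where "f x = gaussian \<alpha> (of_real x) * (1 / theta_hat q (of_real x))" for x :: real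
    obtain C where C: "C \<ge> 0" "\<And>w. \<bar>Im w\<bar> \<le> 0 \<Longrightarrow> norm (1 / theta_hat q w) \<le> C" using bdd[of 0] by auto
    have th: "theta_hat q (of_real (x + of_int n * \<alpha>)) = theta_hat q (of_real x)" for x and n :: int
    proof (induction n rule: int_induct[where k = 0])
      case (step1 i)
      have "theta_hat q (of_real (x + of_int i * \<alpha>) + of_real \<alpha>) = theta_hat q (of_real (x + of_int i * \<alpha>))"
        using per by (metis div_by_1 divide_divide_eq_right mult_1)
      then show ?case using step1 by (simp add: algebra_simps)
    next
      case (step2 i)
      have "theta_hat q (of_real (x + of_int (i - 1) * \<alpha>) + of_real \<alpha>) = theta_hat q (of_real (x + of_int (i - 1) * \<alpha>))"
        using per by (metis div_by_1 divide_divide_eq_right mult_1)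
      then show ?case using step2 by (simp add: algebra_simps)
    qed simp
    have nz: "theta_hat q (of_real x) \<noteq> 0" for x :: real by (rule theta_hat_nonzero[OF q]) auto
    have fe: "f (x + of_int n * \<alpha>) = gaussian \<alpha> (of_real x + of_int n * of_real \<alpha>) * (1 / theta_hat q (of_real x))" for x and n :: int
      unfolding f_def th by simp
    have fi: "integrable lborel f"
    proof (rule Bochner_Integration.integrable_bound)
      show "integrable lborel (\<lambda>x. C * normal_density (- \<alpha> / 2) (sqrt \<alpha>) x)" using a by simp
      have "continuous_on UNIV f"
      proof -
        have "continuous_on UNIV (\<lambda>x::real. theta_hat q (of_real x))"
          by (rule continuous_on_compose2[OF holomorphic_on_imp_continuous_on[OF theta_hat_holomorphic[OF q, of UNIV]]])
             (auto intro!: continuous_intros)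
        moreover have "continuous_on UNIV (\<lambda>x::real. gaussian \<alpha> (of_real x))"
          unfolding gaussian_of_real[OF a] normal_density_def by (intro continuous_intros) (use a in auto)
        ultimately show ?thesis unfolding f_def[abs_def] using nz by (intro continuous_intros) auto
      qed
      then show "f \<in> borel_measurable lborel" using borel_measurable_continuous_onI by simp
      have "norm (f x) \<le> norm (C * normal_density (- \<alpha> / 2) (sqrt \<alpha>) x)" for x
        using mult_right_mono[OF C(2)[of "of_real x"], of "normal_density (- \<alpha> / 2) (sqrt \<alpha>) x"] C(1)
        by (simp add: f_def gaussian_of_real[OF a] norm_mult norm_divide mult.commute)
      then show "AE x in lborel. norm (f x) \<le> norm (C * normal_density (- \<alpha> / 2) (sqrt \<alpha>) x)" by simp
    qed
    have fs: "(\<lambda>n. f (x + of_int n * \<alpha>)) abs_summable_on UNIV" for x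
      unfolding fe norm_mult by (rule summable_on_cmult_left[OF gaussian_translates(1)[OF assms]])
    have "(\<Sum>\<^sub>\<infinity>n. f (x + of_int n * \<alpha>)) = 1 / of_real \<alpha>" for x
    proof -
      have "(\<Sum>\<^sub>\<infinity>n. f (x + of_int n * \<alpha>)) = (gaussian \<alpha> (of_real x) * theta_q q (exp (of_real x))) * (1 / theta_hat q (of_real x))"
        unfolding fe infsum_cmult_left' gaussian_translates(2)[OF assms] ..
      moreover define G where "G = gaussian \<alpha> (of_real x) * theta_q q (exp (of_real x))"
      moreover have m: "theta_hat q (of_real x) = of_real \<alpha> * G"
        unfolding G_def by (rule theta_modular[OF assms, symmetric])
      moreover have "G \<noteq> 0" using nz[of x] m by auto
      ultimately show ?thesis using a by simp
    qed
    then have "(\<integral>x. f x \<partial>lborel) = (\<integral>x. indicator {0..<\<alpha>} x *\<^sub>R (1 / complex_of_real \<alpha>) \<partial>lborel)"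
      using fold_integral[OF a fi fs] by simp
    also have "\<dots> = integral {0..\<alpha>} (\<lambda>x. 1 / complex_of_real \<alpha>)"
      by (rule integral_period_eq) (intro continuous_intros)
    also have "\<dots> = 1" using a by (simp add: scaleR_conv_of_real)
    finally show ?thesis by (simp add: f_def)
  qed
qed

section \<open>The remainders of the three transforms\<close>

context strip_factor begin

lemma positive_strip_kernel:
  assumes r: "r > 0" and K: "\<And>x. strip_kernel (of_real x) = of_real (K x)" "\<And>x. 0 \<le> K x"
  shows "positive_q_kernel q r lborel exp (\<lambda>x. x + \<alpha>) (\<lambda>x. K (x - ln r))"
proof (rule positive_q_kernel.intro)
  have "Arg (of_real r) = 0" using r by simp
  then have "q_kernel q (of_real r) (cis 0) lborel exp (\<lambda>x. x + \<alpha>) (\<lambda>x. strip_kernel (Complex x 0 - Ln (of_real r))) 1"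
    using r by (intro strip_q_kernel) auto
  moreover have "strip_kernel (Complex x 0 - Ln (of_real r)) = of_real (K (x - ln r))" for x
  proof -
    have "Complex x 0 - Ln (of_real r) = of_real (x - ln r)" using r by (simp add: Ln_of_real complex_eq_iff)
    then show ?thesis by (simp only: K(1))
  qed
  ultimately show "q_kernel q (of_real r) 1 lborel exp (\<lambda>x. x + \<alpha>) (\<lambda>x. of_real (K (x - ln r))) 1" by simp
qed (use r K in auto)

text \<open>The two conditions on \<open>y\<close> are the two requirements on the ray: \<open>Re (z / t) \<ge> 0\<close> for the bound on
  \<open>u\<close>, and \<open>Re t \<ge> 0\<close> for \<open>|1 + t| \<ge> 1\<close>.\<close>

lemma strip_remainder_bound:
  fixes M H c :: real
  assumes z: "z \<noteq> 0" "\<bar>Arg z\<bar> < pi"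
    and y: "\<bar>y - Arg z\<bar> \<le> pi / 2" "\<bar>y\<bar> \<le> pi / 2"
    and plus: "positive_q_kernel q (norm z) lborel exp (\<lambda>x. x + \<alpha>) kap"
    and dom: "\<And>x. norm (strip_kernel (Complex x y - Ln z)) \<le> H * kap x" and H: "0 \<le> H"
    and ab: "a \<noteq> 0" "b \<noteq> 0" and c: "c = max (norm a) (norm b)" and cN: "c * q ^ N < 1"
    and M: "\<And>t. Re t \<ge> 0 \<Longrightarrow> norm (u_fun q a b t) \<le> M * qpoch_inf (- c * q * norm t) q"
  shows "norm ((\<integral>x. phi21 q a b (- of_real (exp x)) * strip_kernel (Complex x 0 - Ln z) \<partial>lborel) - U_partial q a b N z)
    \<le> norm (z ^ N) * norm (K0 q a b) * (M * H * q powi (- int (N choose 2)) / qpoch_inf (c * q ^ N) q)"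
proof -
  have ylt: "\<bar>y - Arg z\<bar> < pi" "\<bar>y\<bar> < pi" using y pi_gt_zero by linarith+
  have cy: "0 \<le> cos y" by (rule cos_ge_zero) (use y in linarith)+
  have src: "q_kernel q z (cis 0) lborel exp (\<lambda>x. x + \<alpha>) (\<lambda>x. strip_kernel (Complex x 0 - Ln z)) 1"
    by (rule strip_q_kernel) (use z in auto)
  have tgt: "q_kernel q z (cis y) lborel exp (\<lambda>x. x + \<alpha>) (\<lambda>x. strip_kernel (Complex x y - Ln z)) 1"
    by (rule strip_q_kernel) (use z ylt cy in auto)
  have same: "q_kernel.stieltjes (cis 0) lborel exp (\<lambda>x. strip_kernel (Complex x 0 - Ln z)) 0
     = q_kernel.stieltjes (cis y) lborel exp (\<lambda>x. strip_kernel (Complex x y - Ln z)) 0"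
    by (rule strip_stieltjes_eq) (use z ylt cy in auto)
  have ray: "0 \<le> Re (z / cis y)"
  proof -
    have "z = of_real (norm z) * cis (Arg z)" using rcis_cmod_Arg[of z] by (simp add: rcis_def)
    then have "z / cis y = of_real (norm z) * cis (Arg z - y)" by (metis cis_divide times_divide_eq_right)
    moreover have "0 \<le> cos (Arg z - y)" by (rule cos_ge_zero) (use y in linarith)+
    ultimately show ?thesis by simp
  qed
  show ?thesis
    using remainder_bound[OF src[unfolded cis_zero] tgt plus same[unfolded cis_zero] dom H ray ab c cN M] by simp
qed

lemma strip_transform_eq:
  assumes z: "z \<noteq> 0" "\<bar>Arg z\<bar> < pi"
    and g: "\<And>x. of_real K * g (exp x) = strip_kernel (Complex x 0 - Ln z)" and K: "K \<noteq> 0"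
  shows "of_real K * (LBINT t:{0<..}. phi21 q a b (- of_real t) * g t / of_real t)
    = (\<integral>x. phi21 q a b (- of_real (exp x)) * strip_kernel (Complex x 0 - Ln z) \<partial>lborel)"
proof -
  have src: "q_kernel q z (cis 0) lborel exp (\<lambda>x. x + \<alpha>) (\<lambda>x. strip_kernel (Complex x 0 - Ln z)) 1"
    by (rule strip_q_kernel) (use z in auto)
  then interpret S: q_kernel q z 1 lborel exp "\<lambda>x. x + \<alpha>" "\<lambda>x. strip_kernel (Complex x 0 - Ln z)" 1
    by simp
  define h where "h x = phi21 q a b (- of_real (exp x)) * strip_kernel (Complex x 0 - Ln z)" for x
  obtain N where N: "max (norm a) (norm b) * q ^ N < 1" using ex_mult_power_less_one[OF q] by blast
  have hi: "integrable lborel h"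
    using S.remainder_series(3)[OF refl N] by (simp add: h_def[abs_def] S.pt_def)
  have ImLn: "Im (Ln z) = Arg z" using z by (simp add: Arg_def)
  have "continuous_on UNIV (\<lambda>x. strip_kernel (Complex x 0 - Ln z))"
    by (rule horizontal_continuous[OF strip_kernel_holomorphic[of "Ln z"]]) (use z ImLn in auto)
  moreover have "continuous_on UNIV (\<lambda>x::real. phi21 q a b (- of_real (exp x)))"
    by (rule continuous_on_compose2[OF holomorphic_on_imp_continuous_on[OF phi21_spec(1)[OF q]]])
       (use neg_real_in_phi21_domain[OF q] in \<open>auto intro!: continuous_intros\<close>)
  ultimately have hc: "continuous_on UNIV h" unfolding h_def[abs_def] by (intro continuous_intros)
  have "(LBINT t:{0<..}. phi21 q a b (- of_real t) * g t / of_real t) = (\<integral>x. h x / of_real K \<partial>lborel)"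
  proof (rule integral_exp_substitution)
    show "continuous_on UNIV (\<lambda>x. h x / of_real K)" using K by (intro continuous_intros hc) auto
    show "integrable lborel (\<lambda>x. h x / of_real K)" using hi by simp
    fix t :: real assume t: "0 < t"
    have "of_real K * g t = strip_kernel (Complex (ln t) 0 - Ln z)" using g[of "ln t"] t by simp
    then have "g t = strip_kernel (Complex (ln t) 0 - Ln z) / of_real K" using K by (simp add: field_simps)
    then show "phi21 q a b (- of_real t) * g t / of_real t = h (ln t) / of_real K / of_real t"
      using t by (simp add: h_def)
  qed
  then show ?thesis using K by (simp add: h_def)
qed

end

lemma cos_sector:
  assumes "z \<noteq> 0" "0 \<le> Re z"
  shows "\<bar>Arg z\<bar> \<le> pi / 2"
  using assms Re_Ln_pos_le[of z] by (simp add: Arg_def)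

lemma E_q_eq_gaussian:
  assumes q: "0 < q" "q < 1" and alpha: "\<alpha> = - ln q" and z: "z \<noteq> 0" "\<bar>Arg z\<bar> < pi"
  shows "of_real (C_q q) * E_q q (of_real (exp x) / z) = gaussian \<alpha> (Complex x 0 - Ln z)"
proof -
  have zn: "z \<notin> \<real>\<^sub>\<le>\<^sub>0"
  proof
    assume "z \<in> \<real>\<^sub>\<le>\<^sub>0"
    then obtain s where s: "z = of_real s" "s \<le> 0" by (auto elim: nonpos_Reals_cases)
    then have "s < 0" using z by auto
    then show False using z s by simp
  qed
  have "Ln (of_real (exp x) / z / of_real (sqrt q)) = Ln (of_real (exp x / sqrt q) * inverse z)"
    by (simp add: divide_inverse mult_ac)
  also have "\<dots> = of_real (ln (exp x / sqrt q)) + Ln (inverse z)"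
  proof -
    have r: "0 < exp x / sqrt q" using q by simp
    have "Ln (of_real (exp x / sqrt q) * inverse z) = Ln (of_real (exp x / sqrt q)) + Ln (inverse z)"
      by (rule Ln_times_of_real[OF r]) (use z in simp)
    then show ?thesis by (simp only: Ln_of_real[OF r])
  qed
  also have "Ln (inverse z) = - Ln z" by (rule Ln_inverse[OF zn])
  also have "ln (exp x / sqrt q) = x + \<alpha> / 2"
    using q by (simp add: ln_div ln_sqrt alpha)
  finally have L: "Ln (of_real (exp x) / z / of_real (sqrt q)) = (Complex x 0 - Ln z) + of_real (\<alpha> / 2)"
    by (simp add: complex_eq_iff)
  have "complex_of_real (C_q q) = 1 / of_real (sqrt (2 * pi * \<alpha>))"
    by (simp add: C_q_def alpha)
  then show ?thesis unfolding E_q_def L gaussian_def by (simp add: alpha)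
qed

lemma norm_gaussian_shifted:
  assumes a: "\<alpha> > 0" and z: "z \<noteq> 0"
  shows "norm (gaussian \<alpha> (Complex x y - Ln z))
    = exp ((y - Arg z)\<^sup>2 / (2 * \<alpha>)) * normal_density (- \<alpha> / 2) (sqrt \<alpha>) (x - ln (norm z))"
proof -
  have "Im (Ln z) = Arg z" "Re (Ln z) = ln (norm z)" using z by (simp_all add: Arg_def)
  then have "Complex x y - Ln z = Complex (x - ln (norm z)) (y - Arg z)" by (simp add: complex_eq_iff)
  then show ?thesis by (simp add: norm_gaussian[OF a])
qed

lemma aligned_ray:
  assumes "z \<noteq> 0"
  shows "Complex x (Arg z) - Ln z = of_real (x - ln (norm z))"
proof -
  have "Im (Ln z) = Arg z" "Re (Ln z) = ln (norm z)" using assms by (simp_all add: Arg_def)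
  then show ?thesis by (simp add: complex_eq_iff)
qed

text \<open>The kernel of the discrete transform, carried by the points \<open>\<mu> q\<^sup>n\<close> of a ray. Quasi-periodicity
  writes \<open>1 / \<theta>(q\<^sup>n x)\<close> as the \<open>n\<close>-th term of the theta series divided by \<open>\<theta>(x)\<close>, so the total
  mass is \<open>1\<close> by the triple product identity.\<close>

lemma lattice_q_kernel:
  assumes q: "0 < q" "q < 1" and z: "z \<noteq> 0" and w: "norm \<omega> = 1" and mu: "\<mu> > 0"
    and nz: "theta_q q (\<omega> * of_real \<mu> / z) \<noteq> 0"
    and d: "0 < d" "\<And>n::int. d \<le> norm (1 + \<omega> * of_real (\<mu> * q powi n))"
  shows "q_kernel q z \<omega> (count_space UNIV) (\<lambda>n. \<mu> * q powi n) (\<lambda>n. n - 1)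
     (\<lambda>n. 1 / theta_q q (of_real (q powi n) * (\<omega> * of_real \<mu> / z))) d"
    and "1 / theta_q q (of_real (q powi n) * (\<omega> * of_real \<mu> / z))
       = of_real (tri q n) * (\<omega> * of_real \<mu> / z) powi n / theta_q q (\<omega> * of_real \<mu> / z)"
proof -
  define x where "x = \<omega> * of_real \<mu> / z"
  have w0: "\<omega> \<noteq> 0" using w by auto
  have x0: "x \<noteq> 0" using w0 mu z by (simp add: x_def)
  have k: "1 / theta_q q (of_real (q powi n) * x) = of_real (tri q n) * x powi n / theta_q q x" for n
  proof -
    have sh: "theta_q q (of_real (q powi n) * x) * (of_real (tri q n) * x powi n) = theta_q q x"
      by (rule theta_q_shift[OF q x0])
    then have "theta_q q (of_real (q powi n) * x) \<noteq> 0" using nz unfolding x_def by auto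
    then show ?thesis using sh nz unfolding x_def[symmetric] by (simp add: field_simps)
  qed
  then show "1 / theta_q q (of_real (q powi n) * (\<omega> * of_real \<mu> / z))
       = of_real (tri q n) * (\<omega> * of_real \<mu> / z) powi n / theta_q q (\<omega> * of_real \<mu> / z)" by (simp only: x_def)
  have intk: "integrable (count_space UNIV) (\<lambda>n. of_real (tri q n) * y powi n)" for y :: complex
    using summable_tri[OF q, of y] unfolding abs_summable_equivalent Infinite_Set_Sum.abs_summable_on_def .
  have intt: "(\<integral>n. of_real (tri q n) * y powi n \<partial>count_space UNIV) = theta_series q y" for y :: complex
  proof -
    have "(\<integral>n. of_real (tri q n) * y powi n \<partial>count_space UNIV) = infsetsum (\<lambda>n. of_real (tri q n) * y powi n) UNIV"
      by (simp add: infsetsum_def)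
    also have "\<dots> = theta_series q y" unfolding theta_series_def
      by (rule infsetsum_infsum) (use summable_tri[OF q, of y] in \<open>simp only: abs_summable_equivalent\<close>)
    finally show ?thesis .
  qed
  show "q_kernel q z \<omega> (count_space UNIV) (\<lambda>n. \<mu> * q powi n) (\<lambda>n. n - 1)
     (\<lambda>n. 1 / theta_q q (of_real (q powi n) * (\<omega> * of_real \<mu> / z))) d"
  proof
    show "0 < q" "q < 1" "z \<noteq> 0" "norm \<omega> = 1" "0 < d" by fact+
    show "d \<le> norm (1 + \<omega> * of_real (\<mu> * q powi n))" for n by (rule d(2))
    show "0 < \<mu> * q powi n" for n using mu q by simp
    show "(\<lambda>n. \<mu> * q powi n) \<in> borel_measurable (count_space UNIV)" by simp
    show "\<mu> * q powi (n - 1) = \<mu> * q powi n / q" for n using q by (simp add: power_int_diff)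
    show "(\<integral>n. F (n - 1) \<partial>count_space UNIV) = (\<integral>n. F n \<partial>count_space UNIV)" for F :: "int \<Rightarrow> complex"
      by (rule integral_bij_count_space) (auto intro!: bij_betwI[of _ _ _ "\<lambda>n. n + 1"])
    show "(\<integral>n. 1 / theta_q q (of_real (q powi n) * (\<omega> * of_real \<mu> / z)) \<partial>count_space UNIV) = 1"
      unfolding x_def[symmetric] k using intt[of x] theta_q_eq_series[OF q x0] nz unfolding x_def[symmetric] by simp
    show "integrable (count_space UNIV) (\<lambda>n. of_real (\<mu> * q powi n) powi j * (1 / theta_q q (of_real (q powi n) * (\<omega> * of_real \<mu> / z))))" for j
    proof -
      have "complex_of_real (\<mu> * q powi n) powi j * (of_real (tri q n) * x powi n / theta_q q x)
        = (of_real \<mu> powi j / theta_q q x) * (of_real (tri q n) * (of_real (q powi j) * x) powi n)" for n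
      proof -
        have "complex_of_real (q powi n) powi j = (of_real (q powi j)) powi n"
          by (simp only: of_real_power_int[symmetric] power_int_mult[symmetric] mult.commute)
        then show ?thesis by (simp add: power_int_mult_distrib mult_ac)
      qed
      then show ?thesis unfolding x_def[symmetric] k by (simp only: integrable_mult_right[OF intk])
    qed
    show "1 / theta_q q (of_real (q powi (n - 1)) * (\<omega> * of_real \<mu> / z))
       = 1 / theta_q q (of_real (q powi n) * (\<omega> * of_real \<mu> / z)) * (of_real q * z / (\<omega> * of_real (\<mu> * q powi n)))" for n
    proof -
      define v where "v = of_real (q powi (n - 1)) * x"
      have v0: "v \<noteq> 0" using x0 q by (simp add: v_def)
      have e: "of_real q * v = of_real (q powi n) * x" using q by (simp add: v_def power_int_diff)
      have st: "v * theta_q q (of_real (q powi n) * x) = theta_q q v" using theta_q_step[OF q v0] unfolding e .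
      have "1 / theta_q q v = 1 / theta_q q (of_real (q powi n) * x) * (1 / v)"
        unfolding st[symmetric] by simp
      moreover have "1 / v = of_real q * z / (\<omega> * of_real (\<mu> * q powi n))"
        using q w0 mu z by (simp add: v_def x_def power_int_diff)
      ultimately show ?thesis by (simp only: v_def x_def)
    qed
  qed
qed

lemma not_negative_real:
  assumes "z \<noteq> 0" "\<bar>Arg z\<bar> < pi" "s > 0"
  shows "z \<noteq> - of_real s"
proof
  assume "z = - of_real s"
  then have "z = of_real (- s)" by simp
  then have "Arg z = pi" using assms(3) by (simp only: Arg_of_real) simp
  then show False using assms(2) by simp
qed

text \<open>The nodes \<open>\<lambda> q\<^sup>n\<close> are traded for \<open>z q\<^sup>n / \<lambda>\<close>. With \<open>X = 1 / \<lambda>\<close> and \<open>Y = \<lambda> / z\<close> the arguments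
  of the theta functions are \<open>q\<^sup>n Y\<close> before and \<open>q\<^sup>n X > 0\<close> after the exchange, and
  \<open>1 + t\<close> is \<open>1 + q\<^sup>n / X\<close> before and \<open>1 + q\<^sup>n / Y\<close> after it: this is the symmetry of the
  Appell-Lerch sum.\<close>

lemma R_lambda_bound:
  fixes M c lam d :: real
  assumes q: "0 < q" "q < 1" and z: "z \<noteq> 0" "\<bar>Arg z\<bar> < pi" and lam: "lam > 0"
    and d: "0 < d" "\<And>s. s > 0 \<Longrightarrow> d \<le> norm (1 + cis (Arg z) * of_real s)"
    and ab: "a \<noteq> 0" "b \<noteq> 0" and c: "c = max (norm a) (norm b)" and cN: "c * q ^ N < 1"
    and M: "\<And>t. Re t \<ge> 0 \<Longrightarrow> norm (u_fun q a b t) \<le> M * qpoch_inf (- c * q * norm t) q"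
  shows "norm (R_lambda q (of_real lam) a b N z)
    \<le> norm (z ^ N) * norm (K0 q a b) * (M * (1 / d) * q powi (- int (N choose 2)) / qpoch_inf (c * q ^ N) q)"
proof -
  define X Y where "X = complex_of_real (1 / lam)" and "Y = of_real lam / z"
  define mu where "mu = norm z / lam"
  have nz: "norm z > 0" using z by simp
  have mu: "mu > 0" using nz lam by (simp add: mu_def)
  have pol: "z = cis (Arg z) * of_real (norm z)" using rcis_cmod_Arg[of z] by (simp add: rcis_def mult.commute)
  have X0: "X \<noteq> 0" and Y0: "Y \<noteq> 0" using lam z by (auto simp: X_def Y_def)
  have Xk: "X \<noteq> - of_real (q powi k)" for k :: int
  proof
    assume "X = - of_real (q powi k)"
    then have "1 / lam = - (q powi k)" unfolding X_def by (metis of_real_eq_iff of_real_minus)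
    moreover have "0 < q powi k" "0 < 1 / lam" using q lam by auto
    ultimately show False by linarith
  qed
  have Yk: "Y \<noteq> - of_real (q powi k)" for k :: int
  proof
    assume "Y = - of_real (q powi k)"
    then have "z = - of_real (lam / q powi k)" using z q unfolding Y_def by (simp add: field_simps)
    moreover have "lam / q powi k > 0" using lam q by simp
    ultimately show False using not_negative_real[OF z] by blast
  qed
  have tX: "theta_q q X \<noteq> 0" and tY: "theta_q q Y \<noteq> 0"
    using theta_q_eq_zero_iff[OF q X0] theta_q_eq_zero_iff[OF q Y0] Xk Yk by blast+
  have e1: "1 * of_real lam / z = Y" by (simp add: Y_def)
  have e2: "cis (Arg z) * of_real mu / z = X"
  proof -
    have "cis (Arg z) * of_real mu = z * of_real (1 / lam)" by (subst (2) pol) (simp add: mu_def)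
    then show ?thesis using z by (simp add: X_def)
  qed
  have e3: "1 * of_real mu / of_real (norm z) = X" using nz by (simp add: X_def mu_def)
  note L1 = lattice_q_kernel[OF q z(1), where \<omega> = 1 and \<mu> = lam and d = 1, unfolded e1]
  note L2 = lattice_q_kernel[OF q z(1), where \<omega> = "cis (Arg z)" and \<mu> = mu and d = d, unfolded e2]
  have d1: "1 \<le> norm (1 + 1 * complex_of_real (m * q powi n))" if "m > 0" for m and n :: int
  proof (rule one_plus_norm_ge_1)
    have "0 < m * q powi n" using that q by simp
    then show "0 \<le> Re (1 * complex_of_real (m * q powi n))"
      by (simp only: mult_1_left Re_complex_of_real)
  qed
  have src: "q_kernel q z 1 (count_space UNIV) (\<lambda>n. lam * q powi n) (\<lambda>n. n - 1) (\<lambda>n. 1 / theta_q q (of_real (q powi n) * Y)) 1"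
    by (rule L1(1)) (use lam tY d1[OF lam] in auto)
  have k1: "1 / theta_q q (of_real (q powi n) * Y) = of_real (tri q n) * Y powi n / theta_q q Y" for n :: int
    by (rule L1(2)) (use lam tY d1[OF lam] in auto)
  have dd: "d \<le> norm (1 + cis (Arg z) * complex_of_real (mu * q powi n))" for n :: int
    by (rule d(2)) (use mu q in simp)
  have tgt: "q_kernel q z (cis (Arg z)) (count_space UNIV) (\<lambda>n. mu * q powi n) (\<lambda>n. n - 1) (\<lambda>n. 1 / theta_q q (of_real (q powi n) * X)) d"
    by (rule L2(1)) (use mu tX d(1) dd in auto)
  have k2: "1 / theta_q q (of_real (q powi n) * X) = of_real (tri q n) * X powi n / theta_q q X" for n :: int
    by (rule L2(2)) (use mu tX d(1) dd in auto)
  \<comment> \<open>The arguments \<open>q\<^sup>n X\<close> are positive, so the target kernel is its own positive majorant.\<close>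
  define kap where "kap n = Re (1 / theta_q q (of_real (q powi n) * X))" for n :: int
  have kap: "1 / theta_q q (of_real (q powi n) * X) = of_real (kap n)" "0 \<le> kap n" for n :: int
  proof -
    have "0 < q powi n / lam" using q lam by simp
    from theta_q_of_real_pos[OF q this] obtain v where v: "v > 0" "theta_q q (of_real (q powi n / lam)) = of_real v" by blast
    have "of_real (q powi n) * X = of_real (q powi n / lam)" by (simp add: X_def)
    then have "1 / theta_q q (of_real (q powi n) * X) = of_real (1 / v)" using v by simp
    then show "1 / theta_q q (of_real (q powi n) * X) = of_real (kap n)" "0 \<le> kap n"
      using v unfolding kap_def by simp_all
  qed
  have nzc: "complex_of_real (norm z) \<noteq> 0" using nz by simp
  have plus: "positive_q_kernel q (norm z) (count_space UNIV) (\<lambda>n. mu * q powi n) (\<lambda>n. n - 1) kap"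
  proof (rule positive_q_kernel.intro)
    have "q_kernel q (of_real (norm z)) 1 (count_space UNIV) (\<lambda>n. mu * q powi n) (\<lambda>n. n - 1) (\<lambda>n. 1 / theta_q q (of_real (q powi n) * X)) 1"
      by (rule lattice_q_kernel(1)[OF q nzc, where \<omega> = 1 and \<mu> = mu and d = 1, unfolded e3]) (use mu tX d1[OF mu] in auto)
    then show "q_kernel q (of_real (norm z)) 1 (count_space UNIV) (\<lambda>n. mu * q powi n) (\<lambda>n. n - 1) (\<lambda>n. of_real (kap n)) 1"
      unfolding kap(1) .
  qed (use nz kap(2) in auto)
  interpret A: q_kernel q z 1 "count_space UNIV" "\<lambda>n. lam * q powi n" "\<lambda>n. n - 1" "\<lambda>n. 1 / theta_q q (of_real (q powi n) * Y)" 1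
    by (rule src)
  interpret B: q_kernel q z "cis (Arg z)" "count_space UNIV" "\<lambda>n. mu * q powi n" "\<lambda>n. n - 1" "\<lambda>n. 1 / theta_q q (of_real (q powi n) * X)" d
    by (rule tgt)
  have sum_eq: "(\<integral>n. h n \<partial>count_space UNIV) = (\<Sum>\<^sub>\<infinity>n. h n)" if "integrable (count_space UNIV) h" for h :: "int \<Rightarrow> complex"
    using infsetsum_infsum[of h UNIV] that by (simp add: infsetsum_def Infinite_Set_Sum.abs_summable_on_def)
  have same: "A.stieltjes 0 = B.stieltjes 0"
  proof -
    have ptA: "1 + A.pt n = 1 + of_real (q powi n) / X" for n using lam by (simp add: A.pt_def X_def mult.commute)
    have ptB: "1 + B.pt n = 1 + of_real (q powi n) / Y" for n
    proof -
      have "B.pt n = (cis (Arg z) * of_real (norm z)) * of_real (q powi n) / of_real lam"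
        unfolding B.pt_def by (simp add: mu_def mult_ac)
      also have "\<dots> = of_real (q powi n) / Y" using z lam unfolding pol[symmetric] by (simp add: Y_def)
      finally show ?thesis by simp
    qed
    have "A.stieltjes 0 = (\<Sum>\<^sub>\<infinity>n. A.pt n powi 0 / (1 + A.pt n) * (1 / theta_q q (of_real (q powi n) * Y)))"
      unfolding A.stieltjes_def by (rule sum_eq[OF A.integrable_stieltjes])
    also have "\<dots> = (\<Sum>\<^sub>\<infinity>n. 1 / theta_q q Y * (of_real (tri q n) * Y powi n / (1 + of_real (q powi n) / X)))"
      by (intro infsum_cong) (simp add: ptA k1 del: of_real_power_int)
    also have "\<dots> = 1 / theta_q q Y * (\<Sum>\<^sub>\<infinity>n. of_real (tri q n) * Y powi n / (1 + of_real (q powi n) / X))"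
      by (rule infsum_cmult_right')
    finally have A: "A.stieltjes 0 = \<dots>" .
    have "B.stieltjes 0 = (\<Sum>\<^sub>\<infinity>n. B.pt n powi 0 / (1 + B.pt n) * (1 / theta_q q (of_real (q powi n) * X)))"
      unfolding B.stieltjes_def by (rule sum_eq[OF B.integrable_stieltjes])
    also have "\<dots> = (\<Sum>\<^sub>\<infinity>n. 1 / theta_q q X * (of_real (tri q n) * X powi n / (1 + of_real (q powi n) / Y)))"
      by (intro infsum_cong) (simp add: ptB k2 del: of_real_power_int)
    also have "\<dots> = 1 / theta_q q X * (\<Sum>\<^sub>\<infinity>n. of_real (tri q n) * X powi n / (1 + of_real (q powi n) / Y))"
      by (rule infsum_cmult_right')
    finally have B: "B.stieltjes 0 = \<dots>" .
    have "theta_q q X * (\<Sum>\<^sub>\<infinity>n. of_real (tri q n) * Y powi n / (1 + of_real (q powi n) / X))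
       = theta_q q Y * (\<Sum>\<^sub>\<infinity>n. of_real (tri q n) * X powi n / (1 + of_real (q powi n) / Y))"
      by (rule appell_lerch_symmetry[OF q X0 Xk Y0 Yk])
    then show ?thesis unfolding A B using tX tY by (simp add: divide_eq_eq eq_divide_eq mult.commute)
  qed
  have ray: "0 \<le> Re (z / cis (Arg z))"
  proof -
    have "z / cis (Arg z) = of_real (norm z)" by (subst pol) simp
    then show ?thesis by simp
  qed
  have dom: "norm (1 / theta_q q (of_real (q powi n) * X)) \<le> 1 * kap n" for n :: int
    unfolding kap(1) using kap(2)[of n] by simp
  have U: "(\<integral>n. phi21 q a b (- of_real (lam * q powi n)) * (1 / theta_q q (of_real (q powi n) * Y)) \<partial>count_space UNIV)
     = U_lambda q (of_real lam) a b z"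
  proof -
    have i: "integrable (count_space UNIV) (\<lambda>n. phi21 q a b (- A.pt n) * (1 / theta_q q (of_real (q powi n) * Y)))"
      by (rule A.remainder_series(3)[OF refl]) (use cN c in simp)
    have "(\<integral>n. phi21 q a b (- A.pt n) * (1 / theta_q q (of_real (q powi n) * Y)) \<partial>count_space UNIV)
      = (\<Sum>\<^sub>\<infinity>n. phi21 q a b (- A.pt n) * (1 / theta_q q (of_real (q powi n) * Y)))"
      by (rule sum_eq[OF i])
    also have "\<dots> = U_lambda q (of_real lam) a b z"
      unfolding U_lambda_def by (intro infsum_cong) (simp add: A.pt_def Y_def mult.commute)
    finally show ?thesis by (simp add: A.pt_def)
  qed
  show ?thesis
    using remainder_bound[OF src tgt plus same dom zero_le_one ray ab c cN M] unfolding U R_lambda_def by simp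
qed

text \<open>On the ray of argument \<open>y\<close> the modulus of the Gaussian exceeds that on the ray through \<open>z\<close> by
  the constant factor \<open>exp((y - arg z)\<^sup>2 / (2 \<alpha>))\<close>.\<close>

lemma R_E_bound:
  fixes M c y :: real
  assumes q: "0 < q" "q < 1" and z: "z \<noteq> 0" "\<bar>Arg z\<bar> < pi"
    and y: "\<bar>y - Arg z\<bar> \<le> pi / 2" "\<bar>y\<bar> \<le> pi / 2"
    and ab: "a \<noteq> 0" "b \<noteq> 0" and c: "c = max (norm a) (norm b)" and cN: "c * q ^ N < 1"
    and M: "\<And>t. Re t \<ge> 0 \<Longrightarrow> norm (u_fun q a b t) \<le> M * qpoch_inf (- c * q * norm t) q"
  shows "norm (R_E q a b N z) \<le> norm (z ^ N) * norm (K0 q a b)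
     * (M * exp (- (y - Arg z)\<^sup>2 / (2 * ln q)) * q powi (- int (N choose 2)) / qpoch_inf (c * q ^ N) q)"
proof -
  define \<alpha> where "\<alpha> = - ln q"
  have a: "\<alpha> > 0" using q by (simp add: \<alpha>_def)
  interpret E: strip_factor q \<alpha> "\<lambda>w. 1" by (rule strip_factor_one[OF q \<alpha>_def])
  have k: "E.strip_kernel w = gaussian \<alpha> w" for w by (simp add: E.strip_kernel_def)
  have plus: "positive_q_kernel q (norm z) lborel exp (\<lambda>x. x + \<alpha>) (\<lambda>x. normal_density (- \<alpha> / 2) (sqrt \<alpha>) (x - ln (norm z)))"
    by (rule E.positive_strip_kernel) (use z in \<open>auto simp: k gaussian_of_real[OF a]\<close>)
  have dom: "norm (E.strip_kernel (Complex x y - Ln z))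
     \<le> exp ((y - Arg z)\<^sup>2 / (2 * \<alpha>)) * normal_density (- \<alpha> / 2) (sqrt \<alpha>) (x - ln (norm z))" for x
    unfolding k norm_gaussian_shifted[OF a z(1)] by simp
  have C: "C_q q \<noteq> 0" using q by (simp add: C_q_def)
  have U: "U_E q a b z = (\<integral>x. phi21 q a b (- of_real (exp x)) * E.strip_kernel (Complex x 0 - Ln z) \<partial>lborel)"
    unfolding U_E_def
    by (rule E.strip_transform_eq[OF z _ C]) (simp only: k E_q_eq_gaussian[OF q \<alpha>_def z])
  have "exp ((y - Arg z)\<^sup>2 / (2 * \<alpha>)) = exp (- (y - Arg z)\<^sup>2 / (2 * ln q))" by (simp add: \<alpha>_def)
  then show ?thesis
    using E.strip_remainder_bound[OF z y plus dom _ ab c cN M] unfolding U[symmetric] R_E_def[symmetric] by simp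
qed

text \<open>The Gaussian cancels in Jacobi's transformation.\<close>

lemma theta_strip_kernel:
  assumes q: "0 < q" "q < 1" and alpha: "\<alpha> = - ln q" and w: "\<bar>Im w\<bar> < pi"
  shows "strip_factor.strip_kernel \<alpha> (\<lambda>w. 1 / theta_hat q w) w = of_real (- 1 / ln q) * (1 / theta_q q (exp w))"
proof -
  interpret T: strip_factor q \<alpha> "\<lambda>w. 1 / theta_hat q w" by (rule strip_factor_theta[OF q alpha])
  define G where "G = gaussian \<alpha> w"
  have m: "theta_hat q w = of_real \<alpha> * (G * theta_q q (exp w))" unfolding G_def by (rule theta_modular[OF q alpha, symmetric])
  have "theta_hat q w \<noteq> 0" by (rule theta_hat_nonzero[OF q]) (use w in auto)
  then have nz: "G \<noteq> 0" "theta_q q (exp w) \<noteq> 0" unfolding m by auto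
  have "T.strip_kernel w = G / (of_real \<alpha> * (G * theta_q q (exp w)))"
    unfolding T.strip_kernel_def m[symmetric] by (simp add: G_def)
  also have "\<dots> = of_real (- 1 / ln q) * (1 / theta_q q (exp w))"
    using nz T.alpha_pos by (simp add: alpha)
  finally show ?thesis .
qed

text \<open>On the ray through \<open>z\<close> the theta kernel is positive and is its own majorant. On another ray the
  majorant is the Gaussian, and the dual theta function in the denominator is bounded below.\<close>

lemma R_theta_bound:
  fixes M c y :: real
  assumes q: "0 < q" "q < 1" and z: "z \<noteq> 0" "\<bar>Arg z\<bar> < pi"
    and y: "\<bar>y - Arg z\<bar> \<le> pi / 2" "\<bar>y\<bar> \<le> pi / 2"
    and ab: "a \<noteq> 0" "b \<noteq> 0" and c: "c = max (norm a) (norm b)" and cN: "c * q ^ N < 1"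
    and M: "\<And>t. Re t \<ge> 0 \<Longrightarrow> norm (u_fun q a b t) \<le> M * qpoch_inf (- c * q * norm t) q"
  shows "y = Arg z \<Longrightarrow> norm (R_theta q a b N z) \<le> norm (z ^ N) * norm (K0 q a b)
     * (M * q powi (- int (N choose 2)) / qpoch_inf (c * q ^ N) q)"
    and "norm (R_theta q a b N z) \<le> norm (z ^ N) * norm (K0 q a b)
     * (M * exp (- (y - Arg z)\<^sup>2 / (2 * ln q)) * q powi (- int (N choose 2))
        / (qpoch_inf (c * q ^ N) q * qpoch_inf ((qhat q)\<^sup>2) ((qhat q)\<^sup>2) ^ 3))
     * ((1 + sqrt (qhat q)) / (1 - sqrt (qhat q)))"
proof -
  define \<alpha> where "\<alpha> = - ln q"
  have a: "\<alpha> > 0" using q by (simp add: \<alpha>_def)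
  interpret T: strip_factor q \<alpha> "\<lambda>w. 1 / theta_hat q w" by (rule strip_factor_theta[OF q \<alpha>_def])
  interpret E: strip_factor q \<alpha> "\<lambda>w. 1" by (rule strip_factor_one[OF q \<alpha>_def])
  have ImLn: "Im (Ln z) = Arg z" using z by (simp add: Arg_def)
  have k: "T.strip_kernel w = of_real (- 1 / ln q) * (1 / theta_q q (exp w))" if "\<bar>Im w\<bar> < pi" for w
    by (rule theta_strip_kernel[OF q \<alpha>_def that])
  have U: "U_theta q a b z = (\<integral>x. phi21 q a b (- of_real (exp x)) * T.strip_kernel (Complex x 0 - Ln z) \<partial>lborel)"
  proof -
    have "of_real (- 1 / ln q) * (LBINT t:{0<..}. phi21 q a b (- of_real t) * (1 / theta_q q (of_real t / z)) / of_real t)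
      = (\<integral>x. phi21 q a b (- of_real (exp x)) * T.strip_kernel (Complex x 0 - Ln z) \<partial>lborel)"
    proof (rule T.strip_transform_eq[OF z])
      show "- 1 / ln q \<noteq> 0" using q by simp
      fix x
      have "exp (Complex x 0 - Ln z) = of_real (exp x) / z"
        using z by (simp add: exp_diff exp_of_real flip: complex_of_real_def)
      then show "of_real (- 1 / ln q) * (1 / theta_q q (of_real (exp x) / z)) = T.strip_kernel (Complex x 0 - Ln z)"
        using k[of "Complex x 0 - Ln z"] z ImLn by simp
    qed
    then show ?thesis by (simp add: U_theta_def)
  qed
  show "norm (R_theta q a b N z) \<le> norm (z ^ N) * norm (K0 q a b)
     * (M * q powi (- int (N choose 2)) / qpoch_inf (c * q ^ N) q)" if yz: "y = Arg z"
  proof -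
    define K where "K x = Re (T.strip_kernel (of_real x))" for x
    have K: "T.strip_kernel (of_real x) = of_real (K x)" "0 \<le> K x" for x
    proof -
      obtain v where v: "v > 0" "theta_q q (of_real (exp x)) = of_real v" using theta_q_of_real_pos[OF q exp_gt_zero] by blast
      have "T.strip_kernel (of_real x) = of_real (- 1 / ln q * (1 / v))"
        using k[of "of_real x"] v by (simp add: exp_of_real)
      then show "T.strip_kernel (of_real x) = of_real (K x)" "0 \<le> K x"
        using v q unfolding K_def by (simp_all add: divide_nonneg_nonpos mult_nonneg_nonpos2 divide_nonpos_neg mult_nonpos_nonneg)
    qed
    have plus: "positive_q_kernel q (norm z) lborel exp (\<lambda>x. x + \<alpha>) (\<lambda>x. K (x - ln (norm z)))"
      by (rule T.positive_strip_kernel) (use z K in auto)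
    have dom: "norm (T.strip_kernel (Complex x y - Ln z)) \<le> 1 * K (x - ln (norm z))" for x
      unfolding yz aligned_ray[OF z(1)] K(1) using K(2) by simp
    show ?thesis
      using T.strip_remainder_bound[OF z y plus dom _ ab c cN M] unfolding U[symmetric] R_theta_def[symmetric] by simp
  qed
  define Q p where "Q = (qhat q)\<^sup>2" and "p = sqrt (qhat q)"
  define C where "C = qpoch_inf Q Q ^ 3 * ((1 - p) / (1 + p))"
  note qh = qhat_bounds[OF q]
  have p: "0 < p" "p < 1" using qh by (auto simp: p_def)
  have QQ: "0 < qpoch_inf Q Q" using qh unfolding Q_def by (intro qpoch_inf_pos) auto
  have C: "0 < C" unfolding C_def using QQ p by simp
  define H where "H = exp ((y - Arg z)\<^sup>2 / (2 * \<alpha>)) / C"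
  have plus: "positive_q_kernel q (norm z) lborel exp (\<lambda>x. x + \<alpha>) (\<lambda>x. normal_density (- \<alpha> / 2) (sqrt \<alpha>) (x - ln (norm z)))"
    by (rule E.positive_strip_kernel) (use z in \<open>auto simp: E.strip_kernel_def gaussian_of_real[OF a]\<close>)
  have dom: "norm (T.strip_kernel (Complex x y - Ln z)) \<le> H * normal_density (- \<alpha> / 2) (sqrt \<alpha>) (x - ln (norm z))" for x
  proof -
    have "C \<le> norm (theta_hat q (Complex x y - Ln z))"
      unfolding C_def Q_def p_def by (rule theta_hat_lower_bound_half[OF q]) (use y ImLn in simp)
    then have "1 / norm (theta_hat q (Complex x y - Ln z)) \<le> 1 / C"
      using C by (intro divide_left_mono mult_pos_pos) linarith+
    then have "norm (gaussian \<alpha> (Complex x y - Ln z)) * (1 / norm (theta_hat q (Complex x y - Ln z)))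
       \<le> norm (gaussian \<alpha> (Complex x y - Ln z)) * (1 / C)"
      by (rule mult_left_mono) simp
    then show ?thesis
      unfolding T.strip_kernel_def norm_mult norm_divide norm_one norm_gaussian_shifted[OF a z(1)] H_def by simp
  qed
  have H0: "0 \<le> H" using C by (simp add: H_def)
  have "norm (R_theta q a b N z) \<le> norm (z ^ N) * norm (K0 q a b) * (M * H * q powi (- int (N choose 2)) / qpoch_inf (c * q ^ N) q)"
    using T.strip_remainder_bound[OF z y plus dom H0 ab c cN M] unfolding U[symmetric] R_theta_def[symmetric] .
  also have "H = exp (- (y - Arg z)\<^sup>2 / (2 * ln q)) * (1 / qpoch_inf Q Q ^ 3) * ((1 + p) / (1 - p))"
    using p QQ by (simp add: H_def C_def \<alpha>_def)
  finally show "norm (R_theta q a b N z) \<le> norm (z ^ N) * norm (K0 q a b)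
     * (M * exp (- (y - Arg z)\<^sup>2 / (2 * ln q)) * q powi (- int (N choose 2))
        / (qpoch_inf (c * q ^ N) q * qpoch_inf ((qhat q)\<^sup>2) ((qhat q)\<^sup>2) ^ 3))
     * ((1 + sqrt (qhat q)) / (1 - sqrt (qhat q)))"
    unfolding Q_def[symmetric] p_def[symmetric] by (simp add: mult_ac)
qed

text \<open>\<open>|sin t|\<close> is the distance of \<open>-1\<close> from the line of direction \<open>cis t\<close>.\<close>

lemma sin_le_norm_ray:
  "\<bar>sin t\<bar> \<le> norm (1 + cis t * of_real s)"
proof -
  have "1 + cis t * of_real s = cis t * (cis (- t) + of_real s)" by (simp add: distrib_left cis_mult)
  then have "norm (1 + cis t * of_real s) = norm (cis (- t) + of_real s)" by (simp add: norm_mult)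
  then show ?thesis using abs_Im_le_cmod[of "cis (- t) + of_real s"] by simp
qed

lemma mult_power_less_one:
  fixes c q :: real
  assumes q: "0 < q" "q < 1" and c: "0 < c" and N: "real N > - ln c / ln q"
  shows "c * q ^ N < 1"
proof -
  have "ln q < 0" using q by simp
  then have "real N * ln q < - ln c" using N neg_divide_less_eq[of "ln q" "- ln c" "real N"] by simp
  then have "ln (c * q ^ N) < 0" using q c by (simp add: ln_mult ln_realpow)
  then show ?thesis using q c by (simp add: ln_less_zero_iff)
qed

theorem theorem7p1:
  fixes q c M :: real and a b :: complex and N :: nat
  assumes q: "0 < q" "q < 1"
    and ab: "a \<noteq> 0" "b \<noteq> 0"
    and c: "c = max (norm a) (norm b)"
    and M: "M > 0"
      "\<And>t. Re t \<ge> 0 \<Longrightarrow> norm (u_fun q a b t) \<le> M * qpoch_inf (- c * q * norm t) q"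
    and N: "N \<ge> 1"
  shows
    "(\<forall>z. z \<noteq> 0 \<and> Re z \<ge> 0 \<longrightarrow>
        (real N > 1 - ln c / ln q \<longrightarrow>
          norm (R_E q a b N z) \<le> norm (z ^ N) * norm (K0 q a b)
            * (M * q powi (- int (N choose 2)) / qpoch_inf (c * q ^ N) q) \<and>
          norm (R_theta q a b N z) \<le> norm (z ^ N) * norm (K0 q a b)
            * (M * q powi (- int (N choose 2)) / qpoch_inf (c * q ^ N) q)) \<and>
        (real N > - ln c / ln q \<longrightarrow> (\<forall>lam::real. lam > 0 \<longrightarrow>
          norm (R_lambda q (of_real lam) a b N z) \<le> norm (z ^ N) * norm (K0 q a b)
            * (M * q powi (- int (N choose 2)) / qpoch_inf (c * q ^ N) q))))
     \<and>
     (real N > 1 - ln c / ln q \<longrightarrow>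
      (\<forall>z. z \<noteq> 0 \<and> \<bar>Arg z\<bar> \<in> {pi / 2<..<pi} \<longrightarrow>
        (let zeta = \<bar>Arg z\<bar> - pi / 2; xi = Arg z in
          norm (R_E q a b N z) \<le> norm (z ^ N) * norm (K0 q a b)
            * (M * exp (- zeta\<^sup>2 / (2 * ln q)) * q powi (- int (N choose 2))
               / qpoch_inf (c * q ^ N) q) \<and>
          norm (R_theta q a b N z) \<le> norm (z ^ N) * norm (K0 q a b)
            * (M * exp (- zeta\<^sup>2 / (2 * ln q)) * q powi (- int (N choose 2))
               / (qpoch_inf (c * q ^ N) q * qpoch_inf ((qhat q)\<^sup>2) ((qhat q)\<^sup>2) ^ 3))
            * ((1 + sqrt (qhat q)) / (1 - sqrt (qhat q))) \<and>
          (\<forall>lam::real. lam > 0 \<longrightarrow>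
            norm (R_lambda q (of_real lam) a b N z) \<le> norm (z ^ N) * norm (K0 q a b)
              * (M * q powi (- int (N choose 2)) / (qpoch_inf (c * q ^ N) q * \<bar>sin xi\<bar>))))))"
proof (intro conjI allI impI)
  have c0: "0 < c" using ab unfolding c by (simp add: less_max_iff_disj)
  have strict: "c * q ^ N < 1" if "real N > 1 - ln c / ln q"
    by (rule mult_power_less_one[OF q c0]) (use that in simp)
  {
    fix z :: complex assume z: "z \<noteq> 0 \<and> Re z \<ge> 0"
    then have z0: "z \<noteq> 0" and A: "\<bar>Arg z\<bar> \<le> pi / 2" using cos_sector by auto
    have A': "\<bar>Arg z\<bar> < pi" using A pi_gt_zero by linarith
    {
      assume "real N > 1 - ln c / ln q"
      note cN = strict[OF this]
      show "norm (R_E q a b N z) \<le> norm (z ^ N) * norm (K0 q a b)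
            * (M * q powi (- int (N choose 2)) / qpoch_inf (c * q ^ N) q)"
        using R_E_bound[OF q z0 A' _ A ab c cN M(2)] by simp
      show "norm (R_theta q a b N z) \<le> norm (z ^ N) * norm (K0 q a b)
            * (M * q powi (- int (N choose 2)) / qpoch_inf (c * q ^ N) q)"
        using R_theta_bound(1)[OF q z0 A' _ A ab c cN M(2) refl] by simp
    next
      fix lam :: real assume N': "real N > - ln c / ln q" and lam: "lam > 0"
      have "1 \<le> norm (1 + cis (Arg z) * of_real s)" if "s > 0" for s
        by (rule one_plus_norm_ge_1) (use that A in \<open>auto intro!: mult_nonneg_nonneg cos_ge_zero\<close>)
      from R_lambda_bound[OF q z0 A' lam zero_less_one this ab c mult_power_less_one[OF q c0 N'] M(2)]
      show "norm (R_lambda q (of_real lam) a b N z) \<le> norm (z ^ N) * norm (K0 q a b)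
            * (M * q powi (- int (N choose 2)) / qpoch_inf (c * q ^ N) q)" by simp
    }
  next
    fix z :: complex
    assume N': "real N > 1 - ln c / ln q" and z: "z \<noteq> 0 \<and> \<bar>Arg z\<bar> \<in> {pi / 2<..<pi}"
    note cN = strict[OF N']
    from z have z0: "z \<noteq> 0" and A: "pi / 2 < \<bar>Arg z\<bar>" "\<bar>Arg z\<bar> < pi" by auto
    \<comment> \<open>The half of the imaginary axis nearest to \<open>z\<close>; the angle between them is \<open>\<bar>Arg z\<bar> - pi / 2\<close>.\<close>
    define y where "y = (if Arg z > 0 then pi / 2 else - (pi / 2))"
    have yA: "\<bar>y - Arg z\<bar> = \<bar>Arg z\<bar> - pi / 2" using A by (auto simp: y_def)
    have y: "\<bar>y - Arg z\<bar> \<le> pi / 2" "\<bar>y\<bar> \<le> pi / 2" unfolding yA using A by (auto simp: y_def)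
    have sq: "(y - Arg z)\<^sup>2 = (\<bar>Arg z\<bar> - pi / 2)\<^sup>2" using yA by (metis power2_abs)
    have sin: "0 < \<bar>sin (Arg z)\<bar>"
    proof -
      have "0 < sin \<bar>Arg z\<bar>" using A by (intro sin_gt_zero) auto
      then show ?thesis by (auto simp: abs_if split: if_splits)
    qed
    show "let zeta = \<bar>Arg z\<bar> - pi / 2; xi = Arg z in
          norm (R_E q a b N z) \<le> norm (z ^ N) * norm (K0 q a b)
            * (M * exp (- zeta\<^sup>2 / (2 * ln q)) * q powi (- int (N choose 2))
               / qpoch_inf (c * q ^ N) q) \<and>
          norm (R_theta q a b N z) \<le> norm (z ^ N) * norm (K0 q a b)
            * (M * exp (- zeta\<^sup>2 / (2 * ln q)) * q powi (- int (N choose 2))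
               / (qpoch_inf (c * q ^ N) q * qpoch_inf ((qhat q)\<^sup>2) ((qhat q)\<^sup>2) ^ 3))
            * ((1 + sqrt (qhat q)) / (1 - sqrt (qhat q))) \<and>
          (\<forall>lam::real. lam > 0 \<longrightarrow>
            norm (R_lambda q (of_real lam) a b N z) \<le> norm (z ^ N) * norm (K0 q a b)
              * (M * q powi (- int (N choose 2)) / (qpoch_inf (c * q ^ N) q * \<bar>sin xi\<bar>)))"
      unfolding Let_def sq[symmetric]
    proof (intro conjI allI impI)
      show "norm (R_E q a b N z) \<le> norm (z ^ N) * norm (K0 q a b)
            * (M * exp (- (y - Arg z)\<^sup>2 / (2 * ln q)) * q powi (- int (N choose 2)) / qpoch_inf (c * q ^ N) q)"
        by (rule R_E_bound[OF q z0 A(2) y ab c cN M(2)])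
      show "norm (R_theta q a b N z) \<le> norm (z ^ N) * norm (K0 q a b)
            * (M * exp (- (y - Arg z)\<^sup>2 / (2 * ln q)) * q powi (- int (N choose 2))
               / (qpoch_inf (c * q ^ N) q * qpoch_inf ((qhat q)\<^sup>2) ((qhat q)\<^sup>2) ^ 3))
            * ((1 + sqrt (qhat q)) / (1 - sqrt (qhat q)))"
        by (rule R_theta_bound(2)[OF q z0 A(2) y ab c cN M(2)])
      fix lam :: real assume lam: "lam > 0"
      from R_lambda_bound[OF q z0 A(2) lam sin sin_le_norm_ray ab c cN M(2)]
      show "norm (R_lambda q (of_real lam) a b N z) \<le> norm (z ^ N) * norm (K0 q a b)
              * (M * q powi (- int (N choose 2)) / (qpoch_inf (c * q ^ N) q * \<bar>sin (Arg z)\<bar>))"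
        by (simp add: mult_ac)
    qed
  }
qed

end
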